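(* Let $P_1,P_2$ be probability measures on $\mathbb{R}^d$ with pdfs $p_1,p_2$ having nested supports $\Omega_{p_2}\subseteq\Omega_{p_1}$, such that $\mathbb{E}_{p_1}|h|<\infty$ for every $h\in\mathrm{Lip}(\Omega_{p_1},1)$. Suppose that $P_1$ has finite variance and satisfies a Poincaré inequality with Poincaré constant $C_{P_1}$. Assume that $p_2=\pi_0\,p_1$ with $\pi_0-\mathbb{E}_{p_1}\pi_0\in W^{1,2}_0(p_1)$. Then $$\mathcal{W}_1(P_1,P_2)\le C_{P_1}\sqrt{\mathbb{E}_{p_1}\|\nabla\pi_0\|^2}.$$
   Context: Each pdf $p$ (density with respect to Lebesgue measure) is assumed to have open support $\Omega_p=\{x:p(x)>0\}$ and to be continuous on $\Omega_p$. $\mathbb{E}_p f=\int_{\Omega_p}fp$. $\mathrm{Lip}(\Omega,1)$ is the set of Lipschitz functions $\Omega\to\mathbb{R}$ with Lipschitz constant $1$, and $\mathcal{W}_1(P_1,P_2)=\sup_{h\in\mathrm{Lip}(\Omega_{p_1},1)}|\int h\,dP_1-\int h\,dP_2|$. A probability distribution $P$ satisfies a Poincaré inequality if there is a constant $C<\infty$ such that for every locally Lipschitz function $\varphi\in L^2(P)$ with $\mathbb{E}_P\varphi=0$ one has $\mathbb{E}_P\varphi^2\le C\,\mathbb{E}_P\|\nabla\varphi\|^2$; the smallest such constant is the Poincaré constant $C_P$. $W^{1,2}(p)$ is the weighted Sobolev space of weakly differentiable functions $u:\Omega_p\to\mathbb{R}$ with $\|u\|_{W^{1,2}(p)}^2=\|u\|_{L^2(p)}^2+\|\nabla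 u\|_{L^2(p)}^2<\infty$. $W^{1,2}_0(p)$ is the subspace of those $u\in W^{1,2}(p)$ with $\mathbb{E}_p u=0$. *)

theory Defs
  imports "HOL-Probability.Probability"
begin

definition pdf_support :: "('a::euclidean_space \<Rightarrow> real) \<Rightarrow> 'a set" where
  "pdf_support p = {x. p x > 0}"

definition has_pdf :: "'a::euclidean_space measure \<Rightarrow> ('a \<Rightarrow> real) \<Rightarrow> bool" where
  "has_pdf P p \<longleftrightarrow>
     prob_space P \<and> p \<in> borel_measurable lborel \<and> (\<forall>x. 0 \<le> p x) \<and>
     P = density lborel (\<lambda>x. ennreal (p x)) \<and>
     open (pdf_support p) \<and> continuous_on (pdf_support p) p"

text \<open>
  A real function on the support is represented by a total function whose values outside the
  support are arbitrary: every notion below only looks at its values on the support.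
\<close>

definition pdf_integrable :: "('a::euclidean_space \<Rightarrow> real) \<Rightarrow> ('a \<Rightarrow> real) \<Rightarrow> bool" where
  "pdf_integrable p f \<longleftrightarrow> set_integrable lborel (pdf_support p) (\<lambda>x. f x * p x)"

definition pdf_expectation :: "('a::euclidean_space \<Rightarrow> real) \<Rightarrow> ('a \<Rightarrow> real) \<Rightarrow> real" where
  "pdf_expectation p f = (LINT x:pdf_support p|lborel. f x * p x)"

definition pdf_nn_expectation :: "('a::euclidean_space \<Rightarrow> real) \<Rightarrow> ('a \<Rightarrow> real) \<Rightarrow> ennreal" where
  "pdf_nn_expectation p f = (\<integral>\<^sup>+x\<in>pdf_support p. ennreal (f x * p x) \<partial>lborel)"

definition finite_variance :: "'a::euclidean_space measure \<Rightarrow> bool" where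
  "finite_variance P \<longleftrightarrow>
     integrable P (\<lambda>x. x) \<and>
     integrable P (\<lambda>x. (norm (x - integral\<^sup>L P (\<lambda>y. y)))\<^sup>2)"

text \<open>The space \<open>L\<^sup>2(p)\<close>, for scalar as well as for vector valued functions.\<close>

definition L2 :: "('a::euclidean_space \<Rightarrow> real) \<Rightarrow> ('a \<Rightarrow> 'b::euclidean_space) set" where
  "L2 p = {u. set_borel_measurable lborel (pdf_support p) u \<and>
              pdf_integrable p (\<lambda>x. (norm (u x))\<^sup>2)}"

definition Lip1 :: "'a::metric_space set \<Rightarrow> ('a \<Rightarrow> real) set" where
  "Lip1 \<Omega> = {h. 1-lipschitz_on \<Omega> h}"

text \<open>The supremum is taken in the extended reals, since it may be infinite.\<close>

definition wasserstein1 ::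
    "'a::euclidean_space set \<Rightarrow> 'a measure \<Rightarrow> 'a measure \<Rightarrow> ereal" where
  "wasserstein1 \<Omega> P Q =
     (SUP h\<in>Lip1 \<Omega>. ereal \<bar>(LINT x:\<Omega>|P. h x) - (LINT x:\<Omega>|Q. h x)\<bar>)"

text \<open>
  The library predicate concerns families of functions indexed by a time parameter; here the
  family is constant.
\<close>

definition locally_lipschitz_on :: "'a::metric_space set \<Rightarrow> ('a \<Rightarrow> real) \<Rightarrow> bool" where
  "locally_lipschitz_on \<Omega> f \<longleftrightarrow> local_lipschitz {0::real} \<Omega> (\<lambda>_. f)"

text \<open>
  Classical gradient. A locally Lipschitz function on an open set is differentiable almost
  everywhere (Rademacher), so the value \<open>0\<close> at the remaining points does not
  affect any integral.
\<close>

definition grad :: "('a::euclidean_space \<Rightarrow> real) \<Rightarrow> 'a \<Rightarrow> 'a" where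
  "grad f x = (if f differentiable (at x) then (THE g. GDERIV f x :> g) else 0)"

text \<open>
  The inequality and its constant are attached to the density rather than to the
  measure alone, because the test functions are those that are locally Lipschitz on its support.
  The right-hand side is an extended nonnegative real, so the inequality is vacuous when the
  gradient is not square integrable; \<open>0 \<le> C\<close> is required because
  \<open>ennreal\<close> maps negative reals to \<open>0\<close>.
\<close>

definition poincare_ineq :: "('a::euclidean_space \<Rightarrow> real) \<Rightarrow> real \<Rightarrow> bool" where
  "poincare_ineq p C \<longleftrightarrow>
     0 \<le> C \<and>
     (\<forall>\<phi>. locally_lipschitz_on (pdf_support p) \<phi> \<and> \<phi> \<in> L2 p \<and> pdf_expectation p \<phi> = 0 \<longrightarrow>
        pdf_nn_expectation p (\<lambda>x. (\<phi> x)\<^sup>2)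
          \<le> ennreal C * pdf_nn_expectation p (\<lambda>x. (norm (grad \<phi> x))\<^sup>2))"

definition satisfies_poincare :: "('a::euclidean_space \<Rightarrow> real) \<Rightarrow> bool" where
  "satisfies_poincare p \<longleftrightarrow> (\<exists>C. poincare_ineq p C)"

text \<open>For a density the infimum is attained whenever the set is nonempty, so it is the smallest constant.\<close>

definition poincare_constant :: "('a::euclidean_space \<Rightarrow> real) \<Rightarrow> real" where
  "poincare_constant p = Inf {C. poincare_ineq p C}"

text \<open>\<open>Ck k f\<close>: all partial derivatives of order at most \<open>k\<close> exist and are continuous.\<close>

primrec Ck :: "nat \<Rightarrow> ('a::euclidean_space \<Rightarrow> real) \<Rightarrow> bool" where
  "Ck 0 f \<longleftrightarrow> continuous_on UNIV f"
| "Ck (Suc k) f \<longleftrightarrow>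
     (\<forall>x. f differentiable (at x)) \<and>
     (\<forall>b\<in>Basis. Ck k (\<lambda>x. frechet_derivative f (at x) b))"

text \<open>The space \<open>C\<^sub>c\<^sup>\<infinity>(\<Omega>)\<close>, each function being extended by zero to the whole space.\<close>

definition test_functions :: "'a::euclidean_space set \<Rightarrow> ('a \<Rightarrow> real) set" where
  "test_functions \<Omega> =
     {\<psi>. (\<forall>k. Ck k \<psi>) \<and> (\<exists>K. compact K \<and> K \<subseteq> \<Omega> \<and> (\<forall>x. x \<notin> K \<longrightarrow> \<psi> x = 0))}"

definition locally_integrable_on ::
    "'a::euclidean_space set \<Rightarrow> ('a \<Rightarrow> 'b::euclidean_space) \<Rightarrow> bool" where
  "locally_integrable_on \<Omega> u \<longleftrightarrow> (\<forall>K. compact K \<and> K \<subseteq> \<Omega> \<longrightarrow> set_integrable lborel K u)"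

definition has_weak_gradient ::
    "'a::euclidean_space set \<Rightarrow> ('a \<Rightarrow> real) \<Rightarrow> ('a \<Rightarrow> 'a) \<Rightarrow> bool" where
  "has_weak_gradient \<Omega> u g \<longleftrightarrow>
     locally_integrable_on \<Omega> u \<and> locally_integrable_on \<Omega> g \<and>
     (\<forall>\<psi>\<in>test_functions \<Omega>. \<forall>b\<in>Basis.
        (LINT x:\<Omega>|lborel. u x * frechet_derivative \<psi> (at x) b)
          = - (LINT x:\<Omega>|lborel. (g x \<bullet> b) * \<psi> x))"

definition weakly_differentiable_on :: "'a::euclidean_space set \<Rightarrow> ('a \<Rightarrow> real) \<Rightarrow> bool" where
  "weakly_differentiable_on \<Omega> u \<longleftrightarrow> (\<exists>g. has_weak_gradient \<Omega> u g)"

text \<open>The weak gradient is unique up to a null set; some version of it is chosen.\<close>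

definition weak_grad :: "'a::euclidean_space set \<Rightarrow> ('a \<Rightarrow> real) \<Rightarrow> 'a \<Rightarrow> 'a" where
  "weak_grad \<Omega> u = (SOME g. has_weak_gradient \<Omega> u g)"

definition W12 :: "('a::euclidean_space \<Rightarrow> real) \<Rightarrow> ('a \<Rightarrow> real) set" where
  "W12 p = {u. u \<in> L2 p \<and> weakly_differentiable_on (pdf_support p) u \<and>
               weak_grad (pdf_support p) u \<in> L2 p}"

definition W12_0 :: "('a::euclidean_space \<Rightarrow> real) \<Rightarrow> ('a \<Rightarrow> real) set" where
  "W12_0 p = {u \<in> W12 p. pdf_expectation p u = 0}"

end

theory Submission
  imports Defs
begin

text \<open>
  For a 1-Lipschitz \<open>h\<close> the difference of the two integrals is, up to sign, the covariance of
  \<open>h\<close> and \<open>\<pi>0\<close> under \<open>P1\<close>, so by Cauchy--Schwarz it is at most the product of their standard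
  deviations; no Stein equation has to be solved. The Poincare inequality bounds the variance of
  \<open>h\<close> by \<open>C\<close> and that of \<open>\<pi>0\<close> by \<open>C\<close> times its Dirichlet energy. The inequality is only assumed
  for locally Lipschitz functions; a weighted Meyers--Serrin approximation carries it over to the
  Sobolev space.
\<close>

section \<open>Smooth functions and mollifiers\<close>

text \<open>Each of the two standard deviations contributes a factor sqrt C, whence the first power
  of C in the bound. The real work is the passage to weak gradients. The boundary of the support is
  arbitrary and the density may tend to 0 or become unbounded there, so mollification at one global
  scale is not controlled in the weighted norm; the scale has to shrink towards the boundary. The
  approximants must also belong to the test class of \<open>poincare_ineq\<close>, with their
  classical \<open>grad\<close> close to the weak gradient. So that the limit keeps C itself and not
  a multiple of it, errors are absorbed by Young's inequality with a parameter t that tends to 0.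
  The mean of \<open>\<pi>0\<close> is 1 because \<open>p2\<close> has mass 1. The hypothesis speaks
  of \<open>\<pi>0\<close> minus this constant and the conclusion of the weak gradient of
  \<open>\<pi>0\<close>; the two are linked by the fact that partial derivatives of test functions
  have integral 0. The estimate is proved for every admissible C and then passed to the
  infimum.\<close>

definition smooth :: "('a::euclidean_space \<Rightarrow> real) \<Rightarrow> bool" where
  "smooth f \<longleftrightarrow> (\<forall>k. Ck k f)"

abbreviation pd :: "'a::euclidean_space \<Rightarrow> ('a \<Rightarrow> real) \<Rightarrow> 'a \<Rightarrow> real" where
  "pd b f \<equiv> \<lambda>x. frechet_derivative f (at x) b"

section \<open>Closure properties of k times continuously differentiable functions\<close>

lemma Ck_imp_continuous: "Ck k f \<Longrightarrow> continuous_on UNIV f"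
proof (cases k)
  case (Suc m)
  assume "Ck k f"
  then show ?thesis
    using Suc by (auto intro!: continuous_at_imp_continuous_on differentiable_imp_continuous_within)
qed simp

text \<open>\<open>Ck (Suc k)\<close> records only differentiability and the regularity of the
  partial derivatives, so lower orders are recovered by induction, with continuity of a
  differentiable function as base case. The product rule relies on this, since its terms contain
  underived factors.\<close>

lemma Ck_SucD: "Ck (Suc k) f \<Longrightarrow> Ck k f"
proof (induction k arbitrary: f)
  case 0
  then show ?case using Ck_imp_continuous[of "Suc 0"] by simp
next
  case (Suc k)
  then show ?case by (metis Ck.simps(2))
qed

lemma pd_eqI: "(f has_derivative D) (at x) \<Longrightarrow> pd b f x = D b"
  by (metis frechet_derivative_at)

lemma Ck_const: "Ck k (\<lambda>x. c)"
  by (induction k arbitrary: c) (auto simp: frechet_derivative_const)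

lemma pd_add:
  assumes "f differentiable (at x)" "g differentiable (at x)"
  shows "pd b (\<lambda>x. f x + g x) x = pd b f x + pd b g x"
  using assms
  by (intro pd_eqI) (auto intro!: derivative_eq_intros simp: frechet_derivative_works[symmetric])

lemma Ck_add: "Ck k f \<Longrightarrow> Ck k g \<Longrightarrow> Ck k (\<lambda>x. f x + g x)"
proof (induction k arbitrary: f g)
  case (Suc k)
  have "pd b (\<lambda>x. f x + g x) = (\<lambda>x. pd b f x + pd b g x)" for b
    using Suc.prems by (intro ext pd_add) auto
  then show ?case using Suc by auto
qed (auto intro: continuous_intros)

lemma pd_mult:
  assumes "f differentiable (at x)" "g differentiable (at x)"
  shows "pd b (\<lambda>x. f x * g x) x = f x * pd b g x + pd b f x * g x"
  using assms
  by (intro pd_eqI) (auto intro!: derivative_eq_intros simp: frechet_derivative_works[symmetric])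

lemma Ck_mult: "Ck k f \<Longrightarrow> Ck k g \<Longrightarrow> Ck k (\<lambda>x. f x * g x)"
proof (induction k arbitrary: f g)
  case (Suc k)
  have "pd b (\<lambda>x. f x * g x) = (\<lambda>x. f x * pd b g x + pd b f x * g x)" for b
    using Suc.prems by (intro ext pd_mult) auto
  then show ?case using Suc Ck_SucD[of k f] Ck_SucD[of k g]
    by (auto intro!: Ck_add Suc.IH)
qed (auto intro: continuous_intros)

lemma Ck_sum: "finite A \<Longrightarrow> (\<And>i. i \<in> A \<Longrightarrow> Ck k (f i)) \<Longrightarrow> Ck k (\<lambda>x. \<Sum>i\<in>A. f i x)"
  by (induction A rule: finite_induct) (auto intro: Ck_const Ck_add)

lemma Ck_inner: "Ck k (\<lambda>x::'a::euclidean_space. x \<bullet> c)"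
proof (cases k)
  case (Suc m)
  have d: "((\<lambda>x. x \<bullet> c) has_derivative (\<lambda>h. h \<bullet> c)) (at x)" for x :: 'a
    by (auto intro!: derivative_eq_intros)
  have "pd b (\<lambda>x. x \<bullet> c) = (\<lambda>x. b \<bullet> c)" for b
    using pd_eqI[OF d] by auto
  then show ?thesis using d Suc by (auto simp: differentiable_def intro: Ck_const)
qed (auto intro: continuous_intros)

lemma Ck_inner_self: "Ck k (\<lambda>x::'a::euclidean_space. x \<bullet> x)"
proof -
  have "(\<lambda>x::'a. x \<bullet> x) = (\<lambda>x. \<Sum>b\<in>Basis. (x \<bullet> b) * (x \<bullet> b))"
    by (intro ext euclidean_inner)
  then show ?thesis by (auto intro!: Ck_sum Ck_mult Ck_inner)
qed

text \<open>\<open>F\<close> is the whole sequence of successive derivatives of \<open>F 0\<close>.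
  Stating the claim for all \<open>n\<close> closes the induction: a partial derivative of
  \<open>F n\<close> after \<open>g\<close> is a smooth factor times \<open>F (Suc n)\<close> after
  \<open>g\<close>.\<close>

lemma Ck_compose_real:
  fixes F :: "nat \<Rightarrow> real \<Rightarrow> real" and g :: "'a::euclidean_space \<Rightarrow> real"
  assumes F: "\<And>n t. (F n has_real_derivative F (Suc n) t) (at t)" and g: "smooth g"
  shows "Ck k (\<lambda>x. F n (g x))"
proof (induction k arbitrary: n)
  case 0
  have "continuous_on UNIV (F n)"
    using F by (meson DERIV_isCont continuous_at_imp_continuous_on)
  moreover have "continuous_on UNIV g" using g Ck_imp_continuous smooth_def by blast
  ultimately show ?case using continuous_on_compose2 by fastforce
next
  case (Suc k)
  have gd: "g differentiable (at x)" for x using g by (auto simp: smooth_def dest: spec[of _ "Suc 0"])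
  have d: "((\<lambda>x. F n (g x)) has_derivative (\<lambda>h. frechet_derivative g (at x) h * F (Suc n) (g x))) (at x)" for x
    by (rule DERIV_compose_FDERIV[OF F gd[unfolded frechet_derivative_works]])
  have "pd b (\<lambda>x. F n (g x)) = (\<lambda>x. pd b g x * F (Suc n) (g x))" for b
    using pd_eqI[OF d] by auto
  moreover have "Ck k (pd b g)" if "b \<in> Basis" for b
    using g that unfolding smooth_def by (metis Ck.simps(2))
  ultimately show ?case using d Suc by (auto simp: differentiable_def intro!: Ck_mult)
qed

text \<open>Needed to insert the reflected kernel, \<open>r (x - y)\<close> as a function of
  \<open>y\<close>, as a test function in the definition of weak gradients.\<close>

lemma Ck_reflect: "Ck k f \<Longrightarrow> Ck k (\<lambda>y. f (a - y))"
proof (induction k arbitrary: f)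
  case 0
  then show ?case by (auto intro!: continuous_on_compose2[of UNIV f] continuous_intros)
next
  case (Suc k)
  have d: "((\<lambda>y. f (a - y)) has_derivative (\<lambda>h. frechet_derivative f (at (a - y)) (- h))) (at y)" for y
  proof -
    have f: "(f has_derivative frechet_derivative f (at (a - y))) (at (a - y))"
      using Suc.prems by (simp add: frechet_derivative_works[symmetric])
    have "((\<lambda>y. a - y) has_derivative (\<lambda>h. - h)) (at y)"
      by (auto intro!: derivative_eq_intros)
    from has_derivative_compose[OF this f] show ?thesis .
  qed
  have "pd b (\<lambda>y. f (a - y)) = (\<lambda>y. (- 1) * pd b f (a - y))" for b
  proof
    fix y
    have "linear (frechet_derivative f (at (a - y)))"
      using Suc.prems by (auto intro: linear_frechet_derivative)
    then show "pd b (\<lambda>y. f (a - y)) y = (- 1) * pd b f (a - y)"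
      using pd_eqI[OF d] by (simp add: linear_neg)
  qed
  moreover have "Ck k (\<lambda>y. (- 1) * pd b f (a - y))" if "b \<in> Basis" for b
    using Suc that by (intro Ck_mult Ck_const Suc.IH) auto
  ultimately show ?case using d by (simp only: Ck.simps differentiable_def) blast
qed

lemma smooth_differentiable: "smooth f \<Longrightarrow> f differentiable (at x)"
  by (auto simp: smooth_def dest: spec[of _ "Suc 0"])

lemma smooth_has_derivative: "smooth f \<Longrightarrow> (f has_derivative frechet_derivative f (at x)) (at x)"
  using smooth_differentiable frechet_derivative_works by blast

lemma smooth_pd: "smooth f \<Longrightarrow> b \<in> Basis \<Longrightarrow> smooth (pd b f)"
  unfolding smooth_def by (metis Ck.simps(2))

lemma smooth_continuous: "smooth f \<Longrightarrow> continuous_on UNIV f"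
  using Ck_imp_continuous smooth_def by blast

lemma smooth_continuous_pd: "smooth f \<Longrightarrow> b \<in> Basis \<Longrightarrow> continuous_on UNIV (pd b f)"
  by (simp add: smooth_continuous smooth_pd)

lemma smooth_const: "smooth (\<lambda>x. c)"
  and smooth_add: "smooth f \<Longrightarrow> smooth g \<Longrightarrow> smooth (\<lambda>x. f x + g x)"
  and smooth_mult: "smooth f \<Longrightarrow> smooth g \<Longrightarrow> smooth (\<lambda>x. f x * g x)"
  and smooth_reflect: "smooth f \<Longrightarrow> smooth (\<lambda>y. f (a - y))"
  by (auto simp: smooth_def intro: Ck_const Ck_add Ck_mult Ck_reflect)

lemma smooth_cmult: "smooth f \<Longrightarrow> smooth (\<lambda>x. c * f x)"
  by (intro smooth_mult smooth_const)

lemma smooth_diff: "smooth f \<Longrightarrow> smooth g \<Longrightarrow> smooth (\<lambda>x. f x - g x)"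
  using smooth_add[of f "\<lambda>x. (-1) * g x"] smooth_cmult[of g "-1"] by simp

section \<open>A smooth function that is flat at 0, and mollifiers\<close>

text \<open>\<open>bump_deriv n\<close> is the \<open>n\<close>-th derivative of \<open>exp (- 1 / t)\<close>, extended by \<open>0\<close> to \<open>t \<le> 0\<close>.\<close>

fun bump_poly :: "nat \<Rightarrow> real poly" where
  "bump_poly 0 = 1"
| "bump_poly (Suc n) = monom 1 2 * (bump_poly n - pderiv (bump_poly n))"

definition bump_deriv :: "nat \<Rightarrow> real \<Rightarrow> real" where
  "bump_deriv n t = (if t > 0 then poly (bump_poly n) (1 / t) * exp (- (1 / t)) else 0)"

lemma poly_exp_tendsto_0: "((\<lambda>s::real. poly P s * exp (- s)) \<longlongrightarrow> 0) at_top"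
proof -
  have "((\<lambda>s. \<Sum>i\<le>degree P. coeff P i * (s ^ i / exp s)) \<longlongrightarrow> (\<Sum>i\<le>degree P. coeff P i * 0)) at_top"
    by (intro tendsto_sum tendsto_mult tendsto_const tendsto_power_div_exp_0)
  moreover have "(\<lambda>s. \<Sum>i\<le>degree P. coeff P i * (s ^ i / exp s)) = (\<lambda>s. poly P s * exp (- s))"
    by (auto simp: poly_altdef sum_distrib_right exp_minus divide_inverse mult.assoc)
  ultimately show ?thesis by simp
qed

text \<open>With s = 1/t the operator d/dt becomes - s^2 d/ds and sends P(s) exp(-s) to s^2 (P -
  P')(s) exp(-s), which is the recursion of \<open>bump_poly\<close>. At 0 the right difference
  quotient is s P(s) exp(-s) with s tending to infinity, still a polynomial times exp(-s), so it
  vanishes in the limit.\<close>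

lemma bump_deriv_has_derivative: "(bump_deriv n has_real_derivative bump_deriv (Suc n) t) (at t)"
proof -
  consider "t > 0" | "t < 0" | "t = 0" by linarith
  then show ?thesis
  proof cases
    case 1
    have d: "((\<lambda>t. poly (bump_poly n) (1 / t) * exp (- (1 / t))) has_real_derivative bump_deriv (Suc n) t) (at t)"
      using 1 unfolding bump_deriv_def
      by (auto intro!: derivative_eq_intros poly_DERIV[THEN DERIV_chain2] simp: poly_monom field_simps power2_eq_square)
    show ?thesis
      by (rule has_field_derivative_transform_within_open[OF d, of "{0<..}"]) (use 1 in \<open>auto simp: bump_deriv_def\<close>)
  next
    case 2
    have d: "((\<lambda>t. 0) has_real_derivative bump_deriv (Suc n) t) (at t)"
      using 2 by (simp add: bump_deriv_def)
    show ?thesis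
      by (rule has_field_derivative_transform_within_open[OF d, of "{..<0}"]) (use 2 in \<open>auto simp: bump_deriv_def\<close>)
  next
    case 3
    have "((\<lambda>h. (bump_deriv n h - bump_deriv n 0) / h) \<longlongrightarrow> 0) (at_right 0)"
    proof -
      have "((\<lambda>h. poly (monom 1 1 * bump_poly n) (inverse h) * exp (- inverse h)) \<longlongrightarrow> 0) (at_right (0::real))"
        using filterlim_compose[OF poly_exp_tendsto_0 filterlim_inverse_at_top_right] .
      moreover have "\<forall>\<^sub>F h in at_right 0. poly (monom 1 1 * bump_poly n) (inverse h) * exp (- inverse h)
          = (bump_deriv n h - bump_deriv n 0) / h"
        by (rule eventually_at_rightI[of 0 1]) (auto simp: bump_deriv_def poly_monom field_simps)
      ultimately show ?thesis by (rule Lim_transform_eventually)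
    qed
    moreover have "((\<lambda>h. (bump_deriv n h - bump_deriv n 0) / h) \<longlongrightarrow> 0) (at_left 0)"
    proof -
      have "\<forall>\<^sub>F h in at_left (0::real). 0 = (bump_deriv n h - bump_deriv n 0) / h"
        by (rule eventually_at_leftI[of "-1"]) (auto simp: bump_deriv_def)
      then show ?thesis by (rule Lim_transform_eventually[OF tendsto_const])
    qed
    ultimately have "((\<lambda>h. (bump_deriv n h - bump_deriv n 0) / h) \<longlongrightarrow> 0) (at 0)"
      by (rule filterlim_split_at[rotated])
    then show ?thesis using 3 by (simp add: DERIV_def bump_deriv_def)
  qed
qed

text \<open>\<open>d\<close> only bounds the radius of the support from above, so a single kernel
  can meet several smallness conditions at once by taking a minimum. No symmetry of the kernel is
  built in.\<close>

definition mollifier :: "real \<Rightarrow> ('a::euclidean_space \<Rightarrow> real) \<Rightarrow> bool" where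
  "mollifier d r \<longleftrightarrow> smooth r \<and> (\<forall>x. 0 \<le> r x) \<and> (\<forall>x. d \<le> norm x \<longrightarrow> r x = 0) \<and>
     integrable lborel r \<and> (LINT x|lborel. r x) = 1"

lemma integrable_continuous_bounded_support:
  fixes f :: "'a::euclidean_space \<Rightarrow> 'b::euclidean_space"
  assumes "continuous_on UNIV f" "\<And>x. R \<le> norm x \<Longrightarrow> f x = 0"
  shows "integrable lborel f"
proof -
  have "set_integrable lborel (cball 0 R) f"
    unfolding set_integrable_def
    using assms(1) by (intro borel_integrable_compact) (auto intro: continuous_on_subset)
  moreover have "(\<lambda>x. indicator (cball 0 R) x *\<^sub>R f x) = f"
    using assms(2) by (auto simp: indicator_def) 
  ultimately show ?thesis by (simp add: set_integrable_def)
qed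

text \<open>The flat function is composed with d^2 - |x|^2, a polynomial in the coordinates and
  hence smooth also at the origin, and then normalised. Its integral is nonzero because the set
  where it is positive is open and nonempty, hence not a null set.\<close>

lemma mollifier_exists:
  assumes "0 < d"
  shows "\<exists>r :: 'a::euclidean_space \<Rightarrow> real. mollifier d r"
proof -
  define f :: "'a \<Rightarrow> real" where "f x = bump_deriv 0 (d\<^sup>2 + (- 1) * (x \<bullet> x))" for x
  have sm: "smooth f"
  proof -
    have "smooth (\<lambda>x::'a. d\<^sup>2 + (- 1) * (x \<bullet> x))"
      by (intro smooth_add smooth_cmult smooth_const) (simp add: smooth_def Ck_inner_self)
    then show ?thesis unfolding smooth_def f_def
      using Ck_compose_real[of bump_deriv, OF bump_deriv_has_derivative] smooth_def by blast
  qed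
  have nn: "0 \<le> f x" for x by (simp add: f_def bump_deriv_def)
  have supp: "f x = 0" if "d \<le> norm x" for x
  proof -
    have "d\<^sup>2 \<le> (norm x)\<^sup>2" using that assms by (intro power_mono) auto
    then show ?thesis by (simp add: f_def bump_deriv_def power2_norm_eq_inner)
  qed
  have int: "integrable lborel f"
    using sm supp by (intro integrable_continuous_bounded_support smooth_continuous)
  have f0: "f 0 > 0" using assms by (simp add: f_def bump_deriv_def)
  have "(LINT x|lborel. f x) \<noteq> 0"
  proof
    assume "(LINT x|lborel. f x) = 0"
    then have ae: "AE x in lborel. f x = 0"
      using integral_nonneg_eq_0_iff_AE[OF int] nn by auto
    have "f x = 0" if "open {x. f x > 0}" for x
    proof (rule ccontr)
      assume "f x \<noteq> 0"
      then have "\<not> negligible {x. f x > 0}"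
        using nn[of x] that by (intro open_not_negligible) (auto simp: order_less_le)
      moreover have "emeasure lborel {x. f x > 0} = 0"
      proof -
        have "{x. f x > 0} = {x \<in> space lborel. f x \<noteq> 0}" using nn by (auto simp: order_less_le)
        then show ?thesis using ae AE_iff_measurable[of "{x. f x > 0}" lborel "\<lambda>x. f x = 0"] that by simp
      qed
      ultimately show False
        using that by (simp add: negligible_iff_null_sets null_sets_def)
    qed
    moreover have "open {x. f x > 0}"
      using smooth_continuous[OF sm] by (intro open_Collect_less) (auto intro: continuous_intros)
    ultimately have "f 0 = 0" by blast
    then show False using f0 by auto
  qed
  then have pos: "(LINT x|lborel. f x) > 0"
    using nn by (simp add: Bochner_Integration.integral_nonneg order_less_le)
  have "mollifier d (\<lambda>x. inverse (LINT x|lborel. f x) * f x)"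
    unfolding mollifier_def using sm nn supp int pos by (auto intro: smooth_cmult)
  then show ?thesis by blast
qed

section \<open>Convolution\<close>

definition bounded_support :: "('a::euclidean_space \<Rightarrow> real) \<Rightarrow> bool" where
  "bounded_support f \<longleftrightarrow> (\<exists>R. \<forall>x. R \<le> norm x \<longrightarrow> f x = 0)"

lemma frechet_derivative_expand:
  assumes "f differentiable (at x)"
  shows "frechet_derivative f (at x) h = (\<Sum>b\<in>Basis. (h \<bullet> b) * pd b f x)"
proof -
  have "linear (frechet_derivative f (at x))"
    using assms by (rule linear_frechet_derivative)
  then have "frechet_derivative f (at x) (\<Sum>b\<in>Basis. (h \<bullet> b) *\<^sub>R b) = (\<Sum>b\<in>Basis. (h \<bullet> b) * pd b f x)"
    by (simp add: linear_sum linear_scale)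
  then show ?thesis by (simp add: euclidean_representation)
qed

lemma bounded_support_pd:
  assumes "bounded_support f"
  shows "bounded_support (pd b f)"
proof -
  obtain R where R: "\<And>x. R \<le> norm x \<Longrightarrow> f x = 0"
    using assms by (auto simp: bounded_support_def)
  have "pd b f x = 0" if "R + 1 \<le> norm x" for x
  proof -
    have o: "open {x::'a. R < norm x}" by (intro open_Collect_less continuous_intros)
    have d: "((\<lambda>x. 0) has_derivative (\<lambda>h. 0)) (at x)" by simp
    have "(f has_derivative (\<lambda>h. 0)) (at x)"
      by (rule has_derivative_transform_within_open[OF d o]) (use that R in auto)
    then show ?thesis by (rule pd_eqI)
  qed
  then show ?thesis unfolding bounded_support_def by blast
qed

lemma bounded_support_bounded:
  assumes "continuous_on UNIV f" "bounded_support f"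
  obtains M where "0 < M" "\<And>x. \<bar>f x\<bar> \<le> M"
proof -
  obtain R where R: "\<And>x. R \<le> norm x \<Longrightarrow> f x = 0"
    using assms by (auto simp: bounded_support_def)
  have "compact (f ` cball 0 R)"
    using assms(1) by (intro compact_continuous_image) (auto intro: continuous_on_subset)
  then obtain M where "0 < M" "\<And>y. y \<in> f ` cball 0 R \<Longrightarrow> norm y \<le> M"
    using compact_imp_bounded bounded_pos by metis
  then show ?thesis using R that[of M]
    by (metis abs_zero image_eqI linear mem_cball_0 order_less_imp_le real_norm_def)
qed

lemma bounded_support_uniformly_continuous:
  assumes "continuous_on UNIV f" "bounded_support f"
  shows "uniformly_continuous_on UNIV f"
proof -
  obtain R where R: "\<And>x. R \<le> norm x \<Longrightarrow> f x = 0"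
    using assms by (auto simp: bounded_support_def)
  have u: "uniformly_continuous_on (cball 0 (R + 1)) f"
    using assms(1) by (intro compact_uniformly_continuous) (auto intro: continuous_on_subset)
  show ?thesis unfolding uniformly_continuous_on_def
  proof (intro allI impI)
    fix e :: real assume "0 < e"
    then obtain d where d: "d > 0"
      "\<And>x y. x \<in> cball 0 (R + 1) \<Longrightarrow> y \<in> cball 0 (R + 1) \<Longrightarrow> dist y x < d \<Longrightarrow> dist (f y) (f x) < e"
      using u unfolding uniformly_continuous_on_def by metis
    \<comment> \<open>The bound 1 matches the margin between the radii \<open>R\<close> and
      \<open>R + 1\<close>: if one of the points leaves the larger ball, then both lie outside the
      smaller one, where \<open>f\<close> vanishes.\<close>
    have "dist (f y) (f x) < e" if "dist y x < min d 1" for x y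
    proof (cases "x \<in> cball 0 (R + 1) \<and> y \<in> cball 0 (R + 1)")
      case True
      then show ?thesis using d that by auto
    next
      case False
      have "\<bar>norm x - norm y\<bar> < 1" 
        using that norm_triangle_ineq3[of y x] by (auto simp: dist_norm)
      then have "f x = 0" "f y = 0" using R False by auto
      then show ?thesis using \<open>0 < e\<close> by simp
    qed
    then show "\<exists>d>0. \<forall>x\<in>UNIV. \<forall>x'\<in>UNIV. dist x' x < d \<longrightarrow> dist (f x') (f x) < e"
      using d(1) by (intro exI[of _ "min d 1"]) auto
  qed
qed

text \<open>The partial derivatives have bounded support and are therefore uniformly continuous; the
  mean value inequality on a ball turns this into a remainder estimate uniform in \<open>z\<close>,
  as needed to differentiate under an integral. The tolerance is divided by the dimension because
  the difference of two derivatives is a sum over the basis.\<close>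

lemma smooth_uniformly_differentiable:
  fixes r :: "'a::euclidean_space \<Rightarrow> real"
  assumes r: "smooth r" "bounded_support r" and e: "0 < e"
  shows "\<exists>d>0. \<forall>z h. norm h < d \<longrightarrow> \<bar>r (z + h) - r z - frechet_derivative r (at z) h\<bar> \<le> e * norm h"
proof -
  let ?e = "e / DIM('a)"
  have "\<exists>d>0. \<forall>w z. dist w z < d \<longrightarrow> \<bar>pd b r w - pd b r z\<bar> < ?e" if "b \<in> Basis" for b
  proof -
    have "uniformly_continuous_on UNIV (pd b r)"
      by (rule bounded_support_uniformly_continuous[OF smooth_continuous_pd[OF r(1) that] bounded_support_pd[OF r(2)]])
    moreover have "?e > 0" using e by simp
    ultimately obtain d where "d > 0" "\<forall>x\<in>UNIV. \<forall>x'\<in>UNIV. dist x' x < d \<longrightarrow> dist (pd b r x') (pd b r x) < ?e"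
      unfolding uniformly_continuous_on_def by blast
    then show ?thesis by (intro exI[of _ d]) (auto simp: dist_real_def)
  qed
  then obtain D where D: "\<And>b. b \<in> Basis \<Longrightarrow> D b > 0"
    "\<And>b w z. b \<in> Basis \<Longrightarrow> dist w z < D b \<Longrightarrow> \<bar>pd b r w - pd b r z\<bar> < ?e"
    by metis
  define d where "d = Min (D ` Basis)"
  have dpos: "d > 0" using D(1) by (simp add: d_def)
  have D2: "\<bar>pd b r w - pd b r z\<bar> < ?e" if "b \<in> Basis" "dist w z < d" for b w z
    using that D(2) by (auto simp: d_def)
  have "\<bar>r (z + h) - r z - frechet_derivative r (at z) h\<bar> \<le> e * norm h" if h: "norm h < d" for z h
  proof -
    have "norm (r (z + h) - r z - frechet_derivative r (at z) (z + h - z)) \<le> norm (z + h - z) * e"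
    proof (rule differentiable_bound_linearization[where S="ball z d"])
      show "z + t *\<^sub>R (z + h - z) \<in> ball z d" if "t \<in> {0..1}" for t
        using that h mult_right_le_one_le[of "norm h" t] by (auto simp: dist_norm mult.commute)
      show "(r has_derivative frechet_derivative r (at x)) (at x within ball z d)" for x
        by (rule has_derivative_at_withinI[OF smooth_has_derivative[OF r(1)]])
      show "onorm (frechet_derivative r (at x) - frechet_derivative r (at z)) \<le> e" if "x \<in> ball z d" for x
      proof (rule onorm_le)
        fix k :: 'a
        have "norm ((frechet_derivative r (at x) - frechet_derivative r (at z)) k)
            = norm (\<Sum>b\<in>Basis. (k \<bullet> b) * (pd b r x - pd b r z))"
          by (simp add: frechet_derivative_expand[OF smooth_differentiable[OF r(1)], of _ k] sum_subtractf right_diff_distrib)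
        also have "\<dots> \<le> (\<Sum>b\<in>(Basis :: 'a set). norm k * ?e)"
        proof (rule sum_norm_le)
          fix b :: 'a assume b: "b \<in> Basis"
          show "norm ((k \<bullet> b) * (pd b r x - pd b r z)) \<le> norm k * ?e"
            unfolding norm_mult
            using D2[OF b, of x z] that Basis_le_norm[OF b, of k]
            by (intro mult_mono) (auto simp: dist_commute)
        qed
        also have "\<dots> = e * norm k" by simp
        finally show "norm ((frechet_derivative r (at x) - frechet_derivative r (at z)) k) \<le> e * norm k" .
      qed
      show "z \<in> ball z d" using dpos by simp
    qed
    then show ?thesis by (simp add: mult.commute)
  qed
  then show ?thesis using dpos by blast
qed

text \<open>The two arguments play different roles: \<open>f\<close> is merely integrable, and all
  regularity sits in the kernel \<open>r\<close>, which receives every derivative.\<close>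

definition conv :: "('a::euclidean_space \<Rightarrow> real) \<Rightarrow> ('a \<Rightarrow> real) \<Rightarrow> 'a \<Rightarrow> real" where
  "conv f r x = (LINT y|lborel. f y * r (x - y))"

lemma integrable_conv:
  assumes f: "integrable lborel f" and r: "continuous_on UNIV r" "bounded_support r"
  shows "integrable lborel (\<lambda>y. f y * r (x - y))"
proof -
  obtain M where M: "0 < M" "\<And>x. \<bar>r x\<bar> \<le> M" using bounded_support_bounded[OF r] by blast
  have [measurable]: "r \<in> borel_measurable borel"
    using r(1) by (rule borel_measurable_continuous_onI)
  have [measurable]: "f \<in> borel_measurable borel" using f by auto
  show ?thesis
  proof (rule Bochner_Integration.integrable_bound)
    show "integrable lborel (\<lambda>y. f y * M)" using f by simp
    show "AE y in lborel. norm (f y * r (x - y)) \<le> norm (f y * M)"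
      using M by (intro always_eventually allI) (auto simp: abs_mult intro!: mult_left_mono)
  qed measurable
qed

text \<open>The first-order remainder of \<open>r\<close> is at most e / (I + 1) |h|, uniformly in
  the base point, so against |f|, whose integral is I, it contributes at most I / (I + 1) e |h|.
  Using I + 1 avoids a division by zero when \<open>f\<close> vanishes almost everywhere.\<close>

lemma conv_has_derivative:
  assumes f: "integrable lborel f" and r: "smooth r" "bounded_support r"
  shows "(conv f r has_derivative (\<lambda>h. \<Sum>b\<in>Basis. (h \<bullet> b) * conv f (pd b r) x)) (at x)"
  unfolding has_derivative_at_alt
proof (intro conjI allI impI)
  show "bounded_linear (\<lambda>h. \<Sum>b\<in>Basis. (h \<bullet> b) * conv f (pd b r) x)"
    by (intro bounded_linear_sum bounded_linear_mult_const bounded_linear_inner_left)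
  fix e :: real assume e: "0 < e"
  define I where "I = (LINT z|lborel. \<bar>f z\<bar>)"
  have I: "I \<ge> 0" by (simp add: I_def)
  have "e / (I + 1) > 0" using e I by simp
  from smooth_uniformly_differentiable[OF r this]
  obtain d where d: "0 < d"
    "\<And>z h. norm h < d \<Longrightarrow> \<bar>r (z + h) - r z - frechet_derivative r (at z) h\<bar> \<le> e / (I + 1) * norm h"
    by metis
  have "norm (conv f r y - conv f r x - (\<Sum>b\<in>Basis. ((y - x) \<bullet> b) * conv f (pd b r) x)) \<le> e * norm (y - x)"
    if y: "norm (y - x) < d" for y
  proof -
    note ic = integrable_conv[OF f smooth_continuous[OF r(1)] r(2)]
    have icb: "integrable lborel (\<lambda>z. f z * pd b r (x - z))" if "b \<in> Basis" for b
      by (rule integrable_conv[OF f smooth_continuous_pd[OF r(1) that] bounded_support_pd[OF r(2)]])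
    let ?g = "\<lambda>z. f z * r (y - z) - f z * r (x - z) - (\<Sum>b\<in>Basis. ((y - x) \<bullet> b) * (f z * pd b r (x - z)))"
    have ih: "integrable lborel (\<lambda>z. f z * r (y - z) - f z * r (x - z))"
      by (intro Bochner_Integration.integrable_diff ic)
    have ib: "integrable lborel (\<lambda>z. \<Sum>b\<in>Basis. ((y - x) \<bullet> b) * (f z * pd b r (x - z)))"
      by (intro Bochner_Integration.integrable_sum integrable_mult_right icb)
    have gi: "integrable lborel ?g"
      by (intro Bochner_Integration.integrable_diff ih ib)
    have "(LINT z|lborel. (\<Sum>b\<in>Basis. ((y - x) \<bullet> b) * (f z * pd b r (x - z))))
        = (\<Sum>b\<in>Basis. ((y - x) \<bullet> b) * conv f (pd b r) x)"
      unfolding conv_def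
      by (subst Bochner_Integration.integral_sum) (auto intro!: sum.cong integrable_mult_right icb)
    moreover have "(LINT z|lborel. f z * r (y - z) - f z * r (x - z)) = conv f r y - conv f r x"
      unfolding conv_def by (intro Bochner_Integration.integral_diff ic)
    ultimately have "norm (conv f r y - conv f r x - (\<Sum>b\<in>Basis. ((y - x) \<bullet> b) * conv f (pd b r) x))
        = norm (LINT z|lborel. ?g z)"
      using Bochner_Integration.integral_diff[OF ih ib] by simp
    also have "\<dots> \<le> (LINT z|lborel. norm (?g z))" by (rule integral_norm_bound)
    also have "\<dots> \<le> (LINT z|lborel. \<bar>f z\<bar> * (e / (I + 1) * norm (y - x)))"
    proof (rule integral_mono)
      show "integrable lborel (\<lambda>z. norm (?g z))" by (rule integrable_norm[OF gi])
      show "integrable lborel (\<lambda>z. \<bar>f z\<bar> * (e / (I + 1) * norm (y - x)))" using f by simp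
      fix z
      have "?g z = f z * (r ((x - z) + (y - x)) - r (x - z) - frechet_derivative r (at (x - z)) (y - x))"
        by (simp add: frechet_derivative_expand[OF smooth_differentiable[OF r(1)], of "x - z" "y - x"]
            right_diff_distrib sum_distrib_left mult.left_commute)
      then show "norm (?g z) \<le> \<bar>f z\<bar> * (e / (I + 1) * norm (y - x))"
        using mult_left_mono[OF d(2)[OF y, of "x - z"] abs_ge_zero[of "f z"]] by (simp add: abs_mult)
    qed
    also have "\<dots> = I / (I + 1) * (e * norm (y - x))" by (simp add: I_def)
    also have "\<dots> \<le> 1 * (e * norm (y - x))" using I e by (intro mult_right_mono) auto
    finally show ?thesis by simp
  qed
  then show "\<exists>d>0. \<forall>y. norm (y - x) < d \<longrightarrow>
      norm (conv f r y - conv f r x - (\<Sum>b\<in>Basis. ((y - x) \<bullet> b) * conv f (pd b r) x)) \<le> e * norm (y - x)"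
    using d(1) by blast
qed

lemma pd_conv:
  assumes "integrable lborel f" "smooth r" "bounded_support r" "b \<in> Basis"
  shows "pd b (conv f r) = conv f (pd b r)"
proof
  fix x
  have "pd b (conv f r) x = (\<Sum>c\<in>Basis. (b \<bullet> c) * conv f (pd c r) x)"
    by (rule pd_eqI[OF conv_has_derivative[OF assms(1-3)]])
  also have "\<dots> = (\<Sum>c\<in>Basis. if c = b then conv f (pd c r) x else 0)"
    using assms(4) by (intro sum.cong) (auto simp: inner_Basis)
  also have "\<dots> = conv f (pd b r) x" using assms(4) by simp
  finally show "pd b (conv f r) x = conv f (pd b r) x" .
qed

lemma smooth_conv:
  assumes f: "integrable lborel f" and r: "smooth r" "bounded_support r"
  shows "smooth (conv f r)"
proof -
  have "Ck k (conv f r)" for k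
    using r
  proof (induction k arbitrary: r)
    case 0
    then show ?case
      by (auto intro!: continuous_at_imp_continuous_on has_derivative_continuous[OF conv_has_derivative[OF f]])
  next
    case (Suc k)
    have "conv f r differentiable (at x)" for x
      using conv_has_derivative[OF f Suc.prems] by (rule differentiableI)
    moreover have "Ck k (pd b (conv f r))" if "b \<in> Basis" for b
      using Suc that by (simp add: pd_conv[OF f] smooth_pd bounded_support_pd)
    ultimately show ?case by simp
  qed
  then show ?thesis by (simp add: smooth_def)
qed

section \<open>Invariance of Lebesgue measure under reflections and translations\<close>

lemma lborel_distr_reflect:
  fixes a :: "'a::euclidean_space"
  shows "distr lborel borel (\<lambda>x. a - x) = lborel"
proof -
  have "density (distr lborel borel (\<lambda>x. a + (- 1) *\<^sub>R x)) (\<lambda>_. ennreal (\<bar>- 1\<bar> ^ DIM('a)))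
      = distr lborel borel (\<lambda>x. a - x)"
    by (simp add: density_1)
  moreover have "(lborel :: 'a measure) = density (distr lborel borel (\<lambda>x. a + (- 1) *\<^sub>R x)) (\<lambda>_. ennreal (\<bar>- 1\<bar> ^ DIM('a)))"
    by (rule lborel_affine) simp
  ultimately show ?thesis by (metis (no_types))
qed

lemma nn_integral_lborel_reflect:
  fixes a :: "'a::euclidean_space"
  assumes [measurable]: "f \<in> borel_measurable borel"
  shows "(\<integral>\<^sup>+y. f (a - y) \<partial>lborel) = (\<integral>\<^sup>+y. f y \<partial>lborel)"
  using nn_integral_distr[of "\<lambda>x. a - x" lborel borel f] by (simp add: lborel_distr_reflect)

lemma lborel_integral_reflect:
  fixes a :: "'a::euclidean_space" and f :: "'a \<Rightarrow> real"
  assumes [measurable]: "f \<in> borel_measurable borel"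
  shows "(LINT y|lborel. f (a - y)) = (LINT y|lborel. f y)"
  using integral_distr[of "\<lambda>x. a - x" lborel borel f] by (simp add: lborel_distr_reflect)

lemma nn_integral_lborel_translate:
  fixes a :: "'a::euclidean_space"
  assumes [measurable]: "f \<in> borel_measurable borel"
  shows "(\<integral>\<^sup>+y. f (y - a) \<partial>lborel) = (\<integral>\<^sup>+y. f y \<partial>lborel)"
  using nn_integral_lborel_reflect[of "\<lambda>y. f (- y)" a] nn_integral_lborel_reflect[of f 0] by simp

section \<open>Approximation in \<open>L\<^sup>2\<close>\<close>

text \<open>Lebesgue measurability supplies continuous functions \<open>g n\<close> converging to
  \<open>f\<close> off a null set. Clamping them to [-M, M] and multiplying by the plateau
  \<open>c\<close>, which is 1 up to radius \<open>R\<close> and 0 from \<open>R + 1\<close> on,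
  leaves the limit unchanged, because \<open>f\<close> obeys the same restrictions, and yields the
  dominating function (2M)^2 on a ball.\<close>

lemma approx_L2_continuous_bounded:
  fixes f :: "'a::euclidean_space \<Rightarrow> real"
  assumes [measurable]: "f \<in> borel_measurable borel" and R: "\<And>x. R \<le> norm x \<Longrightarrow> f x = 0"
    and M: "\<And>x. \<bar>f x\<bar> \<le> M" and e: "0 < e"
  shows "\<exists>h. continuous_on UNIV h \<and> bounded_support h \<and> (LINT x|lborel. (f x - h x)\<^sup>2) < e"
proof -
  have M0: "0 \<le> M" using M[of 0] by simp
  have "f \<in> borel_measurable lebesgue" by (rule measurable_completion) simp
  then have "f measurable_on UNIV" by (rule lebesgue_measurable_imp_measurable_on_real) simp
  then obtain N g where N: "negligible N" and gc: "\<And>n. continuous_on UNIV (g n)"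
    and g: "\<And>x. x \<notin> N \<Longrightarrow> (\<lambda>n. g n x) \<longlonglongrightarrow> f x"
    unfolding measurable_on_def by auto
  define c :: "'a \<Rightarrow> real" where "c x = max 0 (min 1 (R + 1 - norm x))" for x
  define h where "h n x = c x * max (- M) (min M (g n x))" for n x
  have hc: "continuous_on UNIV (h n)" for n
    unfolding h_def c_def using gc by (intro continuous_intros)
  have hs: "h n x = 0" if "R + 1 \<le> norm x" for n x
    using that by (simp add: h_def c_def)
  have lim: "(\<lambda>n. (f x - h n x)\<^sup>2) \<longlonglongrightarrow> 0" if "x \<notin> N" for x
  proof -
    have "(\<lambda>n. (f x - c x * max (- M) (min M (g n x)))\<^sup>2) \<longlonglongrightarrow> (f x - c x * max (- M) (min M (f x)))\<^sup>2"
      using g[OF that] by (intro tendsto_intros)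
    moreover have "max (- M) (min M (f x)) = f x" using M[of x] by auto
    moreover have "c x * f x = f x" using R[of x] by (cases "R \<le> norm x") (auto simp: c_def)
    ultimately show ?thesis by (simp add: h_def)
  qed
  have bd: "(f x - h n x)\<^sup>2 \<le> indicator (cball 0 (R + 1)) x *\<^sub>R (2 * M)\<^sup>2" for n x
  proof (cases "norm x \<le> R + 1")
    case True
    have "\<bar>h n x\<bar> \<le> 1 * M"
      unfolding h_def abs_mult using M0 by (intro mult_mono) (auto simp: c_def)
    then have "\<bar>f x - h n x\<bar> \<le> 2 * M" using M[of x] by linarith
    then have "\<bar>f x - h n x\<bar>\<^sup>2 \<le> (2 * M)\<^sup>2" by (intro power_mono) auto
    then show ?thesis using True by simp
  next
    case False
    then show ?thesis using R[of x] hs[of x n] by simp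
  qed
  have [measurable]: "h n \<in> borel_measurable borel" for n
    using hc by (rule borel_measurable_continuous_onI)
  have "(\<lambda>n. LINT x|lborel. (f x - h n x)\<^sup>2) \<longlonglongrightarrow> (LINT x|(lborel::'a measure). 0)"
  proof (rule integral_dominated_convergence)
    have "integrable lborel (\<lambda>x::'a. indicator (cball 0 (R + 1)) x *\<^sub>R (2 * M)\<^sup>2)"
      by (intro borel_integrable_compact) (auto intro: continuous_intros)
    then show "integrable lborel (\<lambda>x::'a. indicator (cball 0 (R + 1)) x *\<^sub>R (2 * M)\<^sup>2)" .
    have "AE x in lebesgue. x \<notin> N"
      using N by (intro AE_not_in) (simp add: negligible_iff_null_sets)
    then have "AE x in lebesgue. (\<lambda>n. (f x - h n x)\<^sup>2) \<longlonglongrightarrow> 0" by eventually_elim (rule lim)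
    then show "AE x in lborel. (\<lambda>n. (f x - h n x)\<^sup>2) \<longlonglongrightarrow> 0" by (simp add: AE_completion_iff)
    show "AE x in lborel. norm ((f x - h n x)\<^sup>2) \<le> indicator (cball 0 (R + 1)) x *\<^sub>R (2 * M)\<^sup>2" for n
      using bd by (intro always_eventually) auto
  qed measurable
  then have "\<forall>\<^sub>F n in sequentially. (LINT x|lborel. (f x - h n x)\<^sup>2) < e"
    using e by (intro order_tendstoD(2)) auto
  then obtain n where "(LINT x|lborel. (f x - h n x)\<^sup>2) < e"
    by (auto simp: eventually_sequentially)
  then show ?thesis using hc hs unfolding bounded_support_def by blast
qed

lemma power2_sum_le: "((a::real) + b)\<^sup>2 \<le> 2 * a\<^sup>2 + 2 * b\<^sup>2"
proof -
  have "0 \<le> (a - b)\<^sup>2" by simp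
  then show ?thesis by (simp add: power2_eq_square algebra_simps)
qed

lemma power2_diff_le: "((a::real) - b)\<^sup>2 \<le> 2 * a\<^sup>2 + 2 * b\<^sup>2"
  using power2_sum_le[of a "- b"] by simp

lemma integrable_continuous_bounded_support':
  fixes f :: "'a::euclidean_space \<Rightarrow> real"
  assumes "continuous_on UNIV f" "bounded_support f"
  shows "integrable lborel f"
  using assms integrable_continuous_bounded_support unfolding bounded_support_def by blast

text \<open>Truncation at height \<open>n\<close> reduces to the bounded case; truncations converge
  in L^2 by dominated convergence with bound f^2. Both errors are taken below e/4, since the square
  of a sum costs a factor 2 on each.\<close>

lemma approx_L2_continuous:
  fixes f :: "'a::euclidean_space \<Rightarrow> real"
  assumes [measurable]: "f \<in> borel_measurable borel" and R: "bounded_support f"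
    and f2: "integrable lborel (\<lambda>x. (f x)\<^sup>2)" and e: "0 < e"
  shows "\<exists>h. continuous_on UNIV h \<and> bounded_support h \<and>
    (\<integral>\<^sup>+x. ennreal ((f x - h x)\<^sup>2) \<partial>lborel) \<le> ennreal e"
proof -
  define F where "F n x = max (- real n) (min (real n) (f x))" for n x
  have "(\<lambda>n. LINT x|lborel. (f x - F n x)\<^sup>2) \<longlonglongrightarrow> (LINT x|(lborel::'a measure). 0)"
  proof (rule integral_dominated_convergence[OF _ _ f2])
    have "(\<lambda>n. (f x - F n x)\<^sup>2) \<longlonglongrightarrow> 0" for x
    proof (rule tendsto_eventually)
      obtain m :: nat where "\<bar>f x\<bar> \<le> m" using real_arch_simple by blast
      then show "\<forall>\<^sub>F n in sequentially. (f x - F n x)\<^sup>2 = 0"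
        by (intro eventually_sequentiallyI[of m]) (auto simp: F_def)
    qed
    then show "AE x in lborel. (\<lambda>n. (f x - F n x)\<^sup>2) \<longlonglongrightarrow> 0" by simp
    have "\<bar>f x - F n x\<bar> \<le> \<bar>f x\<bar>" for n x by (auto simp: F_def)
    then show "AE x in lborel. norm ((f x - F n x)\<^sup>2) \<le> (f x)\<^sup>2" for n
      by (auto simp: abs_le_square_iff)
  qed (auto simp: F_def)
  then have "\<forall>\<^sub>F n in sequentially. (LINT x|lborel. (f x - F n x)\<^sup>2) < e / 4"
    using e by (intro order_tendstoD(2)) auto
  then obtain n where n: "(LINT x|lborel. (f x - F n x)\<^sup>2) < e / 4"
    by (auto simp: eventually_sequentially)
  obtain R where R: "\<And>x. R \<le> norm x \<Longrightarrow> f x = 0" using R by (auto simp: bounded_support_def)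
  have FM: "\<bar>F n x\<bar> \<le> real n" and FR: "R \<le> norm x \<Longrightarrow> F n x = 0" for x
    using R by (auto simp: F_def)
  have [measurable]: "F n \<in> borel_measurable borel" unfolding F_def by simp
  obtain h where h: "continuous_on UNIV h" "bounded_support h" "(LINT x|lborel. (F n x - h x)\<^sup>2) < e / 4"
  proof -
    have "e / 4 > 0" using e by simp
    from approx_L2_continuous_bounded[OF \<open>F n \<in> borel_measurable borel\<close> _ FM this, of R] FR that
    show thesis by blast
  qed
  have [measurable]: "h \<in> borel_measurable borel" using h(1) by (rule borel_measurable_continuous_onI)
  have h2: "integrable lborel (\<lambda>x. (h x)\<^sup>2)"
    using h(1,2) by (intro integrable_continuous_bounded_support') (auto intro!: continuous_intros simp: bounded_support_def)
  have FF: "\<bar>F n x\<bar> \<le> \<bar>f x\<bar>" for x by (auto simp: F_def)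
  have F2: "integrable lborel (\<lambda>x. (F n x)\<^sup>2)"
    by (rule Bochner_Integration.integrable_bound[OF f2]) (use FF in \<open>auto simp: abs_le_square_iff\<close>)
  have sq: "integrable lborel (\<lambda>x. (u x - v x)\<^sup>2)"
    if [measurable]: "u \<in> borel_measurable borel" "v \<in> borel_measurable borel"
      and "integrable lborel (\<lambda>x. (u x)\<^sup>2)" "integrable lborel (\<lambda>x. (v x)\<^sup>2)" for u v :: "'a \<Rightarrow> real"
  proof (rule Bochner_Integration.integrable_bound)
    show "integrable lborel (\<lambda>x. 2 * (u x)\<^sup>2 + 2 * (v x)\<^sup>2)" using that by simp
  qed (use power2_diff_le in \<open>auto intro: order_trans[OF _ abs_ge_self]\<close>)
  have i: "integrable lborel (\<lambda>x. (f x - F n x)\<^sup>2)" "integrable lborel (\<lambda>x. (F n x - h x)\<^sup>2)"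
    "integrable lborel (\<lambda>x. (f x - h x)\<^sup>2)"
    using f2 F2 h2 by (auto intro!: sq)
  have "(LINT x|lborel. (f x - h x)\<^sup>2) \<le> (LINT x|lborel. 2 * (f x - F n x)\<^sup>2 + 2 * (F n x - h x)\<^sup>2)"
  proof (rule integral_mono)
    show "(f x - h x)\<^sup>2 \<le> 2 * (f x - F n x)\<^sup>2 + 2 * (F n x - h x)\<^sup>2" for x
      using power2_sum_le[of "f x - F n x" "F n x - h x"] by simp
    show "integrable lborel (\<lambda>x. 2 * (f x - F n x)\<^sup>2 + 2 * (F n x - h x)\<^sup>2)"
      by (intro Bochner_Integration.integrable_add integrable_mult_right i)
  qed (rule i)
  also have "\<dots> = 2 * (LINT x|lborel. (f x - F n x)\<^sup>2) + 2 * (LINT x|lborel. (F n x - h x)\<^sup>2)"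
    by (simp only: Bochner_Integration.integral_add[OF integrable_mult_right[OF i(1)] integrable_mult_right[OF i(2)]]
        integral_mult_right_zero)
  also have "\<dots> \<le> e" using n h(3) by simp
  finally have "(LINT x|lborel. (f x - h x)\<^sup>2) \<le> e" .
  then have "(\<integral>\<^sup>+x. ennreal ((f x - h x)\<^sup>2) \<partial>lborel) \<le> ennreal e"
    using i(3) by (simp add: nn_integral_eq_integral ennreal_leI)
  then show ?thesis using h by blast
qed

section \<open>Continuity of translations and convergence of mollifications in L^2\<close>

lemma nn_integral_power2_sum_le:
  fixes u v :: "'a \<Rightarrow> real"
  assumes [measurable]: "u \<in> borel_measurable M" "v \<in> borel_measurable M"
  shows "(\<integral>\<^sup>+x. ennreal ((u x + v x)\<^sup>2) \<partial>M)
    \<le> 2 * (\<integral>\<^sup>+x. ennreal ((u x)\<^sup>2) \<partial>M) + 2 * (\<integral>\<^sup>+x. ennreal ((v x)\<^sup>2) \<partial>M)"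
proof -
  have "(\<integral>\<^sup>+x. ennreal ((u x + v x)\<^sup>2) \<partial>M) \<le> (\<integral>\<^sup>+x. 2 * ennreal ((u x)\<^sup>2) + 2 * ennreal ((v x)\<^sup>2) \<partial>M)"
  proof (rule nn_integral_mono)
    fix x
    have "ennreal ((u x + v x)\<^sup>2) \<le> ennreal (2 * (u x)\<^sup>2 + 2 * (v x)\<^sup>2)"
      using power2_sum_le by (rule ennreal_leI)
    also have "\<dots> = 2 * ennreal ((u x)\<^sup>2) + 2 * ennreal ((v x)\<^sup>2)"
      by (simp add: ennreal_mult')
    finally show "ennreal ((u x + v x)\<^sup>2) \<le> 2 * ennreal ((u x)\<^sup>2) + 2 * ennreal ((v x)\<^sup>2)" .
  qed
  also have "\<dots> = 2 * (\<integral>\<^sup>+x. ennreal ((u x)\<^sup>2) \<partial>M) + 2 * (\<integral>\<^sup>+x. ennreal ((v x)\<^sup>2) \<partial>M)"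
    by (simp add: nn_integral_add nn_integral_cmult)
  finally show ?thesis .
qed

text \<open>For shifts shorter than 1 the integrand lives on the ball of radius
  \<open>R + 1\<close>, of volume V. There uniform continuity makes it at most s^2 = e / (V + 1), so
  the integral is at most e V / (V + 1).\<close>

lemma translation_continuous_L2_continuous:
  fixes h :: "'a::euclidean_space \<Rightarrow> real"
  assumes h: "continuous_on UNIV h" "bounded_support h" and e: "0 < e"
  shows "\<exists>d>0. \<forall>y. norm y < d \<longrightarrow> (\<integral>\<^sup>+x. ennreal ((h (x - y) - h x)\<^sup>2) \<partial>lborel) \<le> ennreal e"
proof -
  obtain R where R: "\<And>x. R \<le> norm x \<Longrightarrow> h x = 0" using h(2) by (auto simp: bounded_support_def)
  define V where "V = measure lborel (cball (0::'a) (R + 1))"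
  have V: "0 \<le> V" by (simp add: V_def)
  define s where "s = sqrt (e / (V + 1))"
  have s: "s > 0" "s\<^sup>2 = e / (V + 1)" using e V by (auto simp: s_def)
  obtain d where d: "d > 0" "\<And>x y. dist y x < d \<Longrightarrow> dist (h y) (h x) < s"
    using bounded_support_uniformly_continuous[OF h] s(1) unfolding uniformly_continuous_on_def
    by (metis UNIV_I)
  have "(\<integral>\<^sup>+x. ennreal ((h (x - y) - h x)\<^sup>2) \<partial>lborel) \<le> ennreal e" if y: "norm y < min d 1" for y
  proof -
    have "(\<integral>\<^sup>+x. ennreal ((h (x - y) - h x)\<^sup>2) \<partial>lborel)
        \<le> (\<integral>\<^sup>+x. ennreal (e / (V + 1)) * indicator (cball (0::'a) (R + 1)) x \<partial>lborel)"
    proof (rule nn_integral_mono)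
      fix x
      show "ennreal ((h (x - y) - h x)\<^sup>2) \<le> ennreal (e / (V + 1)) * indicator (cball 0 (R + 1)) x"
      proof (cases "norm x \<le> R + 1")
        case True
        have "\<bar>h (x - y) - h x\<bar> < s" using d(2)[of "x - y" x] y by (simp add: dist_norm)
        then have "\<bar>h (x - y) - h x\<bar>\<^sup>2 \<le> s\<^sup>2" by (intro power_mono) auto
        then show ?thesis using True s by (simp add: ennreal_leI)
      next
        case False
        have "norm x \<le> norm (x - y) + norm y" using norm_triangle_ineq[of "x - y" y] by simp
        then show ?thesis using False y R[of x] R[of "x - y"] by simp
      qed
    qed
    also have "\<dots> = ennreal (e / (V + 1)) * emeasure lborel (cball (0::'a) (R + 1))"
      by (simp add: nn_integral_cmult_indicator)
    also have "emeasure lborel (cball (0::'a) (R + 1)) = ennreal V"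
      unfolding V_def using emeasure_lborel_cball_finite[of "0::'a" "R + 1"]
      by (intro emeasure_eq_ennreal_measure) (auto simp: less_top)
    also have "ennreal (e / (V + 1)) * ennreal V = ennreal (e * (V / (V + 1)))"
      using e V by (simp add: ennreal_mult'[symmetric])
    also have "\<dots> \<le> ennreal e"
      using e V by (intro ennreal_leI mult_right_le_one_le) auto
    finally show ?thesis .
  qed
  then show ?thesis using d(1) by (intro exI[of _ "min d 1"]) auto
qed

text \<open>A continuous \<open>h\<close> close to \<open>f\<close> is inserted; the shifted error
  between \<open>f\<close> and \<open>h\<close> equals the unshifted one by translation invariance.
  Splitting the square twice gives the factors 2 and 2 * (2 + 2), in total 10, hence the tolerance
  e/10.\<close>

lemma translation_continuous_L2:
  fixes f :: "'a::euclidean_space \<Rightarrow> real"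
  assumes [measurable]: "f \<in> borel_measurable borel" and R: "bounded_support f"
    and f2: "integrable lborel (\<lambda>x. (f x)\<^sup>2)" and e: "0 < e"
  shows "\<exists>d>0. \<forall>y. norm y < d \<longrightarrow> (\<integral>\<^sup>+x. ennreal ((f (x - y) - f x)\<^sup>2) \<partial>lborel) \<le> ennreal e"
proof -
  obtain h where h: "continuous_on UNIV h" "bounded_support h"
      and fh: "(\<integral>\<^sup>+x. ennreal ((f x - h x)\<^sup>2) \<partial>lborel) \<le> ennreal (e / 10)"
    using approx_L2_continuous[OF assms(1) R f2, of "e / 10"] e by auto
  obtain d where d: "d > 0"
    and dh: "\<And>y. norm y < d \<Longrightarrow> (\<integral>\<^sup>+x. ennreal ((h (x - y) - h x)\<^sup>2) \<partial>lborel) \<le> ennreal (e / 10)"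
    using translation_continuous_L2_continuous[OF h, of "e / 10"] e by auto
  have [measurable]: "h \<in> borel_measurable borel" using h(1) by (rule borel_measurable_continuous_onI)
  have "(\<integral>\<^sup>+x. ennreal ((f (x - y) - f x)\<^sup>2) \<partial>lborel) \<le> ennreal e" if y: "norm y < d" for y
  proof -
    have fh': "(\<integral>\<^sup>+x. ennreal ((f (x - y) - h (x - y))\<^sup>2) \<partial>lborel) \<le> ennreal (e / 10)"
      using fh nn_integral_lborel_translate[of "\<lambda>x. ennreal ((f x - h x)\<^sup>2)" y] by simp
    have hf: "(\<integral>\<^sup>+x. ennreal ((h x - f x)\<^sup>2) \<partial>lborel) \<le> ennreal (e / 10)"
      using fh by (simp add: power2_commute)
    have "(\<integral>\<^sup>+x. ennreal ((f (x - y) - f x)\<^sup>2) \<partial>lborel)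
      = (\<integral>\<^sup>+x. ennreal (((f (x - y) - h (x - y)) + ((h (x - y) - h x) + (h x - f x)))\<^sup>2) \<partial>lborel)" by simp
    also have "\<dots> \<le> 2 * (\<integral>\<^sup>+x. ennreal ((f (x - y) - h (x - y))\<^sup>2) \<partial>lborel)
        + 2 * (\<integral>\<^sup>+x. ennreal (((h (x - y) - h x) + (h x - f x))\<^sup>2) \<partial>lborel)"
      by (rule nn_integral_power2_sum_le) measurable
    also have "\<dots> \<le> 2 * (\<integral>\<^sup>+x. ennreal ((f (x - y) - h (x - y))\<^sup>2) \<partial>lborel)
        + 2 * (2 * (\<integral>\<^sup>+x. ennreal ((h (x - y) - h x)\<^sup>2) \<partial>lborel) + 2 * (\<integral>\<^sup>+x. ennreal ((h x - f x)\<^sup>2) \<partial>lborel))"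
      by (intro add_left_mono mult_left_mono nn_integral_power2_sum_le) auto
    also have "\<dots> \<le> 2 * ennreal (e / 10) + 2 * (2 * ennreal (e / 10) + 2 * ennreal (e / 10))"
      by (intro add_mono mult_left_mono fh' hf dh y) auto
    also have "\<dots> = 10 * ennreal (e / 10)" by (simp flip: distrib_right)
    also have "\<dots> = ennreal (10 * (e / 10))" using e by (subst ennreal_mult) auto
    also have "\<dots> = ennreal e" by simp
    finally show ?thesis .
  qed
  then show ?thesis using d by blast
qed

text \<open>Jensen's inequality for the square under the probability density \<open>r\<close>, read
  off from the nonnegativity of the variance. When the right-hand side is infinite there is nothing
  to show.\<close>

lemma ennreal_square_integral_le:
  fixes F r :: "'a \<Rightarrow> real"
  assumes [measurable]: "F \<in> borel_measurable M"
    and r: "integrable M r" "\<And>x. 0 \<le> r x" "(LINT x|M. r x) = 1"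
    and Fr: "integrable M (\<lambda>x. F x * r x)"
  shows "ennreal ((LINT x|M. F x * r x)\<^sup>2) \<le> (\<integral>\<^sup>+x. ennreal ((F x)\<^sup>2 * r x) \<partial>M)"
proof (cases "(\<integral>\<^sup>+x. ennreal ((F x)\<^sup>2 * r x) \<partial>M) = \<infinity>")
  case False
  have [measurable]: "r \<in> borel_measurable M" using r(1) by auto
  have F2: "integrable M (\<lambda>x. (F x)\<^sup>2 * r x)"
    using False r(2) by (intro integrableI_nonneg) (auto simp: less_top)
  define m where "m = (LINT x|M. F x * r x)"
  have i: "integrable M (\<lambda>x. (2 * m) * (F x * r x))" "integrable M (\<lambda>x. m\<^sup>2 * r x)"
    using Fr r(1) by auto
  have "(LINT x|M. (F x - m)\<^sup>2 * r x) = (LINT x|M. ((F x)\<^sup>2 * r x - (2 * m) * (F x * r x)) + m\<^sup>2 * r x)"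
    by (intro Bochner_Integration.integral_cong) (auto simp: power2_eq_square algebra_simps)
  also have "\<dots> = (LINT x|M. (F x)\<^sup>2 * r x) - (2 * m) * m + m\<^sup>2"
    using F2 i r(3) by (simp add: m_def)
  finally have "(LINT x|M. (F x - m)\<^sup>2 * r x) = (LINT x|M. (F x)\<^sup>2 * r x) - m\<^sup>2"
    by (simp add: power2_eq_square)
  moreover have "0 \<le> (LINT x|M. (F x - m)\<^sup>2 * r x)" using r(2) by (intro Bochner_Integration.integral_nonneg) auto
  ultimately show ?thesis
    using F2 r(2) by (subst nn_integral_eq_integral) (auto simp: m_def intro!: ennreal_leI)
qed simp

lemma mollifier_bounded_support: "mollifier d r \<Longrightarrow> bounded_support r"
  by (auto simp: mollifier_def bounded_support_def)

lemma mollifier_reflect: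
  assumes "mollifier d r"
  shows "integrable lborel (\<lambda>y. r (x - y))" "(LINT y|lborel. r (x - y)) = 1"
proof -
  have [measurable]: "r \<in> borel_measurable borel"
    using assms smooth_continuous borel_measurable_continuous_onI by (auto simp: mollifier_def)
  have nn: "\<And>x. 0 \<le> r x" using assms by (simp add: mollifier_def)
  have "(\<integral>\<^sup>+z. ennreal (r z) \<partial>lborel) = 1"
    using assms by (simp add: mollifier_def nn_integral_eq_integral)
  then have n1: "(\<integral>\<^sup>+y. ennreal (r (x - y)) \<partial>lborel) = 1"
    using nn_integral_lborel_reflect[of "\<lambda>z. ennreal (r z)" x] by simp
  then show "integrable lborel (\<lambda>y. r (x - y))"
    using nn by (intro integrableI_nonneg) auto
  show "(LINT y|lborel. r (x - y)) = 1"
    using n1 nn by (subst integral_eq_nn_integral) auto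
qed

text \<open>The error at x is the average of f(x - z) - f(x) over z with density \<open>r\<close>.
  Jensen and Fubini bound its squared norm by the same average of squared translation errors, and
  only shifts with |z| < d carry weight. The estimate is therefore uniform over all kernels of scale
  \<open>d\<close>.\<close>

lemma conv_tendsto_L2:
  fixes f :: "'a::euclidean_space \<Rightarrow> real"
  assumes [measurable]: "f \<in> borel_measurable borel" and R: "bounded_support f"
    and f1: "integrable lborel f" and f2: "integrable lborel (\<lambda>x. (f x)\<^sup>2)" and e: "0 < e"
  shows "\<exists>d>0. \<forall>r. mollifier d r \<longrightarrow> (\<integral>\<^sup>+x. ennreal ((conv f r x - f x)\<^sup>2) \<partial>lborel) \<le> ennreal e"
proof -
  obtain d where d: "d > 0"
    and df: "\<And>y. norm y < d \<Longrightarrow> (\<integral>\<^sup>+x. ennreal ((f (x - y) - f x)\<^sup>2) \<partial>lborel) \<le> ennreal e"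
    using translation_continuous_L2[OF assms(1) R f2 e] by auto
  have "(\<integral>\<^sup>+x. ennreal ((conv f r x - f x)\<^sup>2) \<partial>lborel) \<le> ennreal e" if r: "mollifier d r" for r :: "'a \<Rightarrow> real"
  proof -
    have rs: "smooth r" "\<And>x. 0 \<le> r x" "\<And>x. d \<le> norm x \<Longrightarrow> r x = 0" "integrable lborel r" "(LINT x|lborel. r x) = 1"
      using r by (auto simp: mollifier_def)
    have [measurable]: "r \<in> borel_measurable borel"
      using smooth_continuous[OF rs(1)] by (rule borel_measurable_continuous_onI)
    have r1: "(\<integral>\<^sup>+z. ennreal (r z) \<partial>lborel) = 1"
      using rs by (simp add: nn_integral_eq_integral)
    have "(\<integral>\<^sup>+x. ennreal ((conv f r x - f x)\<^sup>2) \<partial>lborel)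
        \<le> (\<integral>\<^sup>+x. \<integral>\<^sup>+z. ennreal ((f (x - z) - f x)\<^sup>2) * ennreal (r z) \<partial>lborel \<partial>lborel)"
    proof (rule nn_integral_mono)
      fix x
      note ri = mollifier_reflect(1)[OF r, of x] and rl = mollifier_reflect(2)[OF r, of x]
      have fi: "integrable lborel (\<lambda>y. f y * r (x - y))"
        by (rule integrable_conv[OF f1 smooth_continuous[OF rs(1)] mollifier_bounded_support[OF r]])
      have eq: "(LINT y|lborel. (f y - f x) * r (x - y)) = conv f r x - f x"
        using fi ri rl by (simp add: conv_def left_diff_distrib)
      have fi': "integrable lborel (\<lambda>y. (f y - f x) * r (x - y))"
        using fi ri by (simp add: left_diff_distrib)
      have "ennreal ((conv f r x - f x)\<^sup>2) \<le> (\<integral>\<^sup>+y. ennreal ((f y - f x)\<^sup>2 * r (x - y)) \<partial>lborel)"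
        unfolding eq[symmetric] using rs(2) by (intro ennreal_square_integral_le ri rl fi') auto
      also have "\<dots> = (\<integral>\<^sup>+z. ennreal ((f (x - z) - f x)\<^sup>2 * r z) \<partial>lborel)"
        using nn_integral_lborel_reflect[of "\<lambda>y. ennreal ((f y - f x)\<^sup>2 * r (x - y))" x] by simp
      finally show "ennreal ((conv f r x - f x)\<^sup>2) \<le> (\<integral>\<^sup>+z. ennreal ((f (x - z) - f x)\<^sup>2) * ennreal (r z) \<partial>lborel)"
        using rs(2) by (simp add: ennreal_mult')
    qed
    also have "\<dots> = (\<integral>\<^sup>+z. \<integral>\<^sup>+x. ennreal ((f (x - z) - f x)\<^sup>2) * ennreal (r z) \<partial>lborel \<partial>lborel)"
      by (rule lborel_pair.Fubini') measurable
    also have "\<dots> \<le> (\<integral>\<^sup>+z. ennreal e * ennreal (r z) \<partial>lborel)"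
    proof (rule nn_integral_mono)
      fix z
      show "(\<integral>\<^sup>+x. ennreal ((f (x - z) - f x)\<^sup>2) * ennreal (r z) \<partial>lborel) \<le> ennreal e * ennreal (r z)"
      proof (cases "norm z < d")
        case True
        then show ?thesis using df[OF True] by (simp add: nn_integral_multc mult_right_mono)
      qed (simp add: rs(3))
    qed
    also have "\<dots> = ennreal e" using r1 by (simp add: nn_integral_cmult)
    finally show ?thesis .
  qed
  then show ?thesis using d by blast
qed

section \<open>Weak gradients and the Meyers--Serrin theorem\<close>

lemma integrable_mult_compact_support:
  fixes u :: "'a::euclidean_space \<Rightarrow> real"
  assumes K: "compact K" "set_integrable lborel K u"
    and c: "continuous_on UNIV c" "\<And>x. x \<notin> K \<Longrightarrow> c x = 0"
  shows "integrable lborel (\<lambda>x. c x * u x)"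
proof -
  have [measurable]: "c \<in> borel_measurable borel" using c(1) by (rule borel_measurable_continuous_onI)
  have "compact (c ` K)"
    using c(1) K(1) by (intro compact_continuous_image) (auto intro: continuous_on_subset)
  then obtain M where M: "0 < M" "\<And>y. y \<in> c ` K \<Longrightarrow> norm y \<le> M"
    using compact_imp_bounded bounded_pos by metis
  have i: "integrable lborel (\<lambda>x. indicator K x *\<^sub>R u x)" using K(2) by (simp add: set_integrable_def)
  then have [measurable]: "(\<lambda>x. indicator K x *\<^sub>R u x) \<in> borel_measurable borel" by auto
  have "integrable lborel (\<lambda>x. c x * (indicator K x *\<^sub>R u x))"
  proof (rule Bochner_Integration.integrable_bound)
    show "integrable lborel (\<lambda>x. M * (indicator K x *\<^sub>R u x))" using i by (rule integrable_mult_right)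
    show "AE x in lborel. norm (c x * (indicator K x *\<^sub>R u x)) \<le> norm (M * (indicator K x *\<^sub>R u x))"
      using M by (intro always_eventually allI) (auto simp: abs_mult indicator_def intro!: mult_right_mono)
  qed measurable
  moreover have "(\<lambda>x. c x * (indicator K x *\<^sub>R u x)) = (\<lambda>x. c x * u x)"
    using c(2) by (auto simp: fun_eq_iff indicator_def)
  ultimately show ?thesis by simp
qed

lemma pd_locally_const:
  assumes "open U" "x \<in> U" "\<And>y. y \<in> U \<Longrightarrow> f y = c"
  shows "pd b f x = 0"
proof -
  have "((\<lambda>y. c) has_derivative (\<lambda>h. 0)) (at x)" by simp
  then have "(f has_derivative (\<lambda>h. 0)) (at x)"
    by (rule has_derivative_transform_within_open[OF _ assms(1,2)]) (use assms(3) in auto)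
  then show ?thesis by (rule pd_eqI)
qed

text \<open>The product rule for a smooth cutoff, obtained by testing with z times psi. The compact
  set \<open>K\<close> carries the support of this product, so psi may be any smooth function on the
  whole space; this admits reflected kernels centred at an arbitrary point.\<close>

lemma weak_gradient_cutoff:
  fixes u :: "'a::euclidean_space \<Rightarrow> real"
  assumes w: "has_weak_gradient \<Omega> u g" and K: "compact K" "K \<subseteq> \<Omega>"
    and z: "smooth z" "\<And>x. x \<notin> K \<Longrightarrow> z x = 0" and b: "b \<in> Basis"
  shows "integrable lborel (\<lambda>x. z x * u x)"
    and "integrable lborel (\<lambda>x. z x * (g x \<bullet> b) + pd b z x * u x)"
    and "smooth \<psi> \<Longrightarrow> (LINT x|lborel. (z x * u x) * pd b \<psi> x)
      = - (LINT x|lborel. (z x * (g x \<bullet> b) + pd b z x * u x) * \<psi> x)"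
proof -
  have uK: "set_integrable lborel K u" and gK: "set_integrable lborel K g"
    using w K by (auto simp: has_weak_gradient_def locally_integrable_on_def)
  have gbK: "set_integrable lborel K (\<lambda>x. g x \<bullet> b)"
    using integrable_inner_left[OF gK[unfolded set_integrable_def], of b]
    by (simp add: set_integrable_def inner_scaleR_left)
  have pz: "pd b z x = 0" if "x \<notin> K" for x
    by (rule pd_locally_const[of "- K" _ _ 0]) (use that K z in \<open>auto intro: open_Compl compact_imp_closed\<close>)
  note cz = smooth_continuous[OF z(1)] and cpz = smooth_continuous_pd[OF z(1) b]
  show "integrable lborel (\<lambda>x. z x * u x)"
    by (rule integrable_mult_compact_support[OF K(1) uK cz z(2)])
  show "integrable lborel (\<lambda>x. z x * (g x \<bullet> b) + pd b z x * u x)"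
    by (intro Bochner_Integration.integrable_add integrable_mult_compact_support[OF K(1) gbK cz z(2)]
        integrable_mult_compact_support[OF K(1) uK cpz pz])
  assume psi: "smooth \<psi>"
  note cp = smooth_continuous[OF psi] and cpp = smooth_continuous_pd[OF psi b]
  have i1: "integrable lborel (\<lambda>x. (z x * pd b \<psi> x) * u x)"
    by (rule integrable_mult_compact_support[OF K(1) uK continuous_on_mult[OF cz cpp]]) (simp add: z(2))
  have i2: "integrable lborel (\<lambda>x. (pd b z x * \<psi> x) * u x)"
    by (rule integrable_mult_compact_support[OF K(1) uK continuous_on_mult[OF cpz cp]]) (simp add: pz)
  have i3: "integrable lborel (\<lambda>x. (z x * \<psi> x) * (g x \<bullet> b))"
    by (rule integrable_mult_compact_support[OF K(1) gbK continuous_on_mult[OF cz cp]]) (simp add: z(2))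
  have "(\<lambda>x. z x * \<psi> x) \<in> test_functions \<Omega>"
    using smooth_mult[OF z(1) psi] K z(2) unfolding test_functions_def smooth_def by auto
  with w b have "(LINT x:\<Omega>|lborel. u x * pd b (\<lambda>x. z x * \<psi> x) x) = - (LINT x:\<Omega>|lborel. (g x \<bullet> b) * (z x * \<psi> x))"
    unfolding has_weak_gradient_def by blast
  moreover have "(LINT x:\<Omega>|lborel. (g x \<bullet> b) * (z x * \<psi> x)) = (LINT x|lborel. (z x * \<psi> x) * (g x \<bullet> b))"
    unfolding set_lebesgue_integral_def using K z(2)
    by (intro Bochner_Integration.integral_cong) (auto simp: indicator_def)
  moreover have "(LINT x:\<Omega>|lborel. u x * pd b (\<lambda>x. z x * \<psi> x) x)
      = (LINT x|lborel. (z x * pd b \<psi> x) * u x + (pd b z x * \<psi> x) * u x)"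
  proof -
    have "indicator \<Omega> x *\<^sub>R (u x * pd b (\<lambda>x. z x * \<psi> x) x)
        = (z x * pd b \<psi> x) * u x + (pd b z x * \<psi> x) * u x" for x
    proof -
      have "pd b (\<lambda>x. z x * \<psi> x) x = z x * pd b \<psi> x + pd b z x * \<psi> x"
        by (intro pd_mult smooth_differentiable z psi)
      then show ?thesis using K z(2)[of x] pz[of x]
        by (cases "x \<in> K") (auto simp: indicator_def algebra_simps)
    qed
    then show ?thesis by (simp add: set_lebesgue_integral_def)
  qed
  moreover have "(LINT x|lborel. (z x * pd b \<psi> x) * u x + (pd b z x * \<psi> x) * u x)
     = (LINT x|lborel. (z x * pd b \<psi> x) * u x) + (LINT x|lborel. (pd b z x * \<psi> x) * u x)"
    by (rule Bochner_Integration.integral_add[OF i1 i2])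
  ultimately have "(LINT x|lborel. (z x * pd b \<psi> x) * u x)
      = - ((LINT x|lborel. (z x * \<psi> x) * (g x \<bullet> b)) + (LINT x|lborel. (pd b z x * \<psi> x) * u x))"
    by simp
  also have "(LINT x|lborel. (z x * \<psi> x) * (g x \<bullet> b)) + (LINT x|lborel. (pd b z x * \<psi> x) * u x)
      = (LINT x|lborel. (z x * \<psi> x) * (g x \<bullet> b) + (pd b z x * \<psi> x) * u x)"
    by (rule Bochner_Integration.integral_add[OF i3 i2, symmetric])
  finally show "(LINT x|lborel. (z x * u x) * pd b \<psi> x)
      = - (LINT x|lborel. (z x * (g x \<bullet> b) + pd b z x * u x) * \<psi> x)"
    by (simp add: algebra_simps)
qed

lemma pd_reflect:
  assumes "smooth r"
  shows "pd b (\<lambda>y. r (a - y)) y = - pd b r (a - y)"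
proof -
  note f = smooth_has_derivative[OF assms, of "a - y"]
  have "((\<lambda>y. a - y) has_derivative (\<lambda>h. - h)) (at y)"
    by (auto intro!: derivative_eq_intros)
  from pd_eqI[OF has_derivative_compose[OF this f]]
  show ?thesis
    by (simp add: linear_neg[OF linear_frechet_derivative[OF smooth_differentiable[OF assms]]])
qed

text \<open>The derivative falls on the kernel, and the reflected kernel serves as test function.
  The sign of the reflection cancels the sign of the integration by parts.\<close>

lemma pd_conv_weak:
  fixes u :: "'a::euclidean_space \<Rightarrow> real"
  assumes w: "has_weak_gradient \<Omega> u g" and K: "compact K" "K \<subseteq> \<Omega>"
    and z: "smooth z" "\<And>x. x \<notin> K \<Longrightarrow> z x = 0" and b: "b \<in> Basis" and r: "mollifier d r"
  shows "pd b (conv (\<lambda>x. z x * u x) r) = conv (\<lambda>x. z x * (g x \<bullet> b) + pd b z x * u x) r"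
proof
  fix x
  have rs: "smooth r" using r by (simp add: mollifier_def)
  have "pd b (conv (\<lambda>x. z x * u x) r) x = conv (\<lambda>x. z x * u x) (pd b r) x"
    by (rule fun_cong[OF pd_conv[OF weak_gradient_cutoff(1)[OF w K z b] rs mollifier_bounded_support[OF r] b]])
  also have "\<dots> = - (LINT y|lborel. (z y * u y) * pd b (\<lambda>y. r (x - y)) y)"
    by (simp add: conv_def pd_reflect[OF rs])
  also have "\<dots> = conv (\<lambda>x. z x * (g x \<bullet> b) + pd b z x * u x) r x"
    by (simp add: weak_gradient_cutoff(3)[OF w K z b smooth_reflect[OF rs]] conv_def)
  finally show "pd b (conv (\<lambda>x. z x * u x) r) x = conv (\<lambda>x. z x * (g x \<bullet> b) + pd b z x * u x) r x" .
qed

lemma conv_eq_0: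
  assumes "mollifier d r" "\<And>y. dist x y < d \<Longrightarrow> f y = 0"
  shows "conv f r x = 0"
proof -
  have "(\<lambda>y. f y * r (x - y)) = (\<lambda>y. 0)"
  proof
    show "f y * r (x - y) = 0" for y
      using assms by (cases "dist x y < d") (auto simp: mollifier_def dist_norm)
  qed
  then show ?thesis by (simp add: conv_def)
qed

lemma mollifier_mono: "mollifier d r \<Longrightarrow> d \<le> d' \<Longrightarrow> mollifier d' r"
  unfolding mollifier_def by (meson order_trans)

text \<open>The indicator of the closed d/2-neighbourhood of \<open>K\<close> is mollified at scale
  d/2: from a point of \<open>K\<close> the kernel sees only the value 1, and from a point outside
  \<open>L\<close>, which is farther than d from \<open>K\<close>, only the value 0.\<close>

lemma smooth_cutoff_exists:
  fixes K :: "'a::euclidean_space set"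
  assumes K: "compact K" "K \<subseteq> interior L"
  shows "\<exists>z. smooth z \<and> (\<forall>x\<in>K. z x = 1) \<and> (\<forall>x. x \<notin> L \<longrightarrow> z x = 0)"
proof -
  obtain d where d: "d > 0" "(\<Union>x\<in>K. cball x d) \<subseteq> interior L"
    using compact_subset_open_imp_cball_epsilon_subset[OF K(1) open_interior K(2)] by blast
  define K1 where "K1 = (\<Union>x\<in>K. cball x (d / 2))"
  have K1: "compact K1" unfolding K1_def using K(1) by (rule compact_minkowski_sum_cball)
  obtain r :: "'a \<Rightarrow> real" where r: "mollifier (d / 2) r" using mollifier_exists[of "d / 2"] d by auto
  have rs: "smooth r" using r by (simp add: mollifier_def)
  have "set_integrable lborel K1 (\<lambda>x::'a. 1::real)"
    using K1 unfolding set_integrable_def by (intro borel_integrable_compact) auto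
  then have ind: "integrable lborel (indicator K1 :: 'a \<Rightarrow> real)" by (simp add: set_integrable_def)
  define z where "z = conv (indicator K1) r"
  have "smooth z"
    unfolding z_def by (rule smooth_conv[OF ind rs mollifier_bounded_support[OF r]])
  moreover have "z x = 1" if "x \<in> K" for x
  proof -
    have "indicator K1 y * r (x - y) = r (x - y)" for y
    proof (cases "dist x y < d / 2")
      case True
      then have "y \<in> K1" using that by (auto simp: K1_def intro!: bexI[of _ x])
      then show ?thesis by simp
    next
      case False
      then show ?thesis using r by (auto simp: mollifier_def dist_norm)
    qed
    then have "z x = (LINT y|lborel. r (x - y))"
      unfolding z_def conv_def by (intro Bochner_Integration.integral_cong) auto
    then show ?thesis by (simp add: mollifier_reflect(2)[OF r])
  qed
  moreover have "z x = 0" if "x \<notin> L" for x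
    unfolding z_def
  proof (rule conv_eq_0[OF r])
    fix y assume y: "dist x y < d / 2"
    have "y \<notin> K1"
    proof
      assume "y \<in> K1"
      then obtain k where k: "k \<in> K" "dist k y \<le> d / 2" by (auto simp: K1_def)
      then have "dist k x \<le> d" using y dist_triangle[of k x y] by (simp add: dist_commute)
      then have "x \<in> (\<Union>x\<in>K. cball x d)" using k by auto
      then have "x \<in> interior L" using d(2) by blast
      then show False using that interior_subset by blast
    qed
    then show "indicator K1 y = (0::real)" by simp
  qed
  ultimately show ?thesis by blast
qed

text \<open>On a compact subset of its support the continuous density attains a positive minimum
  \<open>p x0\<close>; dividing by it removes the weight.\<close>

lemma L2_square_integrable_compact:
  fixes u :: "'a::euclidean_space \<Rightarrow> 'b::euclidean_space"
  assumes u: "u \<in> L2 p" and p: "continuous_on (pdf_support p) p" and K: "compact K" "K \<subseteq> pdf_support p"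
  shows "set_integrable lborel K (\<lambda>x. (norm (u x))\<^sup>2)"
proof (cases "K = {}")
  case False
  obtain x0 where x0: "x0 \<in> K" "\<And>x. x \<in> K \<Longrightarrow> p x0 \<le> p x"
    using continuous_attains_inf[OF K(1) False continuous_on_subset[OF p K(2)]] by blast
  have c: "p x0 > 0" using x0(1) K(2) by (auto simp: pdf_support_def)
  have i: "integrable lborel (\<lambda>x. indicator (pdf_support p) x *\<^sub>R ((norm (u x))\<^sup>2 * p x))"
    using u by (simp add: L2_def pdf_integrable_def set_integrable_def)
  have [measurable]: "(\<lambda>x. indicator (pdf_support p) x *\<^sub>R u x) \<in> borel_measurable borel"
    using u by (simp add: L2_def set_borel_measurable_def)
  have [measurable]: "K \<in> sets borel" using K(1) by (simp add: borel_compact)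
  have eq: "indicator K x *\<^sub>R (norm (u x))\<^sup>2 = indicator K x * (norm (indicator (pdf_support p) x *\<^sub>R u x))\<^sup>2" for x
    using K(2) by (auto simp: indicator_def)
  show ?thesis unfolding set_integrable_def
  proof (rule Bochner_Integration.integrable_bound)
    show "integrable lborel (\<lambda>x. inverse (p x0) * (indicator (pdf_support p) x *\<^sub>R ((norm (u x))\<^sup>2 * p x)))"
      using i by (rule integrable_mult_right)
    show "(\<lambda>x. indicator K x *\<^sub>R (norm (u x))\<^sup>2) \<in> borel_measurable lborel"
      unfolding eq by measurable
    have "norm (indicator K x *\<^sub>R (norm (u x))\<^sup>2)
        \<le> norm (inverse (p x0) * (indicator (pdf_support p) x *\<^sub>R ((norm (u x))\<^sup>2 * p x)))" for x
    proof (cases "x \<in> K")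
      case True
      have "(norm (u x))\<^sup>2 * 1 \<le> (norm (u x))\<^sup>2 * (p x / p x0)"
        using x0(2)[OF True] c by (intro mult_left_mono) auto
      then show ?thesis using True K(2) c x0(2)[OF True]
        by (auto simp: abs_mult divide_inverse mult_ac)
    qed simp
    then show "AE x in lborel. norm (indicator K x *\<^sub>R (norm (u x))\<^sup>2)
        \<le> norm (inverse (p x0) * (indicator (pdf_support p) x *\<^sub>R ((norm (u x))\<^sup>2 * p x)))" by simp
  qed
qed (simp add: set_integrable_def)

text \<open>For scales up to \<open>d0\<close> both \<open>f\<close> and its mollification vanish
  outside the compact neighbourhood \<open>K1\<close> of \<open>K\<close>, which still lies in the
  support of \<open>p\<close>. There \<open>p\<close> is at most M, so an unweighted error of e/M
  suffices.\<close>

lemma conv_tendsto_weighted_L2: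
  fixes f :: "'a::euclidean_space \<Rightarrow> real"
  assumes P: "has_pdf P p" and K: "compact K" "K \<subseteq> pdf_support p" and f0: "\<And>x. x \<notin> K \<Longrightarrow> f x = 0"
    and f1: "integrable lborel f" and f2: "integrable lborel (\<lambda>x. (f x)\<^sup>2)" and e: "0 < e"
  shows "\<exists>d>0. \<forall>r. mollifier d r \<longrightarrow> pdf_nn_expectation p (\<lambda>x. (conv f r x - f x)\<^sup>2) \<le> ennreal e"
proof -
  have [measurable]: "f \<in> borel_measurable borel" using f1 by auto
  have o: "open (pdf_support p)" and cp: "continuous_on (pdf_support p) p" and p0: "\<And>x. 0 \<le> p x"
    using P by (auto simp: has_pdf_def)
  obtain d0 where d0: "d0 > 0" "(\<Union>x\<in>K. cball x d0) \<subseteq> pdf_support p"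
    using compact_subset_open_imp_cball_epsilon_subset[OF K(1) o K(2)] by blast
  define K1 where "K1 = (\<Union>x\<in>K. cball x d0)"
  have K1: "compact K1" unfolding K1_def using K(1) by (rule compact_minkowski_sum_cball)
  have "compact (p ` K1)"
    using K1 continuous_on_subset[OF cp d0(2)] unfolding K1_def by (intro compact_continuous_image) auto
  then obtain M where M: "0 < M" "\<And>y. y \<in> p ` K1 \<Longrightarrow> norm y \<le> M"
    using compact_imp_bounded bounded_pos by metis
  obtain R where "\<And>x. x \<in> K \<Longrightarrow> norm x \<le> R" using compact_imp_bounded[OF K(1)] bounded_iff by metis
  then have "bounded_support f" unfolding bounded_support_def using f0
    by (intro exI[of _ "R + 1"]) force
  from conv_tendsto_L2[OF _ this f1 f2, of "e / M"] e M(1)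
  obtain d1 where d1: "d1 > 0"
    "\<And>r. mollifier d1 r \<Longrightarrow> (\<integral>\<^sup>+x. ennreal ((conv f r x - f x)\<^sup>2) \<partial>lborel) \<le> ennreal (e / M)"
    by auto
  have "pdf_nn_expectation p (\<lambda>x. (conv f r x - f x)\<^sup>2) \<le> ennreal e" if r: "mollifier (min d0 d1) r" for r
  proof -
    have rs: "smooth r" using r by (simp add: mollifier_def)
    have "continuous_on UNIV (conv f r)"
      by (rule smooth_continuous[OF smooth_conv[OF f1 rs mollifier_bounded_support[OF r]]])
    then have [measurable]: "conv f r \<in> borel_measurable borel" by (rule borel_measurable_continuous_onI)
    have "pdf_nn_expectation p (\<lambda>x. (conv f r x - f x)\<^sup>2)
        \<le> (\<integral>\<^sup>+x. ennreal M * ennreal ((conv f r x - f x)\<^sup>2) \<partial>lborel)"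
      unfolding pdf_nn_expectation_def
    proof (rule nn_integral_mono)
      fix x
      show "ennreal ((conv f r x - f x)\<^sup>2 * p x) * indicator (pdf_support p) x \<le> ennreal M * ennreal ((conv f r x - f x)\<^sup>2)"
      proof (cases "x \<in> K1")
        case True
        then have "(conv f r x - f x)\<^sup>2 * p x \<le> M * (conv f r x - f x)\<^sup>2"
          using M(2)[of "p x"] p0[of x] by (auto simp: mult.commute intro!: mult_right_mono)
        then show ?thesis using M(1) by (auto simp: indicator_def ennreal_mult[symmetric] intro!: ennreal_leI)
      next
        case False
        have "conv f r x = 0"
        proof (rule conv_eq_0[OF r])
          fix y assume "dist x y < min d0 d1"
          then have "y \<notin> K" using False by (auto simp: K1_def dist_commute)
          then show "f y = 0" by (rule f0)
        qed
        moreover have "x \<notin> K" using False d0(1) by (auto simp: K1_def)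
        ultimately show ?thesis using f0 by simp
      qed
    qed
    also have "\<dots> = ennreal M * (\<integral>\<^sup>+x. ennreal ((conv f r x - f x)\<^sup>2) \<partial>lborel)"
      by (simp add: nn_integral_cmult)
    also have "\<dots> \<le> ennreal M * ennreal (e / M)"
      by (intro mult_left_mono d1(2) mollifier_mono[OF r]) auto
    also have "\<dots> = ennreal e" using M(1) e by (simp add: ennreal_mult[symmetric])
    finally show ?thesis .
  qed
  then show ?thesis using d0(1) d1(1) by (intro exI[of _ "min d0 d1"]) auto
qed

section \<open>Classical gradients of locally smooth functions\<close>

lemma grad_eqI:
  assumes "GDERIV f x :> D"
  shows "grad f x = D"
proof -
  have f: "f differentiable (at x)" using assms by (auto simp: gderiv_def intro: differentiableI)
  have "g = D" if "GDERIV f x :> g" for g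
  proof -
    have "(\<lambda>h. h \<bullet> g) = (\<lambda>h. h \<bullet> D)"
      using has_derivative_unique[OF that[unfolded gderiv_def] assms[unfolded gderiv_def]] .
    then show "g = D" by (metis vector_eq_ldot)
  qed
  with assms have "(THE g. GDERIV f x :> g) = D" by (rule the_equality)
  then show ?thesis using f by (simp add: grad_def)
qed

lemma smooth_GDERIV:
  fixes f :: "'a::euclidean_space \<Rightarrow> real"
  assumes "smooth f"
  shows "GDERIV f x :> (\<Sum>b\<in>Basis. pd b f x *\<^sub>R b)"
proof -
  have "frechet_derivative f (at x) = (\<lambda>h. h \<bullet> (\<Sum>b\<in>Basis. pd b f x *\<^sub>R b))"
  proof
    fix h
    show "frechet_derivative f (at x) h = h \<bullet> (\<Sum>b\<in>Basis. pd b f x *\<^sub>R b)"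
      using frechet_derivative_expand[OF smooth_differentiable[OF assms], of x h]
      by (simp add: inner_sum_right mult.commute)
  qed
  then show ?thesis using smooth_has_derivative[OF assms, of x] by (simp add: gderiv_def)
qed

lemma smooth_lipschitz_cball:
  fixes f :: "'a::euclidean_space \<Rightarrow> real"
  assumes "smooth f"
  shows "\<exists>L. L-lipschitz_on (cball x r) f"
proof -
  define G where "G y = (\<Sum>b\<in>Basis. pd b f y *\<^sub>R b)" for y
  have "continuous_on UNIV G"
    unfolding G_def using smooth_continuous_pd[OF assms] by (intro continuous_intros) auto
  then have "compact (G ` cball x r)"
    by (intro compact_continuous_image) (auto intro: continuous_on_subset)
  then have "bounded (G ` cball x r)" by (rule compact_imp_bounded)
  then obtain M where M: "0 < M" "\<forall>y\<in>G ` cball x r. norm y \<le> M"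
    unfolding bounded_pos by (elim exE conjE)
  have "M-lipschitz_on (cball x r) f"
  proof (rule bounded_derivative_imp_lipschitz)
    show "(f has_derivative (\<lambda>h. h \<bullet> G y)) (at y within cball x r)" for y
      using smooth_GDERIV[OF assms, of y] unfolding gderiv_def G_def by (rule has_derivative_at_withinI)
    show "onorm (\<lambda>h. h \<bullet> G y) \<le> M" if "y \<in> cball x r" for y
    proof (rule onorm_le)
      fix h :: 'a
      have "norm (h \<bullet> G y) \<le> norm h * norm (G y)" using Cauchy_Schwarz_ineq2[of h "G y"] by simp
      also have "\<dots> \<le> norm h * M" using M(2) that by (intro mult_left_mono) auto
      finally show "norm (h \<bullet> G y) \<le> M * norm h" by (simp add: mult.commute)
    qed
  qed (use M in auto)
  then show ?thesis by blast
qed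

lemma grad_locally_smooth:
  assumes "open U" "y \<in> U" "smooth f" "\<forall>y\<in>U. \<phi> y = f y"
  shows "grad \<phi> y = (\<Sum>b\<in>Basis. pd b f y *\<^sub>R b)"
proof (rule grad_eqI)
  show "GDERIV \<phi> y :> (\<Sum>b\<in>Basis. pd b f y *\<^sub>R b)"
    unfolding gderiv_def
    by (rule has_derivative_transform_within_open[OF smooth_GDERIV[OF assms(3), unfolded gderiv_def] assms(1,2)])
       (use assms in auto)
qed

text \<open>The hypothesis is what a locally finite sum of smooth functions provides: agreement near
  each point with a globally smooth function, which may change from point to point. The conclusions
  are the properties that admit the sum as a test function and make its gradient measurable on an
  open set.\<close>

lemma locally_smooth_imp:
  fixes \<phi> :: "'a::euclidean_space \<Rightarrow> real"
  assumes S: "\<And>x. x \<in> \<Omega> \<Longrightarrow> \<exists>U f. open U \<and> x \<in> U \<and> smooth f \<and> (\<forall>y\<in>U. \<phi> y = f y)"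
  shows "locally_lipschitz_on \<Omega> \<phi>" "continuous_on \<Omega> \<phi>" "continuous_on \<Omega> (grad \<phi>)"
proof -
  show "continuous_on \<Omega> \<phi>"
  proof (intro continuous_at_imp_continuous_on ballI)
    fix x assume "x \<in> \<Omega>"
    then obtain U f where U: "open U" "x \<in> U" "smooth f" "\<forall>y\<in>U. \<phi> y = f y" using S by blast
    have "continuous_on U f" using smooth_continuous[OF U(3)] by (rule continuous_on_subset) simp
    then have "continuous_on U \<phi>" by (rule continuous_on_eq) (simp add: U(4))
    then show "isCont \<phi> x" by (rule continuous_on_interior) (simp add: U interior_open)
  qed
  show "continuous_on \<Omega> (grad \<phi>)"
  proof (intro continuous_at_imp_continuous_on ballI)
    fix x assume "x \<in> \<Omega>"
    then obtain U f where U: "open U" "x \<in> U" "smooth f" "\<forall>y\<in>U. \<phi> y = f y" using S by blast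
    have "continuous_on UNIV (\<lambda>y. \<Sum>b\<in>Basis. pd b f y *\<^sub>R b)"
      using smooth_continuous_pd[OF U(3)] by (intro continuous_intros) auto
    then have "continuous_on U (\<lambda>y. \<Sum>b\<in>Basis. pd b f y *\<^sub>R b)" by (rule continuous_on_subset) simp
    then have "continuous_on U (grad \<phi>)" 
      by (rule continuous_on_eq) (simp add: grad_locally_smooth[OF U(1) _ U(3,4)])
    then show "isCont (grad \<phi>) x" by (rule continuous_on_interior) (simp add: U interior_open)
  qed
  show "locally_lipschitz_on \<Omega> \<phi>"
    unfolding locally_lipschitz_on_def
  proof (rule local_lipschitzI)
    fix x and t :: real assume "x \<in> \<Omega>"
    then obtain U f where U: "open U" "x \<in> U" "smooth f" "\<forall>y\<in>U. \<phi> y = f y" using S by blast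
    obtain u where u: "u > 0" "cball x u \<subseteq> U" using U(1,2) open_contains_cball by blast
    obtain L where L: "L-lipschitz_on (cball x u) f" using smooth_lipschitz_cball[OF U(3)] by blast
    have "L-lipschitz_on (cball x u \<inter> \<Omega>) \<phi>"
      using lipschitz_on_subset[OF L, of "cball x u \<inter> \<Omega>"] u(2) U(4)
      by (auto simp: lipschitz_on_def subset_iff)
    then show "\<exists>u>0. \<exists>L. \<forall>t\<in>cball t u \<inter> {0}. L-lipschitz_on (cball x u \<inter> \<Omega>) \<phi>"
      using u(1) by blast
  qed
qed

text \<open>Splitting off the first term repeatedly doubles the weights at each turn. In exchange
  for the geometric weights the outer constant 2 does not depend on \<open>N\<close>, so sums whose
  length varies with the point can be treated.\<close>

lemma power2_sum_weighted:
  "(\<Sum>n<N. (a n :: real))\<^sup>2 \<le> 2 * (\<Sum>n<N. 2 ^ n * (a n)\<^sup>2)"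
proof (induction N arbitrary: a)
  case (Suc N)
  have "(\<Sum>n<Suc N. a n)\<^sup>2 = (a 0 + (\<Sum>n<N. a (Suc n)))\<^sup>2" by (simp add: sum.lessThan_Suc_shift del: sum.lessThan_Suc)
  also have "\<dots> \<le> 2 * (a 0)\<^sup>2 + 2 * (\<Sum>n<N. a (Suc n))\<^sup>2" by (rule power2_sum_le)
  also have "\<dots> \<le> 2 * (a 0)\<^sup>2 + 2 * (2 * (\<Sum>n<N. 2 ^ n * (a (Suc n))\<^sup>2))"
    using Suc.IH[of "\<lambda>n. a (Suc n)"] by simp
  also have "\<dots> = 2 * (\<Sum>n<Suc N. 2 ^ n * (a n)\<^sup>2)"
    by (simp add: sum.lessThan_Suc_shift sum_distrib_left mult.assoc del: sum.lessThan_Suc)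
  finally show ?case .
qed simp

text \<open>The error budget of the n-th piece, e / (4 * 4^n), is designed to beat the weight 2 *
  2^n of the preceding inequality: the product is (e/2) 2^(-n).\<close>

lemma suminf_geometric_half_ennreal:
  assumes "0 \<le> e"
  shows "(\<Sum>n. ennreal (2 * 2 ^ n) * ennreal (e / (4 * 4 ^ n))) = ennreal e"
proof -
  have "ennreal (2 * 2 ^ n) * ennreal (e / (4 * 4 ^ n)) = ennreal (e / 2 * (1 / 2) ^ n)" for n
  proof -
    have "(4::real) ^ n = 2 ^ n * 2 ^ n" by (simp flip: power_mult_distrib)
    then have "2 * 2 ^ n * (e / (4 * 4 ^ n)) = e / 2 * (1 / 2) ^ n" by (simp add: power_divide)
    then show ?thesis using assms by (simp add: ennreal_mult[symmetric])
  qed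
  then have "(\<Sum>n. ennreal (2 * 2 ^ n) * ennreal (e / (4 * 4 ^ n))) = (\<Sum>n. ennreal (e / 2 * (1 / 2) ^ n))" by simp
  also have "\<dots> = ennreal e"
  proof (rule sums_unique[symmetric])
    show "(\<lambda>n. ennreal (e / 2 * (1 / 2) ^ n)) sums ennreal e"
    proof -
      have "(\<lambda>n. e / 2 * (1 / 2) ^ n) sums (e / 2 * (1 / (1 - 1 / 2)))"
        by (intro sums_mult geometric_sums) auto
      then show ?thesis using assms by (subst sums_ennreal) auto
    qed
  qed
  finally show ?thesis .
qed

text \<open>The number of terms \<open>N\<close> may depend on x. Each finite sum is dominated
  pointwise by one and the same weighted series of squares, which is then integrated term by
  term.\<close>

lemma pdf_nn_expectation_series_le:
  fixes a :: "nat \<Rightarrow> 'a::euclidean_space \<Rightarrow> real"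
  assumes P: "has_pdf P p" and a: "\<And>n. a n \<in> borel_measurable borel" and e: "0 \<le> e"
    and s: "\<And>x. x \<in> pdf_support p \<Longrightarrow> \<exists>N. s x = (\<Sum>n<N. a n x)"
    and b: "\<And>n. pdf_nn_expectation p (\<lambda>x. (a n x)\<^sup>2) \<le> ennreal (e / (4 * 4 ^ n))"
  shows "pdf_nn_expectation p (\<lambda>x. (s x)\<^sup>2) \<le> ennreal e"
proof -
  have [measurable]: "p \<in> borel_measurable borel" and p0: "\<And>x. 0 \<le> p x" and "open (pdf_support p)"
    using P by (auto simp: has_pdf_def)
  then have [measurable]: "pdf_support p \<in> sets borel" by auto
  note a[measurable]
  let ?t = "\<lambda>n x. ennreal (2 * 2 ^ n) * (ennreal ((a n x)\<^sup>2 * p x) * indicator (pdf_support p) x)"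
  have "pdf_nn_expectation p (\<lambda>x. (s x)\<^sup>2) \<le> (\<integral>\<^sup>+x. (\<Sum>n. ?t n x) \<partial>lborel)"
    unfolding pdf_nn_expectation_def
  proof (rule nn_integral_mono)
    fix x
    show "ennreal ((s x)\<^sup>2 * p x) * indicator (pdf_support p) x \<le> (\<Sum>n. ?t n x)"
    proof (cases "x \<in> pdf_support p")
      case True
      then obtain N where N: "s x = (\<Sum>n<N. a n x)" using s by blast
      have "(s x)\<^sup>2 * p x \<le> (2 * (\<Sum>n<N. 2 ^ n * (a n x)\<^sup>2)) * p x"
        unfolding N using p0 by (intro mult_right_mono power2_sum_weighted)
      also have "\<dots> = (\<Sum>n<N. 2 * 2 ^ n * ((a n x)\<^sup>2 * p x))"
        by (simp add: sum_distrib_left sum_distrib_right mult_ac)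
      finally have "ennreal ((s x)\<^sup>2 * p x) \<le> ennreal (\<Sum>n<N. 2 * 2 ^ n * ((a n x)\<^sup>2 * p x))"
        by (rule ennreal_leI)
      also have "\<dots> = (\<Sum>n<N. ennreal (2 * 2 ^ n * ((a n x)\<^sup>2 * p x)))"
        using p0 by (intro sum_ennreal[symmetric]) auto
      also have "\<dots> = (\<Sum>n<N. ?t n x)"
        using True p0 by (intro sum.cong) (auto simp: ennreal_mult[symmetric])
      also have "\<dots> \<le> (\<Sum>n. ?t n x)" by (intro sum_le_suminf) auto
      finally show ?thesis using True by simp
    qed simp
  qed
  also have "\<dots> = (\<Sum>n. ennreal (2 * 2 ^ n) * pdf_nn_expectation p (\<lambda>x. (a n x)\<^sup>2))"
    unfolding pdf_nn_expectation_def by (subst nn_integral_suminf) (auto simp: nn_integral_cmult)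
  also have "\<dots> \<le> (\<Sum>n. ennreal (2 * 2 ^ n) * ennreal (e / (4 * 4 ^ n)))"
    by (intro suminf_le mult_left_mono b) auto
  also have "\<dots> = ennreal e" by (rule suminf_geometric_half_ennreal[OF e])
  finally show ?thesis .
qed

lemma square_integrable_mult_compact_support:
  fixes u :: "'a::euclidean_space \<Rightarrow> real"
  assumes K: "compact K" and u: "set_integrable lborel K (\<lambda>x. (u x)\<^sup>2)"
    and c: "continuous_on UNIV c" "\<And>x. x \<notin> K \<Longrightarrow> c x = 0"
  shows "integrable lborel (\<lambda>x. (c x * u x)\<^sup>2)"
proof -
  have "integrable lborel (\<lambda>x. (c x)\<^sup>2 * (u x)\<^sup>2)"
    using c by (intro integrable_mult_compact_support[OF K u]) (auto intro: continuous_intros)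
  then show ?thesis by (simp add: power_mult_distrib)
qed

text \<open>One kernel has to serve the localised function and all its partial derivatives, which is
  possible because only finitely many scales are compared. The extra bound \<open>d\<close> limits
  how far mollification spreads the support of the piece.\<close>

lemma Meyers_Serrin_step:
  fixes u :: "'a::euclidean_space \<Rightarrow> real"
  assumes P: "has_pdf P p" and w: "has_weak_gradient (pdf_support p) u g"
    and u: "u \<in> L2 p" and g: "g \<in> L2 p" and K: "compact K" "K \<subseteq> pdf_support p"
    and z: "smooth z" "\<And>x. x \<notin> K \<Longrightarrow> z x = 0" and e: "0 < e" and d: "0 < d"
  shows "\<exists>r. mollifier d r \<and>
    pdf_nn_expectation p (\<lambda>x. (conv (\<lambda>x. z x * u x) r x - z x * u x)\<^sup>2) \<le> ennreal e \<and>
    (\<forall>b\<in>Basis. pdf_nn_expectation p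
      (\<lambda>x. (conv (\<lambda>x. z x * (g x \<bullet> b) + pd b z x * u x) r x - (z x * (g x \<bullet> b) + pd b z x * u x))\<^sup>2) \<le> ennreal e)"
proof -
  let ?S = "pdf_support p"
  have cp: "continuous_on ?S p" using P by (simp add: has_pdf_def)
  have uK: "set_integrable lborel K u" and gK: "set_integrable lborel K g"
    using w K by (auto simp: has_weak_gradient_def locally_integrable_on_def)
  have u2: "set_integrable lborel K (\<lambda>x. (u x)\<^sup>2)"
    using L2_square_integrable_compact[OF u cp K] by simp
  have pz: "pd b z x = 0" if "x \<notin> K" for x b
    by (rule pd_locally_const[of "- K" _ _ 0]) (use that K z in \<open>auto intro: open_Compl compact_imp_closed\<close>)
  have gb: "set_integrable lborel K (\<lambda>x. g x \<bullet> b)" for b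
    using integrable_inner_left[OF gK[unfolded set_integrable_def], of b]
    by (simp add: set_integrable_def inner_scaleR_left)
  have gb2: "set_integrable lborel K (\<lambda>x. (g x \<bullet> b)\<^sup>2)" if b: "b \<in> Basis" for b
    unfolding set_integrable_def
  proof (rule Bochner_Integration.integrable_bound)
    show "integrable lborel (\<lambda>x. indicator K x *\<^sub>R (norm (g x))\<^sup>2)"
      using L2_square_integrable_compact[OF g cp K] by (simp add: set_integrable_def)
    have [measurable]: "(\<lambda>x. indicator K x *\<^sub>R (g x \<bullet> b)) \<in> borel_measurable borel"
      using gb[of b] by (auto simp: set_integrable_def)
    have eq: "indicator K x *\<^sub>R (g x \<bullet> b)\<^sup>2 = (indicator K x *\<^sub>R (g x \<bullet> b))\<^sup>2" for x
      by (simp add: indicator_def)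
    show "(\<lambda>x. indicator K x *\<^sub>R (g x \<bullet> b)\<^sup>2) \<in> borel_measurable lborel"
      unfolding eq by measurable
    have "(g x \<bullet> b)\<^sup>2 \<le> (norm (g x))\<^sup>2" for x
      using Basis_le_norm[OF b, of "g x"] by (simp add: abs_le_square_iff[symmetric])
    then show "AE x in lborel. norm (indicator K x *\<^sub>R (g x \<bullet> b)\<^sup>2) \<le> norm (indicator K x *\<^sub>R (norm (g x))\<^sup>2)"
      by (intro always_eventually allI) (auto simp: indicator_def)
  qed
  let ?v = "\<lambda>x. z x * u x" and ?G = "\<lambda>b x. z x * (g x \<bullet> b) + pd b z x * u x"
  note cz = smooth_continuous[OF z(1)] and cpz = smooth_continuous_pd[OF z(1)]
  have "integrable lborel ?v"
    by (rule integrable_mult_compact_support[OF K(1) uK cz z(2)])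
  moreover have "integrable lborel (\<lambda>x. (?v x)\<^sup>2)"
    by (rule square_integrable_mult_compact_support[OF K(1) u2 cz z(2)])
  ultimately obtain d0 where d0: "d0 > 0" "\<And>r. mollifier d0 r \<Longrightarrow> pdf_nn_expectation p (\<lambda>x. (conv ?v r x - ?v x)\<^sup>2) \<le> ennreal e"
    using conv_tendsto_weighted_L2[OF P K, of ?v e] z(2) e by auto
  have "\<forall>b\<in>Basis. \<exists>d>0. \<forall>r. mollifier d r \<longrightarrow> pdf_nn_expectation p (\<lambda>x. (conv (?G b) r x - ?G b x)\<^sup>2) \<le> ennreal e"
  proof (rule ballI, rule conv_tendsto_weighted_L2[OF P K])
    fix b :: 'a assume b: "b \<in> Basis"
    show "?G b x = 0" if "x \<notin> K" for x using that z(2) pz by simp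
    show G1: "integrable lborel (?G b)" by (rule weak_gradient_cutoff(2)[OF w K z b])
    have "integrable lborel (\<lambda>x. 2 * (z x * (g x \<bullet> b))\<^sup>2 + 2 * (pd b z x * u x)\<^sup>2)"
      by (intro Bochner_Integration.integrable_add integrable_mult_right
          square_integrable_mult_compact_support[OF K(1) gb2[OF b] cz z(2)]
          square_integrable_mult_compact_support[OF K(1) u2 cpz[OF b] pz])
    then show "integrable lborel (\<lambda>x. (?G b x)\<^sup>2)"
    proof (rule Bochner_Integration.integrable_bound)
      show "(\<lambda>x. (?G b x)\<^sup>2) \<in> borel_measurable lborel" using G1 by (intro borel_measurable_power) auto
      show "AE x in lborel. norm ((?G b x)\<^sup>2) \<le> norm (2 * (z x * (g x \<bullet> b))\<^sup>2 + 2 * (pd b z x * u x)\<^sup>2)"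
        using power2_sum_le by (intro always_eventually allI) (auto intro: order_trans[OF _ abs_ge_self])
    qed
  qed (rule e)
  from bchoice[OF this] obtain D where D': "\<forall>b\<in>Basis. D b > 0 \<and> (\<forall>r. mollifier (D b) r \<longrightarrow>
      pdf_nn_expectation p (\<lambda>x. (conv (?G b) r x - ?G b x)\<^sup>2) \<le> ennreal e)"
    by (elim exE)
  have D: "D b > 0" "mollifier (D b) r \<Longrightarrow> pdf_nn_expectation p (\<lambda>x. (conv (?G b) r x - ?G b x)\<^sup>2) \<le> ennreal e"
    if "b \<in> Basis" for b r
    using bspec[OF D' that] by simp_all
  define d' where "d' = min (min d d0) (Min (D ` Basis))"
  have "d' > 0" using d d0 D(1) by (simp add: d'_def)
  then obtain r :: "'a \<Rightarrow> real" where r: "mollifier d' r" using mollifier_exists by blast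
  have "mollifier d r" "mollifier d0 r" by (auto intro: mollifier_mono[OF r] simp: d'_def)
  moreover have "mollifier (D b) r" if "b \<in> Basis" for b
    using that by (auto intro!: mollifier_mono[OF r] simp: d'_def min.coboundedI2)
  ultimately show ?thesis by (intro exI[of _ r] conjI ballI d0(2) D(2))
qed

lemma sum_telescope_cutoff:
  fixes f :: "nat \<Rightarrow> real"
  shows "(\<Sum>n<Suc m. case n of 0 \<Rightarrow> f 0 | Suc k \<Rightarrow> f (Suc k) - f k) = f m"
  by (induction m) auto

text \<open>
  Meyers--Serrin for the weight \<open>p\<close>, which is bounded above and away from zero on compact
  subsets of its support: \<open>u\<close> is cut into pieces along an exhaustion by compact sets \<open>C n\<close>
  and each piece is mollified at its own scale. The cutoffs \<open>z n\<close> are differences of consecutive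
  plateau functions \<open>c n\<close>, so they add up to \<open>1\<close> without any normalisation.
\<close>

lemma Meyers_Serrin:
  fixes u :: "'a::euclidean_space \<Rightarrow> real"
  assumes P: "has_pdf P p" and w: "has_weak_gradient (pdf_support p) u g"
    and u: "u \<in> L2 p" and g: "g \<in> L2 p" and e: "0 < e"
  shows "\<exists>\<phi>. locally_lipschitz_on (pdf_support p) \<phi> \<and> continuous_on (pdf_support p) \<phi> \<and>
    continuous_on (pdf_support p) (grad \<phi>) \<and>
    pdf_nn_expectation p (\<lambda>x. (\<phi> x - u x)\<^sup>2) \<le> ennreal e \<and>
    (\<forall>b\<in>Basis. pdf_nn_expectation p (\<lambda>x. (grad \<phi> x \<bullet> b - g x \<bullet> b)\<^sup>2) \<le> ennreal e)"
proof -
  let ?S = "pdf_support p"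
  have o: "open ?S" using P by (simp add: has_pdf_def)
  obtain C where C: "\<And>n. compact (C n)" "\<And>n. C n \<subseteq> ?S" "\<And>n. C n \<subseteq> interior (C (Suc n))" "\<Union>(range C) = ?S"
    by (rule open_Union_compact_subsets[OF o]) blast
  have Cm: "C m \<subseteq> C n" if "m \<le> n" for m n
    using that by (rule lift_Suc_mono_le[rotated]) (use C(3) interior_subset in blast)
  obtain c where c: "\<And>n. smooth (c n)" "\<And>n x. x \<in> C n \<Longrightarrow> c n x = 1" "\<And>n x. x \<notin> C (Suc n) \<Longrightarrow> c n x = 0"
    using smooth_cutoff_exists[OF C(1,3)] by metis
  define z where "z n x = (case n of 0 \<Rightarrow> c 0 x | Suc k \<Rightarrow> c (Suc k) x - c k x)" for n x
  have z_eq: "z 0 = c 0" "z (Suc k) = (\<lambda>x. c (Suc k) x - c k x)" for k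
    by (auto simp: z_def fun_eq_iff)
  have zs: "smooth (z n)" for n
    by (cases n) (auto simp: z_eq intro: smooth_diff c(1))
  have z0: "z n x = 0" if "x \<notin> C (Suc n)" for n x
  proof -
    have "x \<notin> C n" using that Cm[of n "Suc n"] by auto
    then show ?thesis using that by (cases n) (auto simp: z_def c(3))
  qed
  \<comment> \<open>Both plateau functions in the difference \<open>z (n + 2)\<close> equal 1 on
    \<open>C (Suc n)\<close>, so this piece lives in a shell away from \<open>C n\<close>.\<close>
  have z_inner: "z (n + 2) x = 0" if "x \<in> C (Suc n)" for n x
    using that Cm[of "Suc n" "Suc (Suc n)"] by (auto simp: z_def c(2))
  have zsum: "(\<Sum>n<m + 2. z n x) = 1" if "x \<in> C m" for m x
    using that Cm[of m "Suc m"] by (auto simp: z_def sum_telescope_cutoff[of "\<lambda>n. c n x" "Suc m"] c(2) simp del: sum.lessThan_Suc)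
  \<comment> \<open>The sum runs to \<open>m + 2\<close> because a derivative requires constancy on
    a neighbourhood: the telescoped sum \<open>c (Suc m)\<close> is 1 on \<open>C (Suc m)\<close>,
    whose interior contains \<open>C m\<close>, whereas \<open>c m\<close> is known to be 1 on
    \<open>C m\<close> only.\<close>
  have pzsum: "(\<Sum>n<m + 2. pd b (z n) x) = 0" if "x \<in> C m" for m x b
  proof -
    have "pd b (z n) x = (case n of 0 \<Rightarrow> pd b (c 0) x | Suc k \<Rightarrow> pd b (c (Suc k)) x - pd b (c k) x)" for n
    proof (cases n)
      case (Suc k)
      have "((\<lambda>x. c (Suc k) x - c k x) has_derivative
          (\<lambda>h. frechet_derivative (c (Suc k)) (at x) h - frechet_derivative (c k) (at x) h)) (at x)"
        by (intro has_derivative_diff smooth_has_derivative c(1))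
      from pd_eqI[OF this] show ?thesis by (simp add: z_eq Suc)
    qed (simp add: z_eq)
    then have "(\<Sum>n<m + 2. pd b (z n) x) = pd b (c (Suc m)) x"
      using sum_telescope_cutoff[of "\<lambda>n. pd b (c n) x" "Suc m"] by (simp del: sum.lessThan_Suc)
    also have "\<dots> = 0"
    proof (rule pd_locally_const)
      show "open (interior (C (Suc m)))" by simp
      show "x \<in> interior (C (Suc m))" using that C(3) by blast
      show "c (Suc m) y = 1" if "y \<in> interior (C (Suc m))" for y
        using that interior_subset c(2) by blast
    qed
    finally show ?thesis .
  qed
  let ?G = "\<lambda>n b x. z n x * (g x \<bullet> b) + pd b (z n) x * u x"
  \<comment> \<open>The scale of piece \<open>m + 2\<close> is kept so small that, seen from
    \<open>C m\<close>, its kernel stays in \<open>C (Suc m)\<close>, where the cutoff vanishes. The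
    first two pieces need no restriction, hence the dummy radius 1.\<close>
  have "\<exists>d>0. \<forall>m x. n = m + 2 \<longrightarrow> x \<in> C m \<longrightarrow> cball x d \<subseteq> C (Suc m)" for n
  proof (cases "n < 2")
    case False
    then obtain m where m: "n = m + 2" by (metis add.commute le_Suc_ex not_less)
    obtain d where "d > 0" "(\<Union>x\<in>C m. cball x d) \<subseteq> interior (C (Suc m))"
      using compact_subset_open_imp_cball_epsilon_subset[OF C(1) open_interior C(3)] by blast
    then show ?thesis using m interior_subset by (intro exI[of _ d]) fastforce
  qed (auto intro: exI[of _ 1])
  then obtain d where d: "\<And>n. d n > 0" "\<And>m x. x \<in> C m \<Longrightarrow> cball x (d (m + 2)) \<subseteq> C (Suc m)"
    by metis
  have e4: "0 < e / (4 * 4 ^ n)" for n :: nat using e by simp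
  have "\<forall>n. \<exists>r. mollifier (d n) r \<and>
      pdf_nn_expectation p (\<lambda>x. (conv (\<lambda>x. z n x * u x) r x - z n x * u x)\<^sup>2) \<le> ennreal (e / (4 * 4 ^ n)) \<and>
      (\<forall>b\<in>Basis. pdf_nn_expectation p (\<lambda>x. (conv (?G n b) r x - ?G n b x)\<^sup>2) \<le> ennreal (e / (4 * 4 ^ n)))"
    by (intro allI Meyers_Serrin_step[OF P w u g C(1,2) zs z0 e4 d(1)])
  from choice[OF this] obtain r where r': "\<forall>n. mollifier (d n) (r n) \<and>
      pdf_nn_expectation p (\<lambda>x. (conv (\<lambda>x. z n x * u x) (r n) x - z n x * u x)\<^sup>2) \<le> ennreal (e / (4 * 4 ^ n)) \<and>
      (\<forall>b\<in>Basis. pdf_nn_expectation p (\<lambda>x. (conv (?G n b) (r n) x - ?G n b x)\<^sup>2) \<le> ennreal (e / (4 * 4 ^ n)))"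
    by (elim exE)
  have r: "mollifier (d n) (r n)"
    "pdf_nn_expectation p (\<lambda>x. (conv (\<lambda>x. z n x * u x) (r n) x - z n x * u x)\<^sup>2) \<le> ennreal (e / (4 * 4 ^ n))"
    "b \<in> Basis \<Longrightarrow> pdf_nn_expectation p (\<lambda>x. (conv (?G n b) (r n) x - ?G n b x)\<^sup>2) \<le> ennreal (e / (4 * 4 ^ n))"
    for n b
    using spec[OF r', of n] by simp_all
  define v where "v n = conv (\<lambda>x. z n x * u x) (r n)" for n
  have rs: "smooth (r n)" "bounded_support (r n)" for n
    using r(1)[of n] mollifier_bounded_support by (auto simp: mollifier_def)
  have b0: "(SOME b. b \<in> Basis) \<in> (Basis :: 'a set)" by (simp add: some_in_eq)
  note cut = weak_gradient_cutoff[OF w C(1,2) zs z0]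
  have vs: "smooth (v n)" for n unfolding v_def by (rule smooth_conv[OF cut(1)[OF _ b0] rs]) simp
  \<comment> \<open>This makes the series for \<open>\<phi>\<close> locally finite: on
    \<open>C m\<close> only the first \<open>m + 2\<close> mollified pieces survive.\<close>
  have v0: "v n x = 0" if x: "x \<in> C m" and n: "m + 2 \<le> n" for n m x
    unfolding v_def
  proof (rule conv_eq_0[OF r(1)])
    fix y assume y: "dist x y < d n"
    define k where "k = n - 2"
    have k: "n = k + 2" "m \<le> k" using n by (auto simp: k_def)
    have "x \<in> C k" using x Cm[OF k(2)] by auto
    then have "y \<in> C (Suc k)" using d(2)[of x k] y k(1) by (auto simp: subset_iff)
    then show "z n y * u y = 0" using z_inner k(1) by simp
  qed
  define \<phi> where "\<phi> x = (\<Sum>n. v n x)" for x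
  have phi: "\<phi> x = (\<Sum>n<m + 2. v n x)" if "x \<in> C m" for x m
    unfolding \<phi>_def using v0[OF that] by (intro suminf_finite) auto
  have vsum: "smooth (\<lambda>x. \<Sum>n<m. v n x)" for m
    using vs unfolding smooth_def by (auto intro: Ck_sum)
  have loc: "open (interior (C (Suc m)))" "x \<in> interior (C (Suc m))"
    "\<forall>y\<in>interior (C (Suc m)). \<phi> y = (\<Sum>n<Suc m + 2. v n y)" if "x \<in> C m" for x m
    using that C(3) phi interior_subset by blast+
  have sm: "\<exists>U f. open U \<and> x \<in> U \<and> smooth f \<and> (\<forall>y\<in>U. \<phi> y = f y)" if x: "x \<in> ?S" for x
  proof -
    obtain m where m: "x \<in> C m" using x C(4) by auto
    show ?thesis
      by (rule exI[of _ "interior (C (Suc m))"], rule exI[of _ "\<lambda>x. \<Sum>n<Suc m + 2. v n x"])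
         (rule conjI[OF loc(1)[OF m] conjI[OF loc(2)[OF m] conjI[OF vsum loc(3)[OF m]]]])
  qed
  have gr: "grad \<phi> x \<bullet> b = (\<Sum>n<Suc m + 2. conv (?G n b) (r n) x)" if x: "x \<in> C m" and b: "b \<in> Basis" for x m b
  proof -
    have pv: "pd b (v n) = conv (?G n b) (r n)" for n
      unfolding v_def by (rule pd_conv_weak[OF w C(1,2) zs z0 b r(1)])
    have "grad \<phi> x \<bullet> b = pd b (\<lambda>x. \<Sum>n<Suc m + 2. v n x) x"
      unfolding grad_locally_smooth[OF loc(1,2)[OF x] vsum loc(3)[OF x]]
      using b by (rule inner_sum_left_Basis)
    also have "\<dots> = (\<Sum>n<Suc m + 2. pd b (v n) x)"
      by (rule pd_eqI) (intro has_derivative_sum smooth_has_derivative vs)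
    also have "\<dots> = (\<Sum>n<Suc m + 2. conv (?G n b) (r n) x)"
      by (rule sum.cong[OF refl fun_cong[OF pv]])
    finally show ?thesis .
  qed
  have meas: "conv f (r n) \<in> borel_measurable borel" if "integrable lborel f" for f n
    by (rule borel_measurable_continuous_onI[OF smooth_continuous[OF smooth_conv[OF that rs]]])
  have "pdf_nn_expectation p (\<lambda>x. (\<phi> x - u x)\<^sup>2) \<le> ennreal e"
  proof (rule pdf_nn_expectation_series_le[OF P])
    have i: "integrable lborel (\<lambda>x. z n x * u x)" for n by (rule cut(1)[OF _ b0]) simp
    show "(\<lambda>x. conv (\<lambda>x. z n x * u x) (r n) x - z n x * u x) \<in> borel_measurable borel" for n
      using meas[OF i[of n], of n] i[of n] by auto
    fix x assume "x \<in> ?S"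
    then obtain m where m: "x \<in> C m" using C(4) by auto
    have "\<phi> x - u x = (\<Sum>n<m + 2. v n x) - (\<Sum>n<m + 2. z n x) * u x"
      unfolding phi[OF m] zsum[OF m] by simp
    also have "\<dots> = (\<Sum>n<m + 2. conv (\<lambda>x. z n x * u x) (r n) x - z n x * u x)"
      unfolding v_def by (simp only: sum_subtractf sum_distrib_right)
    finally show "\<exists>N. \<phi> x - u x = (\<Sum>n<N. conv (\<lambda>x. z n x * u x) (r n) x - z n x * u x)" by blast
  qed (use e r(2) in auto)
  moreover have "pdf_nn_expectation p (\<lambda>x. (grad \<phi> x \<bullet> b - g x \<bullet> b)\<^sup>2) \<le> ennreal e" if b: "b \<in> Basis" for b
  proof (rule pdf_nn_expectation_series_le[OF P])
    have i: "integrable lborel (?G n b)" for n by (rule cut(2)[OF _ b]) simp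
    show "(\<lambda>x. conv (?G n b) (r n) x - ?G n b x) \<in> borel_measurable borel" for n
      using meas[OF i[of n], of n] i[of n] by (intro borel_measurable_diff) auto
    fix x assume "x \<in> ?S"
    then obtain m where m: "x \<in> C m" using C(4) by auto
    \<comment> \<open>The gradient at a point of \<open>C m\<close> is computed from the finite sum
      valid on \<open>C (Suc m)\<close>, so the identities for the cutoffs are used one level up to
      give sums of equal length.\<close>
    have m': "x \<in> C (Suc m)" using m Cm[of m "Suc m"] by auto
    have "grad \<phi> x \<bullet> b - g x \<bullet> b = (\<Sum>n<Suc m + 2. conv (?G n b) (r n) x)
       - ((\<Sum>n<Suc m + 2. z n x) * (g x \<bullet> b) + (\<Sum>n<Suc m + 2. pd b (z n) x) * u x)"
      unfolding gr[OF m b] zsum[OF m'] pzsum[OF m'] by simp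
    also have "\<dots> = (\<Sum>n<Suc m + 2. conv (?G n b) (r n) x - ?G n b x)"
      by (simp only: sum_subtractf sum_distrib_right sum.distrib)
    finally show "\<exists>N. grad \<phi> x \<bullet> b - g x \<bullet> b = (\<Sum>n<N. conv (?G n b) (r n) x - ?G n b x)" by blast
  qed (use e r(3)[OF b] in auto)
  ultimately show ?thesis
    by (intro exI[of _ \<phi>] conjI ballI locally_smooth_imp[of ?S \<phi>, OF sm])
qed

section \<open>The Poincare inequality on the Sobolev space\<close>

lemma pdf_measurable:
  assumes "has_pdf P p"
  shows "p \<in> borel_measurable borel" "pdf_support p \<in> sets borel" "0 \<le> p x" "open (pdf_support p)"
  using assms by (auto simp: has_pdf_def)

lemma pdf_integrable_add:
  "pdf_integrable p f \<Longrightarrow> pdf_integrable p g \<Longrightarrow> pdf_integrable p (\<lambda>x. f x + g x)"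
  unfolding pdf_integrable_def using set_integral_add(1)[of lborel "pdf_support p" "\<lambda>x. f x * p x" "\<lambda>x. g x * p x"]
  by (simp add: distrib_right)

lemma pdf_expectation_add:
  "pdf_integrable p f \<Longrightarrow> pdf_integrable p g \<Longrightarrow>
    pdf_expectation p (\<lambda>x. f x + g x) = pdf_expectation p f + pdf_expectation p g"
  unfolding pdf_integrable_def pdf_expectation_def
  using set_integral_add(2)[of lborel "pdf_support p" "\<lambda>x. f x * p x" "\<lambda>x. g x * p x"]
  by (simp add: distrib_right)

lemma pdf_integrable_cmult: "pdf_integrable p f \<Longrightarrow> pdf_integrable p (\<lambda>x. c * f x)"
  unfolding pdf_integrable_def using set_integrable_mult_right[of c lborel "pdf_support p" "\<lambda>x. f x * p x"]
  by (simp add: mult.assoc)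

lemma pdf_expectation_cmult: "pdf_expectation p (\<lambda>x. c * f x) = c * pdf_expectation p f"
  unfolding pdf_expectation_def by (simp add: mult.assoc)

lemma pdf_integrable_diff:
  "pdf_integrable p f \<Longrightarrow> pdf_integrable p g \<Longrightarrow> pdf_integrable p (\<lambda>x. f x - g x)"
  using pdf_integrable_add[of p f "\<lambda>x. (- 1) * g x"] pdf_integrable_cmult[of p g "- 1"] by simp

lemma pdf_expectation_diff:
  "pdf_integrable p f \<Longrightarrow> pdf_integrable p g \<Longrightarrow>
    pdf_expectation p (\<lambda>x. f x - g x) = pdf_expectation p f - pdf_expectation p g"
  using pdf_expectation_add[of p f "\<lambda>x. (- 1) * g x"] pdf_integrable_cmult[of p g "- 1"]
    pdf_expectation_cmult[of p "- 1" g] by simp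

lemma pdf_expectation_mono:
  assumes "has_pdf P p" "pdf_integrable p f" "pdf_integrable p g" "\<And>x. x \<in> pdf_support p \<Longrightarrow> f x \<le> g x"
  shows "pdf_expectation p f \<le> pdf_expectation p g"
  unfolding pdf_expectation_def using assms
  by (intro set_integral_mono) (auto simp: pdf_integrable_def has_pdf_def intro!: mult_right_mono)

lemma pdf_expectation_nonneg:
  assumes "has_pdf P p" "\<And>x. x \<in> pdf_support p \<Longrightarrow> 0 \<le> f x"
  shows "0 \<le> pdf_expectation p f"
  unfolding pdf_expectation_def set_lebesgue_integral_def
  using assms by (intro Bochner_Integration.integral_nonneg) (auto simp: indicator_def has_pdf_def)

lemma set_borel_measurable_continuous_open:
  "open S \<Longrightarrow> continuous_on S f \<Longrightarrow> set_borel_measurable lborel S f"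
  for f :: "'a::euclidean_space \<Rightarrow> 'b::euclidean_space"
  unfolding set_borel_measurable_def
  using borel_measurable_continuous_on_indicator[of S f] by simp

lemma set_borel_measurable_mult_pdf:
  assumes "has_pdf P p" "set_borel_measurable lborel (pdf_support p) f"
  shows "set_borel_measurable lborel (pdf_support p) (\<lambda>x. (f x :: real) * p x)"
proof -
  have [measurable]: "(\<lambda>x. indicator (pdf_support p) x *\<^sub>R f x) \<in> borel_measurable borel"
    using assms(2) by (simp add: set_borel_measurable_def)
  have [measurable]: "p \<in> borel_measurable borel" using pdf_measurable[OF assms(1)] by simp
  have eq: "(\<lambda>x. indicator (pdf_support p) x *\<^sub>R (f x * p x)) = (\<lambda>x. (indicator (pdf_support p) x *\<^sub>R f x) * p x)"
    by (simp add: mult.assoc)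
  show ?thesis unfolding set_borel_measurable_def eq by measurable
qed

lemma pdf_integrable_bound:
  assumes P: "has_pdf P p" and f: "set_borel_measurable lborel (pdf_support p) f" and g: "pdf_integrable p g"
    and le: "\<And>x. x \<in> pdf_support p \<Longrightarrow> \<bar>f x\<bar> \<le> g x"
  shows "pdf_integrable p f"
  unfolding pdf_integrable_def set_integrable_def
proof (rule Bochner_Integration.integrable_bound)
  show "integrable lborel (\<lambda>x. indicator (pdf_support p) x *\<^sub>R (g x * p x))"
    using g by (simp add: pdf_integrable_def set_integrable_def)
  show "(\<lambda>x. indicator (pdf_support p) x *\<^sub>R (f x * p x)) \<in> borel_measurable lborel"
    using set_borel_measurable_mult_pdf[OF P f] by (simp add: set_borel_measurable_def)
  have "norm (indicator (pdf_support p) x *\<^sub>R (f x * p x)) \<le> norm (indicator (pdf_support p) x *\<^sub>R (g x * p x))" for x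
    using le[of x] pdf_measurable(3)[OF P, of x]
    by (auto simp: indicator_def abs_mult intro!: mult_right_mono)
  then show "AE x in lborel. norm (indicator (pdf_support p) x *\<^sub>R (f x * p x))
      \<le> norm (indicator (pdf_support p) x *\<^sub>R (g x * p x))" by simp
qed

lemma pdf_total_mass:
  assumes "has_pdf P p"
  shows "pdf_integrable p (\<lambda>x. c)" "pdf_expectation p (\<lambda>x. c) = c"
proof -
  note m[measurable] = pdf_measurable(1,2)[OF assms] and p0 = pdf_measurable(3)[OF assms]
  have eq: "(\<lambda>x. indicator (pdf_support p) x *\<^sub>R (1 * p x)) = p"
    using p0 by (auto simp: fun_eq_iff indicator_def pdf_support_def not_less intro: antisym)
  have "prob_space P" using assms unfolding has_pdf_def by blast
  then have "emeasure P (space P) = 1" by (rule prob_space.emeasure_space_1)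
  moreover have "P = density lborel (\<lambda>x. ennreal (p x))" using assms by (simp add: has_pdf_def)
  ultimately have n: "(\<integral>\<^sup>+x. ennreal (p x) \<partial>lborel) = 1"
    by (simp add: emeasure_density)
  have "integrable lborel p" using n p0 by (intro integrableI_nonneg) auto
  then have 1: "pdf_integrable p (\<lambda>x. 1)"
    unfolding pdf_integrable_def set_integrable_def eq .
  have "(LINT x|lborel. p x) = 1" using n p0 by (subst integral_eq_nn_integral) auto
  then have 2: "pdf_expectation p (\<lambda>x. 1) = 1"
    unfolding pdf_expectation_def set_lebesgue_integral_def eq .
  show "pdf_integrable p (\<lambda>x. c)" "pdf_expectation p (\<lambda>x. c) = c"
    using pdf_integrable_cmult[OF 1, of c] pdf_expectation_cmult[of p c "\<lambda>x. 1"] 2 by simp_all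
qed

lemma pdf_nn_expectation_eq:
  assumes P: "has_pdf P p" and f: "pdf_integrable p f" "\<And>x. 0 \<le> f x"
  shows "pdf_nn_expectation p f = ennreal (pdf_expectation p f)"
proof -
  have eq: "ennreal (f x * p x) * indicator (pdf_support p) x
      = ennreal (indicator (pdf_support p) x *\<^sub>R (f x * p x))" for x
    by (simp add: indicator_def)
  show ?thesis
    unfolding pdf_nn_expectation_def pdf_expectation_def set_lebesgue_integral_def eq
    using f pdf_measurable(3)[OF P] by (intro nn_integral_eq_integral) (auto simp: pdf_integrable_def set_integrable_def)
qed

lemma pdf_integrable_nonnegI:
  assumes P: "has_pdf P p" and f: "set_borel_measurable lborel (pdf_support p) f" "\<And>x. 0 \<le> f x"
    and fin: "pdf_nn_expectation p f < \<infinity>"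
  shows "pdf_integrable p f"
proof -
  have eq: "ennreal (f x * p x) * indicator (pdf_support p) x
      = ennreal (indicator (pdf_support p) x *\<^sub>R (f x * p x))" for x
    by (simp add: indicator_def)
  show ?thesis unfolding pdf_integrable_def set_integrable_def
    using fin f(2) set_borel_measurable_mult_pdf[OF P f(1)] pdf_measurable(3)[OF P]
    by (intro integrableI_nonneg) (auto simp: set_borel_measurable_def pdf_nn_expectation_def eq)
qed

lemma L2_real_iff:
  "u \<in> L2 p \<longleftrightarrow> set_borel_measurable lborel (pdf_support p) u \<and> pdf_integrable p (\<lambda>x. (u x)\<^sup>2)"
  for u :: "'a::euclidean_space \<Rightarrow> real"
  by (simp add: L2_def)

lemma L2_mult:
  fixes u v :: "'a::euclidean_space \<Rightarrow> real"
  assumes P: "has_pdf P p" and u: "u \<in> L2 p" and v: "v \<in> L2 p"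
  shows "pdf_integrable p (\<lambda>x. u x * v x)"
proof (rule pdf_integrable_bound[OF P])
  have [measurable]: "(\<lambda>x. indicator (pdf_support p) x *\<^sub>R u x) \<in> borel_measurable borel"
      "(\<lambda>x. indicator (pdf_support p) x *\<^sub>R v x) \<in> borel_measurable borel"
    using u v by (auto simp: L2_def set_borel_measurable_def)
  have eq: "indicator (pdf_support p) x *\<^sub>R (u x * v x)
      = (indicator (pdf_support p) x *\<^sub>R u x) * (indicator (pdf_support p) x *\<^sub>R v x)" for x
    by (simp add: indicator_def)
  show "set_borel_measurable lborel (pdf_support p) (\<lambda>x. u x * v x)"
    unfolding set_borel_measurable_def eq by measurable
  show "pdf_integrable p (\<lambda>x. (u x)\<^sup>2 + (v x)\<^sup>2)"
    using u v by (intro pdf_integrable_add) (auto simp: L2_real_iff)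
  show "\<bar>u x * v x\<bar> \<le> (u x)\<^sup>2 + (v x)\<^sup>2" for x
    using sum_squares_bound[of "\<bar>u x\<bar>" "\<bar>v x\<bar>"] mult_nonneg_nonneg[of "\<bar>u x\<bar>" "\<bar>v x\<bar>"]
    unfolding abs_mult power2_abs by linarith
qed

lemma L2_const: "has_pdf P p \<Longrightarrow> (\<lambda>x. c :: real) \<in> L2 p"
  using pdf_total_mass(1)[of P p "c\<^sup>2"] pdf_measurable(2)[of P p]
  by (auto simp: L2_real_iff set_borel_measurable_def)

lemma L2_integrable: "has_pdf P p \<Longrightarrow> u \<in> L2 p \<Longrightarrow> pdf_integrable p u"
  for u :: "'a::euclidean_space \<Rightarrow> real"
  using L2_mult[OF _ _ L2_const[of P p 1], of P u] by simp

lemma L2_add: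
  fixes u v :: "'a::euclidean_space \<Rightarrow> real"
  assumes P: "has_pdf P p" and u: "u \<in> L2 p" and v: "v \<in> L2 p"
  shows "(\<lambda>x. u x + v x) \<in> L2 p"
proof -
  have [measurable]: "(\<lambda>x. indicator (pdf_support p) x *\<^sub>R u x) \<in> borel_measurable borel"
      "(\<lambda>x. indicator (pdf_support p) x *\<^sub>R v x) \<in> borel_measurable borel"
    using u v by (auto simp: L2_def set_borel_measurable_def)
  have "set_borel_measurable lborel (pdf_support p) (\<lambda>x. u x + v x)"
    unfolding set_borel_measurable_def scaleR_add_right by measurable
  moreover have "pdf_integrable p (\<lambda>x. ((u x)\<^sup>2 + (v x)\<^sup>2) + 2 * (u x * v x))"
    using u v L2_mult[OF P u v] by (intro pdf_integrable_add pdf_integrable_cmult) (auto simp: L2_real_iff)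
  ultimately show ?thesis by (simp add: L2_real_iff power2_sum mult.assoc)
qed

lemma L2_cmult:
  fixes u :: "'a::euclidean_space \<Rightarrow> real"
  assumes u: "u \<in> L2 p"
  shows "(\<lambda>x. c * u x) \<in> L2 p"
proof -
  have [measurable]: "(\<lambda>x. indicator (pdf_support p) x *\<^sub>R u x) \<in> borel_measurable borel"
    using u by (auto simp: L2_def set_borel_measurable_def)
  have eq: "indicator (pdf_support p) x *\<^sub>R (c * u x) = c * (indicator (pdf_support p) x *\<^sub>R u x)" for x by simp
  have "set_borel_measurable lborel (pdf_support p) (\<lambda>x. c * u x)"
    unfolding set_borel_measurable_def eq by measurable
  then show ?thesis using u pdf_integrable_cmult[of p "\<lambda>x. (u x)\<^sup>2" "c\<^sup>2"]
    by (simp add: L2_real_iff power_mult_distrib)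
qed

lemma L2_diff:
  fixes u v :: "'a::euclidean_space \<Rightarrow> real"
  assumes "has_pdf P p" "u \<in> L2 p" "v \<in> L2 p"
  shows "(\<lambda>x. u x - v x) \<in> L2 p"
  using L2_add[OF assms(1,2) L2_cmult[OF assms(3), of "- 1"]] by simp

text \<open>The expectation of (u - s v)^2 is a nonnegative quadratic polynomial in s, evaluated at
  its minimiser b/c when the leading coefficient is nonzero.\<close>

lemma Cauchy_Schwarz_pdf_expectation:
  fixes u v :: "'a::euclidean_space \<Rightarrow> real"
  assumes P: "has_pdf P p" and u: "u \<in> L2 p" and v: "v \<in> L2 p"
  shows "(pdf_expectation p (\<lambda>x. u x * v x))\<^sup>2 \<le> pdf_expectation p (\<lambda>x. (u x)\<^sup>2) * pdf_expectation p (\<lambda>x. (v x)\<^sup>2)"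
proof -
  define a b c where "a = pdf_expectation p (\<lambda>x. (u x)\<^sup>2)" and "b = pdf_expectation p (\<lambda>x. u x * v x)"
    and "c = pdf_expectation p (\<lambda>x. (v x)\<^sup>2)"
  have c0: "0 \<le> c" unfolding c_def by (rule pdf_expectation_nonneg[OF P]) simp
  have q: "0 \<le> a - 2 * s * b + s\<^sup>2 * c" for s
  proof -
    have i: "pdf_integrable p (\<lambda>x. (u x)\<^sup>2)" "pdf_integrable p (\<lambda>x. (2 * s) * (u x * v x))"
      "pdf_integrable p (\<lambda>x. s\<^sup>2 * (v x)\<^sup>2)"
      using u v L2_mult[OF P u v] by (auto simp: L2_real_iff intro!: pdf_integrable_cmult)
    have "0 \<le> pdf_expectation p (\<lambda>x. (u x - s * v x)\<^sup>2)" by (rule pdf_expectation_nonneg[OF P]) simp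
    also have "(\<lambda>x. (u x - s * v x)\<^sup>2) = (\<lambda>x. ((u x)\<^sup>2 - (2 * s) * (u x * v x)) + s\<^sup>2 * (v x)\<^sup>2)"
      by (auto simp: power2_eq_square algebra_simps)
    also have "pdf_expectation p \<dots> = a - 2 * s * b + s\<^sup>2 * c"
      unfolding pdf_expectation_add[OF pdf_integrable_diff[OF i(1,2)] i(3)] pdf_expectation_diff[OF i(1,2)]
        pdf_expectation_cmult a_def b_def c_def ..
    finally show ?thesis .
  qed
  have "b\<^sup>2 \<le> a * c"
  proof (cases "c = 0")
    case True
    have "b = 0"
    proof (rule ccontr)
      assume "b \<noteq> 0"
      \<comment> \<open>With \<open>c = 0\<close> the polynomial is affine in s, and this value of s
        makes it equal to -1.\<close>
      then show False using q[of "(a + 1) / (2 * b)"] True by simp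
    qed
    then show ?thesis using True by simp
  next
    case False
    have "0 \<le> (a - 2 * (b / c) * b + (b / c)\<^sup>2 * c) * c" using q[of "b / c"] c0 by simp
    also have "\<dots> = a * c - b\<^sup>2" using False by (simp add: power2_eq_square field_simps)
    finally show ?thesis by simp
  qed
  then show ?thesis by (simp add: a_def b_def c_def)
qed

lemma pdf_expectation_square_le:
  fixes u :: "'a::euclidean_space \<Rightarrow> real"
  assumes P: "has_pdf P p" and u: "u \<in> L2 p"
  shows "(pdf_expectation p u)\<^sup>2 \<le> pdf_expectation p (\<lambda>x. (u x)\<^sup>2)"
  using Cauchy_Schwarz_pdf_expectation[OF P u L2_const[OF P, of 1]] pdf_total_mass(2)[OF P, of 1] by simp

lemma grad_diff_const: "grad (\<lambda>y. f y - c) x = grad f x"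
proof -
  have h: "((\<lambda>y. f y - c) has_derivative D) (at x) \<longleftrightarrow> (f has_derivative D) (at x)" for D
    using has_derivative_add[of "\<lambda>y. f y - c" D "at x" "\<lambda>y. c" "\<lambda>h. 0"]
      has_derivative_diff[of f D "at x" "\<lambda>y. c" "\<lambda>h. 0"] by auto
  then have "gderiv (\<lambda>y. f y - c) x = gderiv f x" by (simp add: fun_eq_iff gderiv_def)
  then show ?thesis using h by (simp add: grad_def differentiable_def)
qed

lemma locally_lipschitz_on_diff_const:
  "locally_lipschitz_on S f \<Longrightarrow> locally_lipschitz_on S (\<lambda>x. f x - c)"
  by (simp add: locally_lipschitz_on_def local_lipschitz_def lipschitz_on_def dist_real_def)

text \<open>Unlike the bound with factors 2 and 2, the factor of the main term tends to 1 with t, so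
  that no constant is lost in the Poincare inequality.\<close>

lemma power2_sum_young:
  assumes "0 < (t::real)"
  shows "(a + b)\<^sup>2 \<le> (1 + t) * a\<^sup>2 + (1 + 1 / t) * b\<^sup>2"
proof -
  have "0 \<le> (t * a - b)\<^sup>2 / t" using assms by simp
  also have "\<dots> = t * a\<^sup>2 - 2 * a * b + b\<^sup>2 / t"
    using assms by (simp add: power2_eq_square field_simps)
  finally show ?thesis by (simp add: power2_eq_square algebra_simps)
qed

text \<open>The inequality is applied to a recentred approximant \<open>f - m\<close>, and Young's
  inequality with parameter t compares both sides with \<open>u\<close> and \<open>g\<close>. The
  squared errors are of order t^2, so that even multiplied by 1 + 1/t they vanish as t tends to
  0.\<close>

lemma poincare_W12:
  fixes u :: "'a::euclidean_space \<Rightarrow> real"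
  assumes P: "has_pdf P p" and C: "poincare_ineq p C" and w: "has_weak_gradient (pdf_support p) u g"
    and u: "u \<in> L2 p" and g: "g \<in> L2 p" and u0: "pdf_expectation p u = 0"
  shows "pdf_expectation p (\<lambda>x. (u x)\<^sup>2) \<le> C * pdf_expectation p (\<lambda>x. (norm (g x))\<^sup>2)"
proof -
  let ?S = "pdf_support p"
  have C0: "0 \<le> C" using C by (simp add: poincare_ineq_def)
  define A B where "A = pdf_expectation p (\<lambda>x. (u x)\<^sup>2)" and "B = pdf_expectation p (\<lambda>x. (norm (g x))\<^sup>2)"
  have gi: "pdf_integrable p (\<lambda>x. (norm (g x))\<^sup>2)" using g by (simp add: L2_def)
  have gb: "set_borel_measurable lborel ?S (\<lambda>x. g x \<bullet> b)" for b
  proof -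
    have [measurable]: "(\<lambda>x. indicator ?S x *\<^sub>R g x) \<in> borel_measurable borel"
      using g by (simp add: L2_def set_borel_measurable_def)
    have eq: "indicator ?S x *\<^sub>R (g x \<bullet> b) = (indicator ?S x *\<^sub>R g x) \<bullet> b" for x by simp
    show ?thesis unfolding set_borel_measurable_def eq by measurable
  qed
  have gL: "(\<lambda>x. g x \<bullet> b) \<in> L2 p" if b: "b \<in> Basis" for b
  proof -
    have [measurable]: "(\<lambda>x. indicator ?S x *\<^sub>R (g x \<bullet> b)) \<in> borel_measurable borel"
      using gb[of b] by (simp add: set_borel_measurable_def)
    have eq: "indicator ?S x *\<^sub>R (g x \<bullet> b)\<^sup>2 = (indicator ?S x *\<^sub>R (g x \<bullet> b))\<^sup>2" for x
      by (simp add: indicator_def)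
    have "pdf_integrable p (\<lambda>x. (g x \<bullet> b)\<^sup>2)"
    proof (rule pdf_integrable_bound[OF P _ gi])
      show "set_borel_measurable lborel ?S (\<lambda>x. (g x \<bullet> b)\<^sup>2)"
        unfolding set_borel_measurable_def eq by measurable
      show "\<bar>(g x \<bullet> b)\<^sup>2\<bar> \<le> (norm (g x))\<^sup>2" for x
        using Basis_le_norm[OF b, of "g x"] by (simp add: abs_le_square_iff[symmetric])
    qed
    then show ?thesis using gb by (simp add: L2_real_iff)
  qed
  have main: "A \<le> (1 + t) * (C * ((1 + t) * B + (t\<^sup>2 + t))) + 4 * (t\<^sup>2 + t)" if t: "0 < t" for t
  proof -
    \<comment> \<open>Summed over the components of the gradient this tolerance gives t^2, and (1 +
      1/t) t^2 = t^2 + t.\<close>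
    define e where "e = t\<^sup>2 / DIM('a)"
    have e: "0 < e" "e \<le> t\<^sup>2" using t DIM_positive[where 'a='a]
      by (auto simp: e_def divide_le_eq Suc_le_eq mult_le_cancel_left1)
    have t2: "(1 + 1 / t) * t\<^sup>2 = t\<^sup>2 + t" using t by (simp add: power2_eq_square field_simps)
    obtain f where f: "locally_lipschitz_on ?S f" "continuous_on ?S f" "continuous_on ?S (grad f)"
      "pdf_nn_expectation p (\<lambda>x. (f x - u x)\<^sup>2) \<le> ennreal e"
      "\<forall>b\<in>Basis. pdf_nn_expectation p (\<lambda>x. (grad f x \<bullet> b - g x \<bullet> b)\<^sup>2) \<le> ennreal e"
      using Meyers_Serrin[OF P w u g e(1)] by (elim exE conjE)
    note o = pdf_measurable(4)[OF P]
    \<comment> \<open>Applied to \<open>f\<close> against \<open>u\<close> and to each component of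
      \<open>grad f\<close> against that of \<open>g\<close>. Continuity on the open support gives
      measurability, and the finite extended integral then gives integrability.\<close>
    have approx: "(\<lambda>x. v x - q x) \<in> L2 p \<and> pdf_expectation p (\<lambda>x. (v x - q x)\<^sup>2) \<le> e"
      if v: "continuous_on ?S v" and q: "q \<in> L2 p" and le: "pdf_nn_expectation p (\<lambda>x. (v x - q x)\<^sup>2) \<le> ennreal e"
      for v q :: "'a \<Rightarrow> real"
    proof -
      have [measurable]: "(\<lambda>x. indicator ?S x *\<^sub>R v x) \<in> borel_measurable borel"
        using set_borel_measurable_continuous_open[OF o v] by (simp add: set_borel_measurable_def)
      have [measurable]: "(\<lambda>x. indicator ?S x *\<^sub>R q x) \<in> borel_measurable borel"
        using q by (simp add: L2_def set_borel_measurable_def)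
      have m: "set_borel_measurable lborel ?S (\<lambda>x. v x - q x)"
        unfolding set_borel_measurable_def scaleR_diff_right by measurable
      have eq: "indicator ?S x *\<^sub>R (v x - q x)\<^sup>2 = (indicator ?S x *\<^sub>R v x - indicator ?S x *\<^sub>R q x)\<^sup>2" for x
        by (simp add: indicator_def)
      have "set_borel_measurable lborel ?S (\<lambda>x. (v x - q x)\<^sup>2)"
        unfolding set_borel_measurable_def eq by measurable
      then have i: "pdf_integrable p (\<lambda>x. (v x - q x)\<^sup>2)"
        by (rule pdf_integrable_nonnegI[OF P]) (use le in \<open>auto intro: le_less_trans\<close>)
      have "pdf_expectation p (\<lambda>x. (v x - q x)\<^sup>2) \<le> e"
        using le e(1) by (simp add: pdf_nn_expectation_eq[OF P i])
      then show ?thesis using m i by (simp add: L2_real_iff)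
    qed
    have fu: "(\<lambda>x. f x - u x) \<in> L2 p" "pdf_expectation p (\<lambda>x. (f x - u x)\<^sup>2) \<le> e"
      using approx[OF f(2) u f(4)] by auto
    have fL: "f \<in> L2 p" using L2_add[OF P fu(1) u] by simp
    \<comment> \<open>\<open>f\<close> need not have mean 0, but \<open>u\<close> has, so
      \<open>m\<close> is the mean of \<open>f - u\<close> and its square is bounded by the L^2
      error.\<close>
    define m where "m = pdf_expectation p f"
    have m: "m = pdf_expectation p (\<lambda>x. f x - u x)"
      using pdf_expectation_diff[OF L2_integrable[OF P fL] L2_integrable[OF P u]] u0 by (simp add: m_def)
    then have m2: "m\<^sup>2 \<le> e" using pdf_expectation_square_le[OF P fu(1)] fu(2) by simp
    have psiL: "(\<lambda>x. f x - m) \<in> L2 p" by (rule L2_diff[OF P fL L2_const[OF P]])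
    have psi0: "pdf_expectation p (\<lambda>x. f x - m) = 0"
      using pdf_expectation_diff[OF L2_integrable[OF P fL] pdf_total_mass(1)[OF P, of m]] pdf_total_mass(2)[OF P, of m]
      by (simp add: m_def)
    have grb: "pdf_integrable p (\<lambda>x. (grad f x \<bullet> b)\<^sup>2) \<and>
        pdf_expectation p (\<lambda>x. (grad f x \<bullet> b)\<^sup>2) \<le> (1 + t) * pdf_expectation p (\<lambda>x. (g x \<bullet> b)\<^sup>2) + (1 + 1 / t) * e"
      if b: "b \<in> Basis" for b
    proof -
      have d: "(\<lambda>x. grad f x \<bullet> b - g x \<bullet> b) \<in> L2 p" "pdf_expectation p (\<lambda>x. (grad f x \<bullet> b - g x \<bullet> b)\<^sup>2) \<le> e"
        using approx[OF continuous_on_inner[OF f(3) continuous_on_const] gL[OF b], of b] f(5) b by auto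
      have L: "(\<lambda>x. grad f x \<bullet> b) \<in> L2 p" using L2_add[OF P d(1) gL[OF b]] by simp
      have i: "pdf_integrable p (\<lambda>x. (1 + t) * (g x \<bullet> b)\<^sup>2)" "pdf_integrable p (\<lambda>x. (1 + 1 / t) * (grad f x \<bullet> b - g x \<bullet> b)\<^sup>2)"
        using gL[OF b] d(1) by (auto simp: L2_real_iff intro!: pdf_integrable_cmult)
      have "pdf_expectation p (\<lambda>x. (grad f x \<bullet> b)\<^sup>2)
          \<le> pdf_expectation p (\<lambda>x. (1 + t) * (g x \<bullet> b)\<^sup>2 + (1 + 1 / t) * (grad f x \<bullet> b - g x \<bullet> b)\<^sup>2)"
      proof (rule pdf_expectation_mono[OF P])
        show "pdf_integrable p (\<lambda>x. (grad f x \<bullet> b)\<^sup>2)" using L by (simp add: L2_real_iff)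
        show "(grad f x \<bullet> b)\<^sup>2 \<le> (1 + t) * (g x \<bullet> b)\<^sup>2 + (1 + 1 / t) * (grad f x \<bullet> b - g x \<bullet> b)\<^sup>2" for x
          using power2_sum_young[OF t, of "g x \<bullet> b" "grad f x \<bullet> b - g x \<bullet> b"] by simp
      qed (rule pdf_integrable_add[OF i])
      also have "\<dots> = (1 + t) * pdf_expectation p (\<lambda>x. (g x \<bullet> b)\<^sup>2)
          + (1 + 1 / t) * pdf_expectation p (\<lambda>x. (grad f x \<bullet> b - g x \<bullet> b)\<^sup>2)"
        unfolding pdf_expectation_add[OF i] pdf_expectation_cmult ..
      also have "\<dots> \<le> (1 + t) * pdf_expectation p (\<lambda>x. (g x \<bullet> b)\<^sup>2) + (1 + 1 / t) * e"
        using d(2) t by (intro add_left_mono mult_left_mono) auto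
      finally show ?thesis using L by (simp add: L2_real_iff)
    qed
    have norm_sum: "(norm x)\<^sup>2 = (\<Sum>b\<in>Basis. (x \<bullet> b)\<^sup>2)" for x :: 'a
      unfolding power2_norm_eq_inner using euclidean_inner[of x x] by (simp add: power2_eq_square)
    have sums: "pdf_integrable p (\<lambda>x. \<Sum>b\<in>I. h b x) \<and>
        pdf_expectation p (\<lambda>x. \<Sum>b\<in>I. h b x) = (\<Sum>b\<in>I. pdf_expectation p (h b))"
      if "finite I" "\<forall>b\<in>I. pdf_integrable p (h b)" for I :: "'a set" and h
      using that
    proof (induction I rule: finite_induct)
      case empty
      then show ?case using pdf_total_mass[OF P, of 0] by simp
    next
      case (insert b I)
      then show ?case using pdf_integrable_add[of p "h b" "\<lambda>x. \<Sum>b\<in>I. h b x"]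
          pdf_expectation_add[of p "h b" "\<lambda>x. \<Sum>b\<in>I. h b x"] by simp
    qed
    have fs: "pdf_integrable p (\<lambda>x. (norm (grad f x))\<^sup>2)"
        "pdf_expectation p (\<lambda>x. (norm (grad f x))\<^sup>2) = (\<Sum>b\<in>Basis. pdf_expectation p (\<lambda>x. (grad f x \<bullet> b)\<^sup>2))"
      unfolding norm_sum using sums[of Basis "\<lambda>b x. (grad f x \<bullet> b)\<^sup>2"] grb by auto
    have gs: "B = (\<Sum>b\<in>Basis. pdf_expectation p (\<lambda>x. (g x \<bullet> b)\<^sup>2))"
      unfolding norm_sum B_def using sums[of Basis "\<lambda>b x. (g x \<bullet> b)\<^sup>2"] gL by (auto simp: L2_real_iff)
    have "pdf_expectation p (\<lambda>x. (norm (grad f x))\<^sup>2)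
        \<le> (\<Sum>b\<in>Basis. (1 + t) * pdf_expectation p (\<lambda>x. (g x \<bullet> b)\<^sup>2) + (1 + 1 / t) * e)"
      unfolding fs(2) using grb by (intro sum_mono) auto
    also have "\<dots> = (1 + t) * B + (1 + 1 / t) * t\<^sup>2"
      unfolding gs by (simp add: sum.distrib sum_distrib_left e_def)
    finally have grad_le: "pdf_expectation p (\<lambda>x. (norm (grad f x))\<^sup>2) \<le> (1 + t) * B + (t\<^sup>2 + t)"
      unfolding t2 .
    have "pdf_nn_expectation p (\<lambda>x. (f x - m)\<^sup>2)
        \<le> ennreal C * pdf_nn_expectation p (\<lambda>x. (norm (grad (\<lambda>x. f x - m) x))\<^sup>2)"
      using C locally_lipschitz_on_diff_const[OF f(1), of m] psiL psi0 unfolding poincare_ineq_def by simp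
    also have "\<dots> = ennreal (C * pdf_expectation p (\<lambda>x. (norm (grad f x))\<^sup>2))"
      unfolding grad_diff_const using C0 pdf_expectation_nonneg[OF P, of "\<lambda>x. (norm (grad f x))\<^sup>2"]
      by (simp add: pdf_nn_expectation_eq[OF P fs(1)] ennreal_mult)
    finally have "ennreal (pdf_expectation p (\<lambda>x. (f x - m)\<^sup>2)) \<le> ennreal (C * pdf_expectation p (\<lambda>x. (norm (grad f x))\<^sup>2))"
      using psiL by (simp add: pdf_nn_expectation_eq[OF P] L2_real_iff)
    then have psi_le: "pdf_expectation p (\<lambda>x. (f x - m)\<^sup>2) \<le> C * pdf_expectation p (\<lambda>x. (norm (grad f x))\<^sup>2)"
      using C0 pdf_expectation_nonneg[OF P, of "\<lambda>x. (norm (grad f x))\<^sup>2"] by (subst (asm) ennreal_le_iff) auto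
    have i1: "pdf_integrable p (\<lambda>x. (1 + t) * (f x - m)\<^sup>2)"
      using psiL by (auto simp: L2_real_iff intro!: pdf_integrable_cmult)
    have i2: "pdf_integrable p (\<lambda>x. (1 + 1 / t) * (2 * (f x - u x)\<^sup>2))"
      using fu(1) by (auto simp: L2_real_iff intro!: pdf_integrable_cmult)
    note i3 = pdf_total_mass(1)[OF P, of "(1 + 1 / t) * (2 * m\<^sup>2)"]
    have "A \<le> pdf_expectation p (\<lambda>x. ((1 + t) * (f x - m)\<^sup>2 + (1 + 1 / t) * (2 * (f x - u x)\<^sup>2)) + (1 + 1 / t) * (2 * m\<^sup>2))"
      unfolding A_def
    proof (rule pdf_expectation_mono[OF P])
      fix x
      \<comment> \<open>Young's inequality for u = (f - m) + (m - (f - u)).\<close>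
      have "(u x)\<^sup>2 \<le> (1 + t) * (f x - m)\<^sup>2 + (1 + 1 / t) * (m - (f x - u x))\<^sup>2"
        using power2_sum_young[OF t, of "f x - m" "m - (f x - u x)"] by simp
      also have "\<dots> \<le> (1 + t) * (f x - m)\<^sup>2 + (1 + 1 / t) * (2 * m\<^sup>2 + 2 * (f x - u x)\<^sup>2)"
        using t by (intro add_left_mono mult_left_mono power2_diff_le) auto
      finally show "(u x)\<^sup>2 \<le> ((1 + t) * (f x - m)\<^sup>2 + (1 + 1 / t) * (2 * (f x - u x)\<^sup>2)) + (1 + 1 / t) * (2 * m\<^sup>2)"
        by (simp add: distrib_left)
    qed (use u in \<open>auto simp: L2_real_iff intro!: pdf_integrable_add i1 i2 i3\<close>)
    also have "\<dots> = (1 + t) * pdf_expectation p (\<lambda>x. (f x - m)\<^sup>2)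
        + (1 + 1 / t) * (2 * pdf_expectation p (\<lambda>x. (f x - u x)\<^sup>2)) + (1 + 1 / t) * (2 * m\<^sup>2)"
      unfolding pdf_expectation_add[OF pdf_integrable_add[OF i1 i2] i3] pdf_expectation_add[OF i1 i2]
        pdf_total_mass(2)[OF P] pdf_expectation_cmult ..
    also have "\<dots> \<le> (1 + t) * (C * ((1 + t) * B + (t\<^sup>2 + t))) + (1 + 1 / t) * (2 * t\<^sup>2) + (1 + 1 / t) * (2 * t\<^sup>2)"
      using t C0 fu(2) m2 e(2) psi_le grad_le
      by (intro add_mono mult_left_mono order_trans[OF psi_le] mult_left_mono[OF grad_le]) auto
    also have "(1 + 1 / t) * (2 * t\<^sup>2) = 2 * (t\<^sup>2 + t)" using t2 by simp
    finally show ?thesis by simp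
  qed
  have "A \<le> (1 + 0) * (C * ((1 + 0) * B + (0\<^sup>2 + 0))) + 4 * (0\<^sup>2 + 0)"
  proof (rule tendsto_lowerbound)
    show "((\<lambda>t. (1 + t) * (C * ((1 + t) * B + (t\<^sup>2 + t))) + 4 * (t\<^sup>2 + t)) \<longlongrightarrow>
        (1 + 0) * (C * ((1 + 0) * B + (0\<^sup>2 + 0))) + 4 * (0\<^sup>2 + 0)) (at_right (0::real))"
      by (intro tendsto_intros)
    show "\<forall>\<^sub>F t in at_right 0. A \<le> (1 + t) * (C * ((1 + t) * B + (t\<^sup>2 + t))) + 4 * (t\<^sup>2 + t)"
      using main by (intro eventually_at_rightI[of 0 1]) auto
  qed simp
  then show ?thesis by (simp add: A_def B_def)
qed

section \<open>The Wasserstein bound\<close>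

text \<open>Moving from \<open>x\<close> in the direction of the gradient \<open>g\<close> itself,
  the first-order increment is the step length times |g|, while the Lipschitz bound allows at most L
  times the step length. At points of non-differentiability \<open>grad\<close> has the default
  value 0.\<close>

lemma norm_grad_lipschitz_le:
  fixes h :: "'a::euclidean_space \<Rightarrow> real"
  assumes h: "L-lipschitz_on S h" and S: "open S" "x \<in> S"
  shows "norm (grad h x) \<le> L"
proof (cases "h differentiable (at x)")
  case False
  then show ?thesis using lipschitz_on_nonneg[OF h] by (simp add: grad_def)
next
  case True
  define g where "g = (\<Sum>b\<in>Basis. pd b h x *\<^sub>R b)"
  have "frechet_derivative h (at x) = (\<lambda>k. k \<bullet> g)"
  proof
    show "frechet_derivative h (at x) k = k \<bullet> g" for k
      using frechet_derivative_expand[OF True, of k] by (simp add: g_def inner_sum_right mult.commute)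
  qed
  then have d: "(h has_derivative (\<lambda>k. k \<bullet> g)) (at x)" using True by (simp add: frechet_derivative_works)
  then have gg: "grad h x = g" by (intro grad_eqI) (simp add: gderiv_def)
  show ?thesis
  proof (rule field_le_epsilon)
    fix e :: real assume e: "0 < e"
    obtain a where a: "a > 0" "\<And>y. norm (y - x) < a \<Longrightarrow> norm (h y - h x - (y - x) \<bullet> g) \<le> e * norm (y - x)"
      using d e unfolding has_derivative_at_alt by blast
    obtain c where c: "c > 0" "ball x c \<subseteq> S" using S open_contains_ball by blast
    show "norm (grad h x) \<le> L + e"
    proof (cases "g = 0")
      case False
      \<comment> \<open>The step length \<open>s * norm g\<close> is half of \<open>min a c\<close>,
        hence inside the ball contained in \<open>S\<close> and within the range of the linear
        approximation.\<close>
      define s where "s = min a c / (2 * norm g)"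
      have s: "s > 0" "s * norm g < a" "s * norm g < c" using a(1) c(1) False by (auto simp: s_def min_def field_simps)
      define y where "y = x + s *\<^sub>R g"
      have y: "y - x = s *\<^sub>R g" "norm (y - x) = s * norm g" using s(1) by (simp_all add: y_def)
      have "y \<in> S" using c(2) s(3) y by (auto simp: dist_norm norm_minus_commute subset_iff)
      then have "\<bar>h y - h x\<bar> \<le> L * (s * norm g)"
        using lipschitz_onD[OF h, of y x] S(2) y False s(1) by (simp add: dist_norm)
      moreover have "\<bar>h y - h x - s * (g \<bullet> g)\<bar> \<le> e * (s * norm g)" using a(2)[of y] s False y by simp
      ultimately have "s * (g \<bullet> g) \<le> L * (s * norm g) + e * (s * norm g)" by linarith
      then have "(s * norm g) * norm g \<le> (s * norm g) * (L + e)"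
        by (simp add: power2_norm_eq_inner[symmetric] power2_eq_square algebra_simps)
      moreover have "s * norm g > 0" using s(1) False by simp
      ultimately show ?thesis unfolding gg by (simp only: mult_le_cancel_left_pos)
    qed (use gg lipschitz_on_nonneg[OF h] e in simp)
  qed
qed

lemma lipschitz_imp_locally_lipschitz_on: "L-lipschitz_on S f \<Longrightarrow> locally_lipschitz_on S f"
  unfolding locally_lipschitz_on_def
  by (intro local_lipschitzI exI[of _ 1]) (auto intro!: exI[of _ L] intro: lipschitz_on_subset)

text \<open>A 1-Lipschitz function grows at most linearly: |h x| <= K + |x - \<mu>| on the support,
  with K read off from any reference point \<open>x0\<close>. The finite variance makes the
  right-hand side square integrable.\<close>

lemma Lip1_in_L2:
  fixes h :: "'a::euclidean_space \<Rightarrow> real"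
  assumes P: "has_pdf P p" and v: "finite_variance P" and h: "h \<in> Lip1 (pdf_support p)"
  shows "h \<in> L2 p"
proof -
  let ?S = "pdf_support p"
  note m[measurable] = pdf_measurable(1,2)[OF P]
  have lip: "1-lipschitz_on ?S h" using h by (simp add: Lip1_def)
  have meas: "set_borel_measurable lborel ?S h"
    by (rule set_borel_measurable_continuous_open[OF pdf_measurable(4)[OF P] lipschitz_on_continuous_on[OF lip]])
  define \<mu> where "\<mu> = integral\<^sup>L P (\<lambda>y. y)"
  have "integrable P (\<lambda>x. (norm (x - \<mu>))\<^sup>2)" using v by (simp add: finite_variance_def \<mu>_def)
  then have "integrable (density lborel (\<lambda>x. ennreal (p x))) (\<lambda>x. (norm (x - \<mu>))\<^sup>2)"
    using P by (simp add: has_pdf_def)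
  then have "integrable lborel (\<lambda>x. p x *\<^sub>R (norm (x - \<mu>))\<^sup>2)"
    using pdf_measurable(3)[OF P] by (subst (asm) integrable_density) auto
  moreover have "(\<lambda>x. p x *\<^sub>R (norm (x - \<mu>))\<^sup>2) = (\<lambda>x. indicator ?S x *\<^sub>R ((norm (x - \<mu>))\<^sup>2 * p x))"
    using pdf_measurable(3)[OF P] by (auto simp: fun_eq_iff indicator_def pdf_support_def not_less intro: antisym)
  ultimately have v2: "pdf_integrable p (\<lambda>x. (norm (x - \<mu>))\<^sup>2)"
    by (simp add: pdf_integrable_def set_integrable_def)
  obtain K where K: "\<And>x. x \<in> ?S \<Longrightarrow> \<bar>h x\<bar> \<le> K + norm (x - \<mu>)"
  proof (cases "?S = {}")
    case False
    then obtain x0 where x0: "x0 \<in> ?S" by blast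
    have "\<bar>h x\<bar> \<le> (\<bar>h x0\<bar> + norm (x0 - \<mu>)) + norm (x - \<mu>)" if "x \<in> ?S" for x
    proof -
      have "\<bar>h x - h x0\<bar> \<le> norm (x - x0)" using lipschitz_onD[OF lip that x0] by (simp add: dist_norm)
      moreover have "norm (x - x0) \<le> norm (x - \<mu>) + norm (x0 - \<mu>)"
        using norm_triangle_ineq4[of "x - \<mu>" "x0 - \<mu>"] by simp
      ultimately show ?thesis by linarith
    qed
    then show ?thesis using that by blast
  qed (use that in auto)
  have "pdf_integrable p (\<lambda>x. (h x)\<^sup>2)"
  proof (rule pdf_integrable_bound[OF P])
    have [measurable]: "(\<lambda>x. indicator ?S x *\<^sub>R h x) \<in> borel_measurable borel"
      using meas by (simp add: set_borel_measurable_def)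
    have eq: "indicator ?S x *\<^sub>R (h x)\<^sup>2 = (indicator ?S x *\<^sub>R h x)\<^sup>2" for x by (simp add: indicator_def)
    show "set_borel_measurable lborel ?S (\<lambda>x. (h x)\<^sup>2)"
      unfolding set_borel_measurable_def eq by measurable
    show "pdf_integrable p (\<lambda>x. 2 * K\<^sup>2 + 2 * (norm (x - \<mu>))\<^sup>2)"
      by (intro pdf_integrable_add pdf_integrable_cmult v2 pdf_total_mass(1)[OF P])
    show "\<bar>(h x)\<^sup>2\<bar> \<le> 2 * K\<^sup>2 + 2 * (norm (x - \<mu>))\<^sup>2" if "x \<in> ?S" for x
    proof -
      have "\<bar>h x\<bar>\<^sup>2 \<le> (K + norm (x - \<mu>))\<^sup>2" using K[OF that] by (intro power_mono) auto
      then show ?thesis using power2_sum_le[of K "norm (x - \<mu>)"] by simp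
    qed
  qed
  then show ?thesis using meas by (simp add: L2_real_iff)
qed

text \<open>Convolution of \<open>\<psi>\<close> with the indicator of a large ball is constant near \<open>0\<close>.\<close>

lemma integral_pd_test_function:
  fixes \<psi> :: "'a::euclidean_space \<Rightarrow> real"
  assumes s: "smooth \<psi>" "bounded_support \<psi>" and b: "b \<in> Basis"
  shows "(LINT x|lborel. pd b \<psi> x) = 0"
proof -
  obtain R where R: "\<And>x. R \<le> norm x \<Longrightarrow> \<psi> x = 0" using s(2) by (auto simp: bounded_support_def)
  obtain R' where R': "\<And>x. R' \<le> norm x \<Longrightarrow> pd b \<psi> x = 0"
    using bounded_support_pd[OF s(2)] by (auto simp: bounded_support_def)
  \<comment> \<open>For x in the unit ball and y outside \<open>K\<close> the point x - y lies
    beyond \<open>R\<close>, so truncation by the indicator changes nothing; the radius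
    \<open>R'\<close> ensures the same for the derivative at the origin.\<close>
  define K :: "'a set" where "K = cball 0 (max R R' + 1)"
  have "set_integrable lborel K (\<lambda>x::'a. 1::real)"
    unfolding set_integrable_def K_def by (intro borel_integrable_compact) auto
  then have ind: "integrable lborel (indicator K :: 'a \<Rightarrow> real)" by (simp add: set_integrable_def)
  have [measurable]: "\<psi> \<in> borel_measurable borel" "pd b \<psi> \<in> borel_measurable borel"
    using smooth_continuous[OF s(1)] smooth_continuous_pd[OF s(1) b]
    by (auto intro: borel_measurable_continuous_onI)
  have "conv (indicator K) \<psi> x = (LINT y|lborel. \<psi> y)" if "x \<in> ball 0 1" for x
  proof -
    have "indicator K y * \<psi> (x - y) = \<psi> (x - y)" for y
    proof (cases "y \<in> K")
      case False
      then have "R \<le> norm (x - y)" using that norm_triangle_ineq2[of y x] by (auto simp: K_def norm_minus_commute)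
      then show ?thesis using R by simp
    qed simp
    then have "conv (indicator K) \<psi> x = (LINT y|lborel. \<psi> (x - y))"
      unfolding conv_def by presburger
    then show ?thesis using lborel_integral_reflect[of \<psi> x] \<open>\<psi> \<in> borel_measurable borel\<close> by simp
  qed
  then have "pd b (conv (indicator K) \<psi>) 0 = 0"
    by (intro pd_locally_const[of "ball 0 1"]) auto
  moreover have "pd b (conv (indicator K) \<psi>) 0 = conv (indicator K) (pd b \<psi>) 0"
    by (rule fun_cong[OF pd_conv[OF ind s b]])
  moreover have "conv (indicator K) (pd b \<psi>) 0 = (LINT y|lborel. pd b \<psi> (0 - y))"
  proof -
    have "indicator K y * pd b \<psi> (0 - y) = pd b \<psi> (0 - y)" for y
      using R'[of "- y"] by (cases "y \<in> K") (auto simp: K_def)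
    then show ?thesis unfolding conv_def by presburger
  qed
  ultimately show ?thesis using lborel_integral_reflect[of "pd b \<psi>" 0] \<open>pd b \<psi> \<in> borel_measurable borel\<close> by simp
qed

text \<open>The constant is paired with a partial derivative of a test function, whose integral over
  the whole space is 0.\<close>

lemma has_weak_gradient_diff_const:
  fixes u :: "'a::euclidean_space \<Rightarrow> real"
  assumes w: "has_weak_gradient \<Omega> u g"
  shows "has_weak_gradient \<Omega> (\<lambda>x. u x - c) g"
  unfolding has_weak_gradient_def
proof (intro conjI ballI)
  have li: "locally_integrable_on \<Omega> u" using w by (simp add: has_weak_gradient_def)
  have ci: "set_integrable lborel K (\<lambda>x::'a. c)" if "compact K" for K
    using that unfolding set_integrable_def by (intro borel_integrable_compact) auto
  show "locally_integrable_on \<Omega> (\<lambda>x. u x - c)"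
    using li ci unfolding locally_integrable_on_def by (auto intro: set_integral_diff(1))
  show "locally_integrable_on \<Omega> g" using w by (simp add: has_weak_gradient_def)
  fix \<psi> :: "'a \<Rightarrow> real" and b :: 'a assume psi: "\<psi> \<in> test_functions \<Omega>" and b: "b \<in> Basis"
  obtain K where K: "compact K" "K \<subseteq> \<Omega>" "\<And>x. x \<notin> K \<Longrightarrow> \<psi> x = 0" and s: "smooth \<psi>"
    using psi by (auto simp: test_functions_def smooth_def)
  have p0: "pd b \<psi> x = 0" if "x \<notin> K" for x
    by (rule pd_locally_const[of "- K" _ _ 0]) (use that K in \<open>auto intro: open_Compl compact_imp_closed\<close>)
  obtain R where "\<And>x. x \<in> K \<Longrightarrow> norm x \<le> R" using compact_imp_bounded[OF K(1)] bounded_iff by metis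
  then have bs: "bounded_support \<psi>" unfolding bounded_support_def using K(3)
    by (intro exI[of _ "R + 1"]) force
  have i: "integrable lborel (\<lambda>x. pd b \<psi> x * v x)" if "set_integrable lborel K v" for v
    by (rule integrable_mult_compact_support[OF K(1) that smooth_continuous_pd[OF s b] p0])
  have i1: "integrable lborel (\<lambda>x. pd b \<psi> x * u x)" using li K by (intro i) (auto simp: locally_integrable_on_def)
  have i2: "integrable lborel (\<lambda>x. pd b \<psi> x * c)" by (rule i[OF ci[OF K(1)]])
  have S: "(LINT x:\<Omega>|lborel. v x * pd b \<psi> x) = (LINT x|lborel. pd b \<psi> x * v x)" for v
    unfolding set_lebesgue_integral_def using K(2) p0
    by (intro Bochner_Integration.integral_cong) (auto simp: indicator_def)
  have "(LINT x:\<Omega>|lborel. (u x - c) * pd b \<psi> x) = (LINT x|lborel. pd b \<psi> x * u x - pd b \<psi> x * c)"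
    unfolding S by (simp add: right_diff_distrib)
  also have "\<dots> = (LINT x|lborel. pd b \<psi> x * u x)"
    using integral_pd_test_function[OF s bs b] by (subst Bochner_Integration.integral_diff[OF i1 i2]) simp
  also have "\<dots> = (LINT x:\<Omega>|lborel. u x * pd b \<psi> x)" by (rule S[symmetric])
  also have "\<dots> = - (LINT x:\<Omega>|lborel. (g x \<bullet> b) * \<psi> x)"
    using w psi b unfolding has_weak_gradient_def by blast
  finally show "(LINT x:\<Omega>|lborel. (u x - c) * pd b \<psi> x) = - (LINT x:\<Omega>|lborel. (g x \<bullet> b) * \<psi> x)" .
qed

text \<open>An identity of functions and not only almost everywhere: both functions have the same
  set of weak gradients, so \<open>SOME\<close> selects the same representative.\<close>

lemma weak_grad_diff_const:
  fixes u :: "'a::euclidean_space \<Rightarrow> real"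
  shows "weak_grad \<Omega> (\<lambda>x. u x - c) = weak_grad \<Omega> u"
proof -
  have "has_weak_gradient \<Omega> (\<lambda>x. u x - c) = has_weak_gradient \<Omega> u"
    using has_weak_gradient_diff_const[of \<Omega> u _ c] has_weak_gradient_diff_const[of \<Omega> "\<lambda>x. u x - c" _ "- c"]
    by (auto simp: fun_eq_iff)
  then show ?thesis by (simp add: weak_grad_def)
qed

lemma set_integral_pdf:
  fixes f :: "'a::euclidean_space \<Rightarrow> real"
  assumes Q: "has_pdf Q q" and S: "S \<in> sets borel" and f: "set_borel_measurable lborel S f"
  shows "(LINT x:S|Q. f x) = (LINT x:S|lborel. f x * q x)"
proof -
  have [measurable]: "q \<in> borel_measurable borel" using pdf_measurable[OF Q] by simp
  have [measurable]: "(\<lambda>x. indicator S x *\<^sub>R f x) \<in> borel_measurable borel"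
    using f by (simp add: set_borel_measurable_def)
  have "Q = density lborel (\<lambda>x. ennreal (q x))" using Q by (simp add: has_pdf_def)
  then have "(LINT x:S|Q. f x) = (LINT x|density lborel (\<lambda>x. ennreal (q x)). indicator S x *\<^sub>R f x)"
    by (simp add: set_lebesgue_integral_def)
  also have "\<dots> = (LINT x|lborel. q x *\<^sub>R (indicator S x *\<^sub>R f x))"
  proof (rule integral_density)
    show "(\<lambda>x. indicator S x *\<^sub>R f x) \<in> borel_measurable lborel" by measurable
  qed (use pdf_measurable(3)[OF Q] in auto)
  finally show ?thesis by (simp add: set_lebesgue_integral_def mult_ac)
qed

theorem corollary5p16:
  fixes P1 P2 :: "(real ^ 'd) measure"
    and p1 p2 \<pi>0 :: "real ^ 'd \<Rightarrow> real"
  assumes "has_pdf P1 p1"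
    and "has_pdf P2 p2"
    and "pdf_support p2 \<subseteq> pdf_support p1"
    and "\<And>h. h \<in> Lip1 (pdf_support p1) \<Longrightarrow> pdf_integrable p1 (\<lambda>x. \<bar>h x\<bar>)"
    and "finite_variance P1"
    and "satisfies_poincare p1"
    and "\<And>x. x \<in> pdf_support p1 \<Longrightarrow> p2 x = \<pi>0 x * p1 x"
    and "(\<lambda>x. \<pi>0 x - pdf_expectation p1 \<pi>0) \<in> W12_0 p1"
  shows "wasserstein1 (pdf_support p1) P1 P2
           \<le> ereal (poincare_constant p1 *
                sqrt (pdf_expectation p1 (\<lambda>x. (norm (weak_grad (pdf_support p1) \<pi>0 x))\<^sup>2)))"
proof -
  let ?S = "pdf_support p1"
  note P1 = assms(1) and P2 = assms(2)
  define g where "g = weak_grad ?S \<pi>0"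
  define B where "B = pdf_expectation p1 (\<lambda>x. (norm (g x))\<^sup>2)"
  have B0: "0 \<le> B" unfolding B_def by (rule pdf_expectation_nonneg[OF P1]) simp
  \<comment> \<open>The factorisation \<open>p2 = \<pi>0 * p1\<close> is available on
    \<open>?S\<close> only; nestedness of the supports settles the remaining points.\<close>
  have p2_out: "p2 x = 0" if "x \<notin> ?S" for x
    using that assms(3) pdf_measurable(3)[OF P2, of x] by (force simp: pdf_support_def)
  have "pdf_expectation p1 \<pi>0 = (LINT x:pdf_support p2|lborel. 1 * p2 x)"
    unfolding pdf_expectation_def set_lebesgue_integral_def
  proof (intro Bochner_Integration.integral_cong refl)
    show "indicator ?S x *\<^sub>R (\<pi>0 x * p1 x) = indicator (pdf_support p2) x *\<^sub>R (1 * p2 x)" for x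
      using assms(7)[of x] p2_out[of x] pdf_measurable(3)[OF P2, of x]
      by (cases "x \<in> ?S"; cases "x \<in> pdf_support p2") (auto simp: pdf_support_def)
  qed
  \<comment> \<open>The total mass of \<open>P2\<close> identifies the constant subtracted in the
    Sobolev hypothesis, so the centred function there is \<open>w\<close>.\<close>
  then have E1: "pdf_expectation p1 \<pi>0 = 1"
    using pdf_total_mass(2)[OF P2, of 1] by (simp add: pdf_expectation_def)
  define w where "w x = \<pi>0 x - 1" for x
  have W: "w \<in> W12_0 p1" using assms(8) by (simp add: E1 w_def[abs_def])
  have gw: "weak_grad ?S w = g"
    unfolding w_def[abs_def] g_def by (rule weak_grad_diff_const)
  have wL: "w \<in> L2 p1" and gL: "g \<in> L2 p1" and w0: "pdf_expectation p1 w = 0"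
    using W by (auto simp: W12_0_def W12_def gw)
  have "\<exists>g. has_weak_gradient ?S w g"
    using W by (simp add: W12_0_def W12_def weakly_differentiable_on_def)
  then have "has_weak_gradient ?S w (weak_grad ?S w)" unfolding weak_grad_def by (rule someI_ex)
  then have wg: "has_weak_gradient ?S w g" by (simp only: gw)
  have bound: "\<bar>(LINT x:?S|P1. h x) - (LINT x:?S|P2. h x)\<bar> \<le> C * sqrt B"
    if C: "poincare_ineq p1 C" and h: "h \<in> Lip1 ?S" for C h
  proof -
    have C0: "0 \<le> C" using C by (simp add: poincare_ineq_def)
    have hL: "h \<in> L2 p1" by (rule Lip1_in_L2[OF P1 assms(5) h])
    define c where "c = pdf_expectation p1 h"
    have lip: "1-lipschitz_on ?S (\<lambda>x. h x - c)" using h by (simp add: Lip1_def lipschitz_on_def dist_real_def)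
    have kL: "(\<lambda>x. h x - c) \<in> L2 p1" by (rule L2_diff[OF P1 hL L2_const[OF P1]])
    have k0: "pdf_expectation p1 (\<lambda>x. h x - c) = 0"
      using pdf_expectation_diff[OF L2_integrable[OF P1 hL] pdf_total_mass(1)[OF P1, of c]] pdf_total_mass(2)[OF P1, of c]
      by (simp add: c_def)
    have "pdf_nn_expectation p1 (\<lambda>x. (h x - c)\<^sup>2)
        \<le> ennreal C * pdf_nn_expectation p1 (\<lambda>x. (norm (grad (\<lambda>x. h x - c) x))\<^sup>2)"
      using C lipschitz_imp_locally_lipschitz_on[OF lip] kL k0 unfolding poincare_ineq_def by simp
    \<comment> \<open>On the support the gradient of a 1-Lipschitz function has norm at most 1, so
      its Dirichlet energy is at most the total mass 1 of \<open>P1\<close>.\<close>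
    also have "\<dots> \<le> ennreal C * pdf_nn_expectation p1 (\<lambda>x. 1)"
    proof (rule mult_left_mono)
      show "pdf_nn_expectation p1 (\<lambda>x. (norm (grad (\<lambda>x. h x - c) x))\<^sup>2) \<le> pdf_nn_expectation p1 (\<lambda>x. 1)"
        unfolding pdf_nn_expectation_def
      proof (rule nn_integral_mono)
        fix x
        show "ennreal ((norm (grad (\<lambda>x. h x - c) x))\<^sup>2 * p1 x) * indicator ?S x \<le> ennreal (1 * p1 x) * indicator ?S x"
        proof (cases "x \<in> ?S")
          case True
          have "(norm (grad (\<lambda>x. h x - c) x))\<^sup>2 \<le> 1\<^sup>2"
            using norm_grad_lipschitz_le[OF lip pdf_measurable(4)[OF P1] True] by (intro power_mono) auto
          then show ?thesis using True pdf_measurable(3)[OF P1, of x]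
            by (auto intro!: ennreal_leI mult_left_le_one_le)
        qed simp
      qed
    qed simp
    also have "pdf_nn_expectation p1 (\<lambda>x. 1) = 1"
      using pdf_nn_expectation_eq[OF P1 pdf_total_mass(1)[OF P1, of 1]] pdf_total_mass(2)[OF P1, of 1] by simp
    finally have "pdf_nn_expectation p1 (\<lambda>x. (h x - c)\<^sup>2) \<le> ennreal C" by simp
    then have hC: "pdf_expectation p1 (\<lambda>x. (h x - c)\<^sup>2) \<le> C"
      using kL C0 by (simp add: pdf_nn_expectation_eq[OF P1] L2_real_iff)
    have wC: "pdf_expectation p1 (\<lambda>x. (w x)\<^sup>2) \<le> C * B"
      unfolding B_def by (rule poincare_W12[OF P1 C wg wL gL w0])
    have "(pdf_expectation p1 (\<lambda>x. (h x - c) * w x))\<^sup>2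
        \<le> pdf_expectation p1 (\<lambda>x. (h x - c)\<^sup>2) * pdf_expectation p1 (\<lambda>x. (w x)\<^sup>2)"
      by (rule Cauchy_Schwarz_pdf_expectation[OF P1 kL wL])
    \<comment> \<open>The Poincare inequality is used twice, once for each factor; the square root
      of this product is the asserted bound.\<close>
    also have "\<dots> \<le> C * (C * B)"
      using hC wC C0 by (intro mult_mono pdf_expectation_nonneg[OF P1]) auto
    also have "\<dots> = (C * sqrt B)\<^sup>2" using B0 by (simp add: power_mult_distrib power2_eq_square)
    finally have cs: "\<bar>pdf_expectation p1 (\<lambda>x. (h x - c) * w x)\<bar> \<le> C * sqrt B"
      using C0 B0 unfolding abs_le_square_iff[symmetric] by simp
    have hm: "set_borel_measurable lborel ?S h" using hL by (simp add: L2_def)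
    note S = pdf_measurable(2)[OF P1]
    have hw: "pdf_integrable p1 (\<lambda>x. h x * w x)" by (rule L2_mult[OF P1 hL wL])
    have "(LINT x:?S|P1. h x) = pdf_expectation p1 h"
      unfolding pdf_expectation_def by (rule set_integral_pdf[OF P1 S hm])
    \<comment> \<open>On \<open>?S\<close> one has p2 = (w + 1) p1, so the integrals under
      \<open>P2\<close> and \<open>P1\<close> differ by the expectation of h w. Replacing
      \<open>h\<close> by \<open>h - c\<close> leaves it unchanged because \<open>w\<close> has mean
      0.\<close>
    moreover have "(LINT x:?S|lborel. h x * p2 x) = pdf_expectation p1 (\<lambda>x. h x * w x + h x)"
      unfolding pdf_expectation_def set_lebesgue_integral_def
      by (intro Bochner_Integration.integral_cong) (auto simp: assms(7) w_def indicator_def algebra_simps)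
    then have "(LINT x:?S|P2. h x) = pdf_expectation p1 (\<lambda>x. h x * w x + h x)"
      by (simp only: set_integral_pdf[OF P2 S hm])
    moreover have "pdf_expectation p1 (\<lambda>x. h x * w x + h x) = pdf_expectation p1 (\<lambda>x. h x * w x) + pdf_expectation p1 h"
      by (rule pdf_expectation_add[OF hw L2_integrable[OF P1 hL]])
    moreover have "pdf_expectation p1 (\<lambda>x. (h x - c) * w x) = pdf_expectation p1 (\<lambda>x. h x * w x)"
      using pdf_expectation_diff[OF hw pdf_integrable_cmult[OF L2_integrable[OF P1 wL], of c]]
        pdf_expectation_cmult[of p1 c w] w0 by (simp add: left_diff_distrib)
    ultimately show ?thesis using cs by simp
  qed
  have "\<bar>(LINT x:?S|P1. h x) - (LINT x:?S|P2. h x)\<bar> \<le> poincare_constant p1 * sqrt B" if h: "h \<in> Lip1 ?S" for h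
  proof -
    let ?D = "\<bar>(LINT x:?S|P1. h x) - (LINT x:?S|P2. h x)\<bar>"
    have ne: "{C. poincare_ineq p1 C} \<noteq> {}" using assms(6) by (auto simp: satisfies_poincare_def)
    show ?thesis
    \<comment> \<open>Dividing by sqrt B shows that the quotient is a lower bound of all admissible
      constants, hence at most their infimum. If \<open>B = 0\<close>, any admissible constant
      already forces the difference to vanish.\<close>
    proof (cases "B = 0")
      case True
      then show ?thesis using ne bound[OF _ h] by auto
    next
      case False
      then have "sqrt B > 0" using B0 by simp
      moreover have "?D / sqrt B \<le> poincare_constant p1"
        unfolding poincare_constant_def
        using bound[OF _ h] \<open>sqrt B > 0\<close> by (intro cInf_greatest[OF ne]) (auto simp: divide_le_eq)
      ultimately show ?thesis by (simp add: divide_le_eq)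
    qed
  qed
  then show ?thesis
    unfolding wasserstein1_def B_def g_def by (intro SUP_least) simp
qed

end
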